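(* Let $w$ be a vexillary permutation with shape $\mu=\mu(w)$ and supershape $\lambda=\lambda(w)$. Then $\mathfrak{S}_w(1,1,\ldots,1)=|\mathcal{E}(\lambda/\mu)|$.
   Context: $\mathfrak{S}_w$ is the (single) Schubert polynomial of $w$. A permutation is vexillary if it avoids the pattern $2143$. The Rothe diagram of $w\in S_n$ is $D(w)=\{(i,w_j): i<j,\ w_i>w_j\}\subseteq[n]\times[n]$. For vexillary $w$, $\mu(w)$ is the partition obtained by sorting the row lengths of $D(w)$ in decreasing order (up to permuting rows and columns $D(w)$ is the Young diagram of $\mu(w)$), and $\lambda(w)$ is the smallest partition whose Young diagram contains $D(w)$. Excited diagrams $\mathcal{E}(\lambda/\mu)$: subsets of $[\lambda]$ obtained from $[\mu]$ by repeatedly replacing a cell $(i,j)\in D$ by $(i+1,j+1)$ whenever $(i+1,j),(i,j+1),(i+1,j+1)$ all lie in $[\lambda]\setminus D$. *)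

theory Defs
  imports "HOL-Library.Poly_Mapping" "HOL-Combinatorics.Permutations"
begin

text \<open>Integer polynomials in the variables $x_1, x_2, \dots$: finitely supported maps from
  exponent vectors to coefficients.  The variable with index 0 is never used.\<close>

type_synonym zpoly = "(nat \<Rightarrow>\<^sub>0 nat) \<Rightarrow>\<^sub>0 int"

definition var :: "nat \<Rightarrow> zpoly" where
  "var i = Poly_Mapping.single (Poly_Mapping.single i 1) 1"

definition zpoly_eval :: "zpoly \<Rightarrow> (nat \<Rightarrow> int) \<Rightarrow> int" where
  "zpoly_eval f x =
     (\<Sum>m\<in>Poly_Mapping.keys f.
        Poly_Mapping.lookup f m *
        (\<Prod>i\<in>Poly_Mapping.keys m. x i ^ Poly_Mapping.lookup m i))"

text \<open>The inner \<^const>\<open>Poly_Mapping.map_key\<close> permutes the entries of an exponent vector; the outer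
  one applies this to the exponent vectors of a polynomial.\<close>

definition swap_vars :: "nat \<Rightarrow> zpoly \<Rightarrow> zpoly" where
  "swap_vars i f =
     Poly_Mapping.map_key (Poly_Mapping.map_key (transpose i (i + 1))) f"

text \<open>$\partial_i f = (f - s_i f) / (x_i - x_{i+1})$.  The division is exact, and the quotient is
  unique because the polynomial ring is an integral domain.\<close>

definition divided_difference :: "nat \<Rightarrow> zpoly \<Rightarrow> zpoly" where
  "divided_difference i f =
     (THE g. (var i - var (i + 1)) * g = f - swap_vars i f)"

definition longest_perm :: "nat \<Rightarrow> nat \<Rightarrow> nat" where
  "longest_perm n i = (if i \<in> {1..n} then n + 1 - i else i)"

text \<open>Permutations in $S_n$ are functions permuting \<open>{1..n}\<close>, with $w_i$ written \<open>w i\<close>; then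
  $w s_i$ is \<open>w \<circ> transpose i (i + 1)\<close>, and it is shorter than $w$ iff $w_i > w_{i+1}$.\<close>

inductive is_schubert :: "nat \<Rightarrow> (nat \<Rightarrow> nat) \<Rightarrow> zpoly \<Rightarrow> bool" for n :: nat where
  longest: "is_schubert n (longest_perm n) (\<Prod>i = 1..n. var i ^ (n - i))"
| descend: "is_schubert n w f \<Longrightarrow> 1 \<le> i \<Longrightarrow> i < n \<Longrightarrow> w (i + 1) < w i \<Longrightarrow>
    is_schubert n (w \<circ> transpose i (i + 1)) (divided_difference i f)"

text \<open>The result does not depend on the chain of descents leading from the longest permutation
  to $w$, since divided differences satisfy the braid relations.\<close>

definition schubert :: "nat \<Rightarrow> (nat \<Rightarrow> nat) \<Rightarrow> zpoly" where
  "schubert n w = (THE f. is_schubert n w f)"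

definition vexillary :: "nat \<Rightarrow> (nat \<Rightarrow> nat) \<Rightarrow> bool" where
  "vexillary n w \<longleftrightarrow>
     \<not> (\<exists>i j k l. 1 \<le> i \<and> i < j \<and> j < k \<and> k < l \<and> l \<le> n \<and>
          w j < w i \<and> w i < w l \<and> w l < w k)"

definition rothe_diagram :: "nat \<Rightarrow> (nat \<Rightarrow> nat) \<Rightarrow> (nat \<times> nat) set" where
  "rothe_diagram n w = {(i, w j) | i j. 1 \<le> i \<and> i < j \<and> j \<le> n \<and> w j < w i}"

definition is_partition :: "nat list \<Rightarrow> bool" where
  "is_partition p \<longleftrightarrow> sorted_wrt (\<ge>) p \<and> 0 \<notin> set p"

definition young_diagram :: "nat list \<Rightarrow> (nat \<times> nat) set" where
  "young_diagram p = {(i, j). 1 \<le> i \<and> i \<le> length p \<and> 1 \<le> j \<and> j \<le> p ! (i - 1)}"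

text \<open>Empty rows are dropped, so that the parts are positive.\<close>

definition shape :: "nat \<Rightarrow> (nat \<Rightarrow> nat) \<Rightarrow> nat list" where
  "shape n w =
     rev (sort (filter (\<lambda>r. r > 0)
       (map (\<lambda>i. card {j. (i, j) \<in> rothe_diagram n w}) [1..<n + 1])))"

definition supershape :: "nat \<Rightarrow> (nat \<Rightarrow> nat) \<Rightarrow> nat list" where
  "supershape n w =
     (THE p. is_partition p \<and> rothe_diagram n w \<subseteq> young_diagram p \<and>
        (\<forall>q. is_partition q \<and> rothe_diagram n w \<subseteq> young_diagram q \<longrightarrow>
           young_diagram p \<subseteq> young_diagram q))"

inductive_set excited_diagrams :: "nat list \<Rightarrow> nat list \<Rightarrow> (nat \<times> nat) set set"
  for lam :: "nat list" and mu :: "nat list" where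
  initial: "young_diagram mu \<in> excited_diagrams lam mu"
| excite: "D \<in> excited_diagrams lam mu \<Longrightarrow> (i, j) \<in> D \<Longrightarrow>
    {(i + 1, j), (i, j + 1), (i + 1, j + 1)} \<subseteq> young_diagram lam - D \<Longrightarrow>
    insert (i + 1, j + 1) (D - {(i, j)}) \<in> excited_diagrams lam mu"

end

theory Submission
  imports Defs "Jordan_Normal_Form.Determinant"
begin

text \<open>Let \<open>c\<close> be the Lehmer code of a vexillary permutation \<open>w\<close> and \<open>m\<close> its decreasing
  rearrangement. The Schubert polynomial of \<open>w\<close> is the flagged determinant with entries
  \<open>h_{m_r - r + j}(x_1, \<dots>, x_{f_r})\<close>, where \<open>f_r\<close> is the last position \<open>i\<close> with
  \<open>c_i \<ge> m_r\<close> (Wachs). This is proved downwards from the longest permutation: a suitable ascent \<open>k\<close> of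
  \<open>w\<close> leads to a longer vexillary permutation for whose determinant only one row has flag \<open>k\<close>,
  so the divided difference acts on that row alone and turns \<open>h_d(x_1, \<dots>, x_k)\<close> into
  \<open>h_{d-1}(x_1, \<dots>, x_{k+1})\<close>. On the other side, removing an outer corner of the supershape splits the
  excited diagrams according to whether they contain that corner; on determinants this is the recursion
  \<open>h_d(x_1, \<dots>, x_b) = h_d(x_1, \<dots>, x_{b-1}) + x_b h_{d-1}(x_1, \<dots>, x_b)\<close> in a single row,
  where the flag of row \<open>r\<close> is the row in which the diagonal through the last cell of row \<open>r\<close> of the shape
  leaves the supershape. The two flags agree at the last row of each block of equal parts, and the determinant
  depends on nothing else.\<close>

section \<open>Divided differences and Schubert polynomials\<close>

text \<open>Wachs's flags are constant on blocks of equal rows, which stands in the way of acting on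
  one row. Let \<open>C\<close> be the code entry at position \<open>k + 1\<close>. Before the
  divided difference a whole block of rows of length \<open>C + 1\<close> may carry the flag
  \<open>k\<close>; after it a whole block of rows of length \<open>C\<close> carries a common flag
  that may exceed \<open>k + 1\<close>. Spread out as ramps, the two flags differ in one row only.
  This works because earlier entries \<open>C + 1\<close> occur at position \<open>k - 1\<close> at
  most, and because the entries \<open>C\<close> from \<open>k + 1\<close> on are consecutive; the
  choice of the ascent guarantees both.

  The agreement of the two flags is a count of values. If \<open>j\<close> is the last position with
  code at least \<open>v\<close>, and \<open>r\<close> positions have such a code, then
  \<open>j - r\<close> positions up to \<open>j\<close> have a smaller one. These, together with
  \<open>v\<close> inversions, are compared with the values up to the end of row \<open>j\<close> or
  row \<open>j + 1\<close> of the supershape; the bound in row \<open>j + 1\<close> rests on the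
  exclusion of 2143.\<close>

lemma poly_mapping_single_induct [case_names zero add]:
  fixes f :: "'a \<Rightarrow>\<^sub>0 'b::comm_monoid_add"
  assumes zero: "P 0"
    and add: "\<And>k v f. P f \<Longrightarrow> P (Poly_Mapping.single k v + f)"
  shows "P f"
proof (induction f rule: Poly_Mapping.update_induct)
  case const
  show ?case by (rule zero)
next
  case (update f a b)
  have "Poly_Mapping.update a b f = Poly_Mapping.single a b + f"
    using update.hyps(1)
    by (intro poly_mapping_eqI)
      (auto simp: lookup_update lookup_add lookup_single when_def in_keys_iff)
  then show ?case using add update.IH by metis
qed

lemma additive_multiplicativeI:
  fixes F :: "('a::comm_monoid_add \<Rightarrow>\<^sub>0 'b::comm_ring_1) \<Rightarrow> 'c::comm_ring_1"
  assumes zero: "F 0 = 0" and add: "\<And>f g. F (f + g) = F f + F g"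
    and mult: "\<And>k v l u. F (Poly_Mapping.single k v * Poly_Mapping.single l u) =
      F (Poly_Mapping.single k v) * F (Poly_Mapping.single l u)"
  shows "F (f * g) = F f * F g"
proof -
  have "F (Poly_Mapping.single k v * g) = F (Poly_Mapping.single k v) * F g" for k v
    by (induction g rule: poly_mapping_single_induct)
      (simp_all add: zero add mult distrib_left)
  then show ?thesis
    by (induction f rule: poly_mapping_single_induct)
      (simp_all add: zero add distrib_right)
qed

lemma swap_vars_Suc:
  "swap_vars i f = Poly_Mapping.map_key (Poly_Mapping.map_key (transpose i (Suc i))) f"
  by (simp add: swap_vars_def)

lemma comm_ring_hom_swap_vars: "comm_ring_hom (swap_vars i)"
  and swap_vars_var: "swap_vars i (var j) = var (transpose i (Suc i) j)"
  and swap_vars_single: "swap_vars i (Poly_Mapping.single a c) =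
    Poly_Mapping.single (Poly_Mapping.map_key (transpose i (Suc i)) a) c"
proof -
  let ?t = "transpose i (Suc i)"
  let ?G = "Poly_Mapping.map_key ?t :: (nat \<Rightarrow>\<^sub>0 nat) \<Rightarrow> _"
  have t: "inj ?t" by simp
  have GG: "?G (?G a) = a" for a
    using map_key_compose[OF t t, of a] by (simp add: map_key_id id_def)
  have G: "inj ?G" by (metis GG injI)
  show single: "swap_vars i (Poly_Mapping.single a c) = Poly_Mapping.single (?G a) c" for a c
    using map_key_single[OF G, of "?G a" c] by (simp add: swap_vars_Suc GG)
  have Gs: "?G (Poly_Mapping.single j v) = Poly_Mapping.single (?t j) v" for j v
    using map_key_single[OF t, of "?t j" v] by simp
  show "swap_vars i (var j) = var (?t j)"
    by (simp only: var_def single Gs)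
  have zero: "swap_vars i 0 = 0"
    by (simp add: swap_vars_Suc map_key_zero[OF G])
  have add: "swap_vars i (f + g) = swap_vars i f + swap_vars i g" for f g
    by (simp add: swap_vars_Suc map_key_plus[OF G])
  have mult: "swap_vars i (f * g) = swap_vars i f * swap_vars i g" for f g
    by (rule additive_multiplicativeI[OF zero add])
      (simp add: single mult_single map_key_plus[OF t])
  have one: "swap_vars i 1 = 1"
    using single[of 0 1] by (simp add: map_key_zero[OF t])
  show "comm_ring_hom (swap_vars i)"
    by unfold_locales (simp_all add: zero one add mult)
qed

lemma zpoly_eval_ones_single: "zpoly_eval (Poly_Mapping.single a c) (\<lambda>_. 1) = c"
  by (simp add: zpoly_eval_def)

text \<open>At the all-ones point every monomial has value 1, so evaluation is the sum of the
  coefficients, and multiplicativity has to be checked on single terms only.\<close>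

lemma comm_ring_hom_zpoly_eval_ones: "comm_ring_hom (\<lambda>f. zpoly_eval f (\<lambda>_. 1))"
proof -
  let ?E = "\<lambda>f. zpoly_eval f (\<lambda>_. 1)"
  have zero: "?E 0 = 0" by (simp add: zpoly_eval_def)
  have add: "?E (f + g) = ?E f + ?E g" for f g
    using setsum_keys_plus_distrib[of "\<lambda>k v. v" f g] by (simp add: zpoly_eval_def)
  have mult: "?E (f * g) = ?E f * ?E g" for f g
    by (rule additive_multiplicativeI[of ?E, OF zero add])
      (simp add: zpoly_eval_ones_single mult_single)
  have one: "?E 1 = 1"
    using zpoly_eval_ones_single[of 0 1] by simp
  show ?thesis
    by unfold_locales (simp_all add: zero one add mult)
qed

lemma swap_vars_involutive [simp]: "swap_vars i (swap_vars i f) = f"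
proof -
  interpret comm_ring_hom "swap_vars i" by (rule comm_ring_hom_swap_vars)
  let ?t = "transpose i (Suc i)"
  have t: "inj ?t" by simp
  have GG: "Poly_Mapping.map_key ?t (Poly_Mapping.map_key ?t a) = a" for a :: "nat \<Rightarrow>\<^sub>0 nat"
    using map_key_compose[OF t t, of a] by (simp add: map_key_id id_def)
  show ?thesis
    by (induction f rule: poly_mapping_single_induct) (simp_all only: hom_zero hom_add swap_vars_single GG)
qed

text \<open>The variables generate the ring of integer polynomials. Divisibility of
  \<open>f - swap_vars i f\<close> and equality of ring homomorphisms are tested on variables in
  this way.\<close>

lemma zpoly_var_induct [case_names zero one var add uminus mult]:
  fixes f :: zpoly
  assumes zero: "P 0" and one: "P 1" and var: "\<And>i. P (var i)"
    and add: "\<And>f g. P f \<Longrightarrow> P g \<Longrightarrow> P (f + g)"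
    and uminus: "\<And>f. P f \<Longrightarrow> P (- f)"
    and mult: "\<And>f g. P f \<Longrightarrow> P g \<Longrightarrow> P (f * g)"
  shows "P f"
proof -
  have nat: "P (of_nat c)" for c
    by (induction c) (simp_all add: zero one add)
  have int: "P (of_int c)" for c
    by (cases c rule: int_cases2) (simp_all add: nat uminus)
  have power: "P (var i ^ e)" for i e
    by (induction e) (simp_all add: one var mult)
  have var_power: "var i ^ e = Poly_Mapping.single (Poly_Mapping.single i e) 1" for i e
    by (induction e) (simp_all add: var_def mult_single single_add[symmetric])
  have monom: "P (Poly_Mapping.single a 1)" for a
  proof (induction a rule: poly_mapping_single_induct)
    case zero
    show ?case using one by simp
  next
    case (add k v a)
    have "Poly_Mapping.single (Poly_Mapping.single k v + a) 1 =
      var k ^ v * (Poly_Mapping.single a 1 :: zpoly)"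
      by (simp add: var_power mult_single)
    then show ?case using add power mult by metis
  qed
  have "P (Poly_Mapping.single a c)" for a c
  proof -
    have "Poly_Mapping.single a c = of_int c * Poly_Mapping.single a (1::int)"
      by (simp flip: single_of_int add: mult_single)
    then show ?thesis using mult int monom by metis
  qed
  then show ?thesis
    by (induction f rule: poly_mapping_single_induct) (simp_all add: zero add)
qed

lemma var_inject [simp]: "var i = var j \<longleftrightarrow> i = j"
proof
  assume "var i = var j"
  then have "Poly_Mapping.keys (var i) = Poly_Mapping.keys (var j)" by simp
  then have "Poly_Mapping.single i (1::nat) = Poly_Mapping.single j 1"
    by (simp add: var_def)
  then have "Poly_Mapping.keys (Poly_Mapping.single i (1::nat)) = Poly_Mapping.keys (Poly_Mapping.single j (1::nat))"
    by simp
  then show "i = j" by simp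
qed simp

section \<open>Exactness of the division and the braid relations\<close>

lemma divided_difference_eqI:
  assumes "(var i - var (Suc i)) * g = f - swap_vars i f"
  shows "divided_difference i f = g"
  unfolding divided_difference_def Suc_eq_plus1[symmetric]
proof (rule the_equality)
  show "(var i - var (Suc i)) * g = f - swap_vars i f" by fact
next
  fix h assume "(var i - var (Suc i)) * h = f - swap_vars i f"
  then have "(var i - var (Suc i)) * h = (var i - var (Suc i)) * g" using assms by simp
  moreover have "var i - var (Suc i) \<noteq> 0" by simp
  ultimately show "h = g" by (metis mult_left_cancel)
qed

text \<open>The polynomials for which the division is exact are closed under products by the twisted
  Leibniz rule, and they contain the variables.\<close>

lemma divided_difference_mult:
  "(var i - var (Suc i)) * divided_difference i f = f - swap_vars i f"
proof -
  interpret comm_ring_hom "swap_vars i" by (rule comm_ring_hom_swap_vars)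
  have "var i - var (Suc i) dvd f - swap_vars i f"
  proof (induction f rule: zpoly_var_induct)
    case (var j)
    consider "j = i" | "j = Suc i" | "j \<noteq> i" "j \<noteq> Suc i" by blast
    then show ?case
    proof cases
      case 2
      then have "var j - swap_vars i (var j) = (var i - var (Suc i)) * (-1)"
        by (simp add: swap_vars_var)
      then show ?thesis by (metis dvd_triv_left)
    qed (simp_all add: swap_vars_var)
  next
    case (add f g)
    have "f + g - swap_vars i (f + g) = (f - swap_vars i f) + (g - swap_vars i g)"
      by (simp add: hom_add)
    then show ?case using add by (metis dvd_add)
  next
    case (uminus f)
    have "- f - swap_vars i (- f) = - (f - swap_vars i f)"
      by (simp add: hom_uminus)
    then show ?case using uminus by (metis dvd_minus_iff)
  next
    case (mult f g)
    have "f * g - swap_vars i (f * g) = (f - swap_vars i f) * g + swap_vars i f * (g - swap_vars i g)"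
      by (simp add: hom_mult algebra_simps)
    then show ?case using mult by (metis dvd_add dvd_mult dvd_mult2)
  qed simp_all
  then obtain g where "f - swap_vars i f = (var i - var (Suc i)) * g" by (elim dvdE)
  then show ?thesis using divided_difference_eqI by metis
qed

text \<open>Both \<open>var i - var (Suc i)\<close> and \<open>f - swap_vars i f\<close> change sign
  under the swap, so their quotient is fixed.\<close>

lemma swap_vars_divided_difference: "swap_vars i (divided_difference i f) = divided_difference i f"
proof -
  interpret comm_ring_hom "swap_vars i" by (rule comm_ring_hom_swap_vars)
  let ?g = "divided_difference i f"
  have nz: "var (Suc i) - var i \<noteq> 0" by simp
  have "swap_vars i ((var i - var (Suc i)) * ?g) = swap_vars i f - f"
    by (simp add: divided_difference_mult hom_minus)
  then have "(var (Suc i) - var i) * swap_vars i ?g = - (f - swap_vars i f)"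
    by (simp add: hom_mult hom_minus swap_vars_var)
  also have "\<dots> = (var (Suc i) - var i) * ?g"
    unfolding divided_difference_mult[symmetric] by (simp add: algebra_simps)
  finally show ?thesis by (rule mult_left_cancel[OF nz, THEN iffD1])
qed

lemma zpoly_hom_eqI:
  fixes F G :: "zpoly \<Rightarrow> zpoly"
  assumes "comm_ring_hom F" "comm_ring_hom G" "\<And>j. F (var j) = G (var j)"
  shows "F f = G f"
proof -
  interpret F: comm_ring_hom F by fact
  interpret G: comm_ring_hom G by fact
  show ?thesis
    by (induction f rule: zpoly_var_induct)
      (simp_all add: assms(3) F.hom_add G.hom_add F.hom_mult G.hom_mult F.hom_uminus G.hom_uminus)
qed

lemma comm_ring_hom_compose:
  assumes "comm_ring_hom F" "comm_ring_hom G"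
  shows "comm_ring_hom (\<lambda>x. F (G x))"
proof -
  interpret F: comm_ring_hom F by fact
  interpret G: comm_ring_hom G by fact
  show ?thesis
    by unfold_locales (simp_all add: F.hom_add G.hom_add F.hom_mult G.hom_mult)
qed

lemma swap_vars_commute:
  assumes "Suc i < j"
  shows "swap_vars i (swap_vars j f) = swap_vars j (swap_vars i f)"
proof (rule zpoly_hom_eqI[of "\<lambda>f. swap_vars i (swap_vars j f)"])
  fix k
  consider "k = i" | "k = Suc i" | "k = j" | "k = Suc j" | "k \<notin> {i, Suc i, j, Suc j}" by blast
  then show "swap_vars i (swap_vars j (var k)) = swap_vars j (swap_vars i (var k))"
    using assms by cases (simp_all add: swap_vars_var transpose_def)
qed (rule comm_ring_hom_compose[OF comm_ring_hom_swap_vars comm_ring_hom_swap_vars])+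

lemma swap_vars_braid:
  "swap_vars i (swap_vars (Suc i) (swap_vars i f)) =
   swap_vars (Suc i) (swap_vars i (swap_vars (Suc i) f))"
proof (rule zpoly_hom_eqI[of "\<lambda>f. swap_vars i (swap_vars (Suc i) (swap_vars i f))"])
  fix j
  consider "j = i" | "j = Suc i" | "j = Suc (Suc i)" | "j \<notin> {i, Suc i, Suc (Suc i)}" by blast
  then show "swap_vars i (swap_vars (Suc i) (swap_vars i (var j))) =
      swap_vars (Suc i) (swap_vars i (swap_vars (Suc i) (var j)))"
    by cases (simp_all add: swap_vars_var transpose_def)
qed (rule comm_ring_hom_compose[OF comm_ring_hom_swap_vars
  comm_ring_hom_compose[OF comm_ring_hom_swap_vars comm_ring_hom_swap_vars]])+

lemma divided_difference_commute:
  assumes "Suc i < j"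
  shows "divided_difference i (divided_difference j f) = divided_difference j (divided_difference i f)"
proof -
  interpret s: comm_ring_hom "swap_vars i" by (rule comm_ring_hom_swap_vars)
  interpret t: comm_ring_hom "swap_vars j" by (rule comm_ring_hom_swap_vars)
  define a where "a = var i - var (Suc i)"
  define b where "b = var j - var (Suc j)"
  have nz: "a * b \<noteq> 0" by (simp add: a_def b_def)
  have sb: "swap_vars i b = b" and ta: "swap_vars j a = a"
    using assms by (simp_all add: a_def b_def s.hom_minus t.hom_minus swap_vars_var transpose_def)
  have 1: "a * (b * divided_difference i (divided_difference j f)) =
      f - swap_vars j f - swap_vars i (f - swap_vars j f)"
  proof -
    have "a * (b * divided_difference i (divided_difference j f)) =
        b * (divided_difference j f - swap_vars i (divided_difference j f))"
      using divided_difference_mult[of i "divided_difference j f"] by (simp add: a_def ac_simps)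
    also have "\<dots> = b * divided_difference j f - swap_vars i (b * divided_difference j f)"
      by (simp add: s.hom_mult sb algebra_simps)
    finally show ?thesis
      using divided_difference_mult[of j f] by (simp add: b_def)
  qed
  have 2: "a * (b * divided_difference j (divided_difference i f)) =
      f - swap_vars i f - swap_vars j (f - swap_vars i f)"
  proof -
    have "a * (b * divided_difference j (divided_difference i f)) =
        a * (divided_difference i f - swap_vars j (divided_difference i f))"
      using divided_difference_mult[of j "divided_difference i f"] by (simp add: b_def)
    also have "\<dots> = a * divided_difference i f - swap_vars j (a * divided_difference i f)"
      by (simp add: t.hom_mult ta algebra_simps)
    finally show ?thesis
      using divided_difference_mult[of i f] by (simp add: a_def)
  qed
  have "(a * b) * divided_difference i (divided_difference j f) =
      (a * b) * divided_difference j (divided_difference i f)"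
    using 1 2 swap_vars_commute[OF assms, of f]
    by (simp add: mult.assoc s.hom_minus t.hom_minus)
  then show ?thesis by (rule mult_left_cancel[OF nz, THEN iffD1])
qed

text \<open>Multiplying a threefold divided difference by the Vandermonde product of the three variables
  gives the antisymmetrization, in which the two sides of the braid relation agree.\<close>

lemma divided_difference_antisymmetrization:
  fixes f :: zpoly
  assumes s: "comm_ring_hom s" and t: "comm_ring_hom t"
    and sa: "s a = - a" and ta: "t a = a + b" and sb: "s b = a + b"
    and g1: "a * g1 = f - s f" and g2: "b * g2 = g1 - t g1" and g3: "a * g3 = g2 - s g2"
    and sg1: "s g1 = g1"
  shows "a * b * (a + b) * g3 = f - s f - t f + t (s f) + s (t f) - s (t (s f))"
proof -
  interpret s: comm_ring_hom s by fact
  interpret t: comm_ring_hom t by fact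
  have "(a + b) * s g2 = g1 - s (t g1)"
    using arg_cong[OF g2, of s] by (simp add: s.hom_mult s.hom_minus sb sg1)
  have "a * b * (a + b) * g3 = b * (a + b) * (a * g3)"
    by (simp add: ac_simps)
  also have "\<dots> = (a + b) * (b * g2) - b * ((a + b) * s g2)"
    unfolding g3 by (simp add: algebra_simps)
  also have "\<dots> = (a + b) * (g1 - t g1) - b * (g1 - s (t g1))"
    by (simp only: g2 \<open>(a + b) * s g2 = g1 - s (t g1)\<close>)
  also have "\<dots> = a * g1 - (a + b) * t g1 + b * s (t g1)"
    by (simp add: algebra_simps)
  also have "(a + b) * t g1 = t f - t (s f)"
    using arg_cong[OF g1, of t] by (simp add: t.hom_mult t.hom_minus ta)
  also have "b * s (t g1) = s (t f) - s (t (s f))"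
  proof -
    have "s (t (a * g1)) = b * s (t g1)"
      by (simp add: s.hom_mult t.hom_mult s.hom_add ta sa sb)
    then show ?thesis using g1 by (simp add: s.hom_minus t.hom_minus)
  qed
  finally show ?thesis using g1 by simp
qed

lemma divided_difference_braid:
  "divided_difference i (divided_difference (Suc i) (divided_difference i f)) =
   divided_difference (Suc i) (divided_difference i (divided_difference (Suc i) f))"
proof -
  interpret s: comm_ring_hom "swap_vars i" by (rule comm_ring_hom_swap_vars)
  interpret t: comm_ring_hom "swap_vars (Suc i)" by (rule comm_ring_hom_swap_vars)
  define a where "a = var i - var (Suc i)"
  define b where "b = var (Suc i) - var (Suc (Suc i))"
  have nz: "a * b * (a + b) \<noteq> 0" by (simp add: a_def b_def)
  have ab: "swap_vars i a = - a" "swap_vars i b = a + b"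
    "swap_vars (Suc i) a = b + a" "swap_vars (Suc i) b = - b"
    by (simp_all add: a_def b_def s.hom_minus t.hom_minus swap_vars_var transpose_def)
  have dd: "a * divided_difference i g = g - swap_vars i g"
    "b * divided_difference (Suc i) g = g - swap_vars (Suc i) g" for g
    by (simp_all only: a_def b_def divided_difference_mult)
  have 1: "a * b * (a + b) * divided_difference i (divided_difference (Suc i) (divided_difference i f)) =
      f - swap_vars i f - swap_vars (Suc i) f + swap_vars (Suc i) (swap_vars i f)
      + swap_vars i (swap_vars (Suc i) f) - swap_vars i (swap_vars (Suc i) (swap_vars i f))"
    by (rule divided_difference_antisymmetrization[OF comm_ring_hom_swap_vars comm_ring_hom_swap_vars
      ab(1) ab(3)[unfolded add.commute[of b]] ab(2) dd(1) dd(2) dd(1)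
      swap_vars_divided_difference])
  have 2: "b * a * (b + a) * divided_difference (Suc i) (divided_difference i (divided_difference (Suc i) f)) =
      f - swap_vars (Suc i) f - swap_vars i f + swap_vars i (swap_vars (Suc i) f)
      + swap_vars (Suc i) (swap_vars i f) - swap_vars (Suc i) (swap_vars i (swap_vars (Suc i) f))"
    by (rule divided_difference_antisymmetrization[OF comm_ring_hom_swap_vars comm_ring_hom_swap_vars
      ab(4) ab(2)[unfolded add.commute[of a]] ab(3) dd(2) dd(1) dd(2)
      swap_vars_divided_difference])
  have comm: "a * b * (a + b) = b * a * (b + a)"
    by (simp only: mult.commute add.commute)
  have "a * b * (a + b) * divided_difference i (divided_difference (Suc i) (divided_difference i f)) =
    a * b * (a + b) * divided_difference (Suc i) (divided_difference i (divided_difference (Suc i) f))"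
    unfolding 1 2[folded comm] swap_vars_braid[of i f] by simp
  then show ?thesis by (rule mult_left_cancel[OF nz, THEN iffD1])
qed


section \<open>Climbing to the longest permutation, and uniqueness of Schubert polynomials\<close>

lemma longest_perm_permutes: "longest_perm n permutes {1..n}"
proof -
  have "longest_perm n (longest_perm n i) = i" for i
    by (auto simp: longest_perm_def)
  then have "bij (longest_perm n)" by (intro o_bij[of "longest_perm n"]) auto
  moreover have "longest_perm n i = i" if "i \<notin> {1..n}" for i
    using that by (auto simp: longest_perm_def)
  ultimately show ?thesis unfolding permutes_def bij_iff by simp
qed

lemma permutes_compose_transpose:
  assumes "w permutes {1..n}" "1 \<le> k" "k < n"
  shows "w \<circ> transpose k (Suc k) permutes {1..n}"
  by (rule permutes_compose[OF permutes_swap_id assms(1)]) (use assms in auto)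

lemma is_schubert_permutes: "is_schubert n w f \<Longrightarrow> w permutes {1..n}"
proof (induction rule: is_schubert.induct)
  case longest
  show ?case by (rule longest_perm_permutes)
next
  case (descend w f i)
  then show ?case using permutes_compose_transpose[of w n i] by (simp add: comp_def)
qed

lemma is_schubert_descend:
  assumes "is_schubert n (w \<circ> transpose k (Suc k)) f" "1 \<le> k" "k < n" "w k < w (Suc k)"
  shows "is_schubert n w (divided_difference k f)"
proof -
  have "is_schubert n ((w \<circ> transpose k (k + 1)) \<circ> transpose k (k + 1)) (divided_difference k f)"
    by (rule is_schubert.descend) (use assms in auto)
  moreover have "(w \<circ> transpose k (k + 1)) \<circ> transpose k (k + 1) = w"
    by (auto simp: fun_eq_iff)
  ultimately show ?thesis by simp
qed

lemma eq_longest_perm: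
  assumes w: "w permutes {1..n}" and desc: "\<And>k. 1 \<le> k \<Longrightarrow> k < n \<Longrightarrow> w (Suc k) < w k"
  shows "w = longest_perm n"
proof
  fix i
  have "w i = n + 1 - i" if i: "i \<in> {1..n}"
  proof (rule antisym)
    have "1 \<le> i \<longrightarrow> i \<le> n \<longrightarrow> w i + i \<le> n + 1"
    proof (induction i)
      case (Suc i)
      have "w 1 \<le> n" if "1 \<le> n" using permutes_in_image[OF w, of 1] that by simp
      then show ?case using Suc desc[of i] by (cases "i = 0") auto
    qed simp
    then show "w i \<le> n + 1 - i" using i by auto
    have "d < n \<longrightarrow> d + 1 \<le> w (n - d)" for d
    proof (induction d)
      case 0
      then show ?case using permutes_in_image[OF w, of n] by auto
    next
      case (Suc d)
      show ?case
      proof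
        assume "Suc d < n"
        moreover have "Suc (n - Suc d) = n - d" using \<open>Suc d < n\<close> by simp
        ultimately show "Suc d + 1 \<le> w (n - Suc d)"
          using Suc desc[of "n - Suc d"] by (simp add: Suc_le_eq less_trans_Suc)
      qed
    qed
    from this[of "n - i"] show "n + 1 - i \<le> w i" using i by auto
  qed
  then show "w i = longest_perm n i"
    using permutes_not_in[OF w] by (auto simp: longest_perm_def)
qed

text \<open>A termination measure in place of the length: as in the rearrangement inequality, the
  exchange at an ascent \<open>k\<close> lowers it, by \<open>w (Suc k) - w k\<close>.\<close>

definition perm_weight :: "nat \<Rightarrow> (nat \<Rightarrow> nat) \<Rightarrow> nat" where
  "perm_weight n w = (\<Sum>i = 1..n. i * w i)"

lemma perm_weight_ascent:
  assumes k: "1 \<le> k" "k < n" and asc: "w k < w (Suc k)"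
  shows "perm_weight n (w \<circ> transpose k (Suc k)) < perm_weight n w"
proof -
  have split: "(\<Sum>i = 1..n. g i) = g k + g (Suc k) + (\<Sum>i \<in> {1..n} - {k, Suc k}. g i)" for g :: "nat \<Rightarrow> nat"
  proof -
    have "(\<Sum>i = 1..n. g i) = (\<Sum>i \<in> {k, Suc k}. g i) + (\<Sum>i \<in> {1..n} - {k, Suc k}. g i)"
      using k by (intro sum.subset_diff[THEN trans[OF _ add.commute]]) auto
    then show ?thesis by simp
  qed
  have rest: "(\<Sum>i \<in> {1..n} - {k, Suc k}. i * (w \<circ> transpose k (Suc k)) i) =
    (\<Sum>i \<in> {1..n} - {k, Suc k}. i * w i)"
    by (rule sum.cong) auto
  have "k * w (Suc k) + Suc k * w k < k * w k + Suc k * w (Suc k)"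
    using asc by simp
  then show ?thesis
    unfolding perm_weight_def split rest by simp
qed

lemma perm_ascent_induct [consumes 1, case_names longest ascent]:
  assumes "w permutes {1..n}"
    and "P (longest_perm n)"
    and "\<And>w. w permutes {1..n} \<Longrightarrow> \<exists>k. 1 \<le> k \<and> k < n \<and> w k < w (Suc k) \<Longrightarrow>
      (\<And>k. 1 \<le> k \<Longrightarrow> k < n \<Longrightarrow> w k < w (Suc k) \<Longrightarrow> P (w \<circ> transpose k (Suc k))) \<Longrightarrow> P w"
  shows "P w"
  using assms(1)
proof (induction "perm_weight n w" arbitrary: w rule: less_induct)
  case less
  show ?case
  proof (cases "\<exists>k. 1 \<le> k \<and> k < n \<and> w k < w (Suc k)")
    case True
    show ?thesis
    proof (rule assms(3)[OF less.prems True])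
      fix k assume "1 \<le> k" "k < n" "w k < w (Suc k)"
      then show "P (w \<circ> transpose k (Suc k))"
        using less.hyps perm_weight_ascent permutes_compose_transpose less.prems by blast
    qed
  next
    case False
    have "w (Suc k) < w k" if "1 \<le> k" "k < n" for k
      using False that permutes_inj[OF less.prems] by (metis inj_eq linorder_neqE_nat n_not_Suc_n)
    then show ?thesis using eq_longest_perm[OF less.prems] assms(2) by simp
  qed
qed

lemma is_schubert_exists: "w permutes {1..n} \<Longrightarrow> \<exists>f. is_schubert n w f"
proof (induction rule: perm_ascent_induct)
  case longest
  show ?case using is_schubert.longest by blast
next
  case (ascent w)
  then show ?case using is_schubert_descend by blast
qed

lemma is_schubert_cases:
  assumes "is_schubert n w f"
  obtains (longest) "w = longest_perm n" "f = (\<Prod>i = 1..n. var i ^ (n - i))"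
    | (descend) k g where "1 \<le> k" "k < n" "w k < w (Suc k)"
      "is_schubert n (w \<circ> transpose k (Suc k)) g" "f = divided_difference k g"
  using assms
proof (cases rule: is_schubert.cases)
  case longest
  then show ?thesis using that(1) by blast
next
  case (descend u g k)
  have "u = w \<circ> transpose k (Suc k)" using descend(1) by (auto simp: fun_eq_iff)
  then show ?thesis using that(2)[of k g] descend by auto
qed

lemma is_schubert_unique:
  assumes "w permutes {1..n}" "is_schubert n w f" "is_schubert n w g"
  shows "f = g"
  using assms
proof (induction arbitrary: f g rule: perm_ascent_induct)
  case longest
  have no_ascent: "\<not> longest_perm n k < longest_perm n (Suc k)" if "1 \<le> k" "k < n" for k
    using that by (auto simp: longest_perm_def)
  have "h = (\<Prod>i = 1..n. var i ^ (n - i))" if "is_schubert n (longest_perm n) h" for h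
    by (rule is_schubert_cases[OF that]) (use no_ascent in blast)+
  then show ?case using longest by metis
next
  case (ascent w)
  have not_longest: "w \<noteq> longest_perm n"
    using ascent.hyps(2) by (auto simp: longest_perm_def)
  have cases: "\<exists>k h. 1 \<le> k \<and> k < n \<and> w k < w (Suc k) \<and>
      is_schubert n (w \<circ> transpose k (Suc k)) h \<and> F = divided_difference k h"
    if "is_schubert n w F" for F
    by (rule is_schubert_cases[OF that]) (use not_longest in blast)+
  \<comment> \<open>Any two ascents of \<open>w\<close> are joined by a common longer permutation \<open>z\<close>, below which
    the two chains of divided differences agree by the commutation and braid relations.\<close>
  have main: "divided_difference i f' = divided_difference j g'"
    if ij: "1 \<le> i" "j < n" "i < j" "w i < w (Suc i)" "w j < w (Suc j)"
      and f': "is_schubert n (w \<circ> transpose i (Suc i)) f'"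
      and g': "is_schubert n (w \<circ> transpose j (Suc j)) g'" for i j f' g'
  proof (cases "j = Suc i")
    case True
    \<comment> \<open>Ascents at \<open>i\<close> and \<open>i + 1\<close> mean that
      \<open>w\<close> increases on three consecutive positions. Here \<open>z\<close> reverses
      them, so every step of either chain from \<open>w\<close> to \<open>z\<close> is an
      ascent.\<close>
    define z where "z = w \<circ> transpose i (Suc i) \<circ> transpose j (Suc j) \<circ> transpose i (Suc i)"
    have "z permutes {1..n}"
      using ascent.hyps(1) ij unfolding z_def by (intro permutes_compose_transpose) auto
    then obtain h where h: "is_schubert n z h" using is_schubert_exists by blast
    have z': "z = w \<circ> transpose j (Suc j) \<circ> transpose i (Suc i) \<circ> transpose j (Suc j)"
      by (auto simp: z_def True fun_eq_iff transpose_def)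
    have "is_schubert n (w \<circ> transpose i (Suc i))
        (divided_difference j (divided_difference i h))"
      using h ij True unfolding z_def
      by (intro is_schubert_descend) (auto simp: transpose_def)
    then have 1: "f' = divided_difference j (divided_difference i h)"
      using ascent.IH[of i] f' ij by (auto simp: comp_def)
    have "is_schubert n (w \<circ> transpose j (Suc j))
        (divided_difference i (divided_difference j h))"
      using h ij True unfolding z'
      by (intro is_schubert_descend) (auto simp: transpose_def)
    then have 2: "g' = divided_difference i (divided_difference j h)"
      using ascent.IH[of j] g' ij by (auto simp: comp_def)
    show ?thesis unfolding 1 2 using True divided_difference_braid by simp
  next
    case False
    define z where "z = w \<circ> transpose i (Suc i) \<circ> transpose j (Suc j)"
    have "z permutes {1..n}"
      using ascent.hyps(1) ij unfolding z_def by (intro permutes_compose_transpose) auto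
    then obtain h where h: "is_schubert n z h" using is_schubert_exists by blast
    have z': "z = w \<circ> transpose j (Suc j) \<circ> transpose i (Suc i)"
      using False ij by (auto simp: z_def fun_eq_iff transpose_def)
    have "is_schubert n (w \<circ> transpose i (Suc i)) (divided_difference j h)"
      using h ij False unfolding z_def
      by (intro is_schubert_descend) (auto simp: transpose_def)
    then have 1: "f' = divided_difference j h"
      using ascent.IH[of i] f' ij by (auto simp: comp_def)
    have "is_schubert n (w \<circ> transpose j (Suc j)) (divided_difference i h)"
      using h ij False unfolding z'
      by (intro is_schubert_descend) (auto simp: transpose_def)
    then have 2: "g' = divided_difference i h"
      using ascent.IH[of j] g' ij by (auto simp: comp_def)
    show ?thesis unfolding 1 2 using False ij divided_difference_commute[of i j] by simp
  qed
  obtain i f' where i: "1 \<le> i" "i < n" "w i < w (Suc i)"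
    "is_schubert n (w \<circ> transpose i (Suc i)) f'" "f = divided_difference i f'"
    using cases[OF ascent.prems(1)] by blast
  obtain j g' where j: "1 \<le> j" "j < n" "w j < w (Suc j)"
    "is_schubert n (w \<circ> transpose j (Suc j)) g'" "g = divided_difference j g'"
    using cases[OF ascent.prems(2)] by blast
  consider "i < j" | "j < i" | "i = j" by linarith
  then show ?case
  proof cases
    case 1
    then show ?thesis using main[of i j f' g'] i j by simp
  next
    case 2
    then show ?thesis using main[of j i g' f'] i j by simp
  next
    case 3
    then show ?thesis using ascent.IH[of i f' g'] i j by (simp add: comp_def)
  qed
qed

lemma schubert_eqI: "is_schubert n w f \<Longrightarrow> schubert n w = f"
  unfolding schubert_def by (rule the_equality) (auto intro: is_schubert_unique is_schubert_permutes)

section \<open>Flagged determinants\<close>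

definition rdet :: "nat \<Rightarrow> (nat \<Rightarrow> nat \<Rightarrow> 'a::comm_ring_1) \<Rightarrow> 'a" where
  "rdet n M = det (mat n n (\<lambda>(i, j). M (Suc i) (Suc j)))"

lemma rdet_cong:
  assumes "\<And>i j. 1 \<le> i \<Longrightarrow> i \<le> n \<Longrightarrow> 1 \<le> j \<Longrightarrow> j \<le> n \<Longrightarrow> M i j = M' i j"
  shows "rdet n M = rdet n M'"
  unfolding rdet_def by (rule arg_cong[of _ _ det], rule eq_matI) (auto intro!: assms)

lemma rdet_hom:
  assumes "comm_ring_hom h"
  shows "h (rdet n M) = rdet n (\<lambda>i j. h (M i j))"
proof -
  interpret comm_ring_hom h by fact
  show ?thesis
    unfolding rdet_def hom_det[symmetric] by (rule arg_cong[of _ _ det], rule eq_matI) auto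
qed

lemma rdet_linear:
  fixes M A B :: "nat \<Rightarrow> nat \<Rightarrow> 'a::comm_ring_1"
  assumes r: "1 \<le> r" "r \<le> n"
    and row: "\<And>j. M r j = A r j + c * B r j"
    and rest: "\<And>i j. i \<noteq> r \<Longrightarrow> A i j = M i j" "\<And>i j. i \<noteq> r \<Longrightarrow> B i j = M i j"
  shows "rdet n M = rdet n A + c * rdet n B"
proof -
  let ?F = "\<lambda>N p. signof p * (\<Prod>i = 0..<n. N (Suc i) (Suc (p i))) :: 'a"
  have det: "rdet n N = (\<Sum>p \<in> {p. p permutes {0..<n}}. ?F N p)" for N
    unfolding rdet_def by (subst det_def'[of _ n]) 
      (auto intro!: sum.cong prod.cong arg_cong2[of _ _ _ _ times]
        simp: permutes_in_image[of _ "{0..<n}", simplified])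
  have "?F M p = ?F A p + c * ?F B p" for p
  proof -
    have split: "(\<Prod>i = 0..<n. N (Suc i) (Suc (p i))) =
        N r (Suc (p (r - 1))) * (\<Prod>i \<in> {0..<n} - {r - 1}. N (Suc i) (Suc (p i)))" for N :: "nat \<Rightarrow> nat \<Rightarrow> 'a"
      using r by (subst prod.remove[of _ "r - 1"]) auto
    have same: "(\<Prod>i \<in> {0..<n} - {r - 1}. N (Suc i) (Suc (p i))) =
        (\<Prod>i \<in> {0..<n} - {r - 1}. M (Suc i) (Suc (p i)))"
      if "\<And>i j. i \<noteq> r \<Longrightarrow> N i j = M i j" for N
      by (rule prod.cong) (use that r in auto)
    have A: "(\<Prod>i \<in> {0..<n} - {r - 1}. A (Suc i) (Suc (p i))) =
        (\<Prod>i \<in> {0..<n} - {r - 1}. M (Suc i) (Suc (p i)))"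
      by (rule same) (rule rest)
    have B: "(\<Prod>i \<in> {0..<n} - {r - 1}. B (Suc i) (Suc (p i))) =
        (\<Prod>i \<in> {0..<n} - {r - 1}. M (Suc i) (Suc (p i)))"
      by (rule same) (rule rest)
    show ?thesis
      unfolding split[of M] split[of A] split[of B] A B row
      by (simp add: algebra_simps)
  qed
  then show ?thesis
    unfolding det by (simp add: sum.distrib sum_distrib_left)
qed

lemma rdet_identical_rows:
  assumes "1 \<le> r" "r \<le> n" "1 \<le> s" "s \<le> n" "r \<noteq> s" "\<And>j. M r j = M s j"
  shows "rdet n M = 0"
  unfolding rdet_def
  by (rule det_identical_rows[of _ n "r - 1" "s - 1"])
    (use assms in \<open>auto intro!: eq_vecI\<close>)

lemma rdet_zero_row:
  assumes "1 \<le> r" "r \<le> n" "\<And>j. 1 \<le> j \<Longrightarrow> M r j = 0"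
  shows "rdet n M = 0"
proof -
  \<comment> \<open>Clearing column 0, which the determinant does not see, makes row
    \<open>r\<close> vanish identically. It is then the sum of itself and itself, so the determinant
    equals its double.\<close>
  let ?N = "\<lambda>i j. if j = 0 then 0 else M i j"
  have "rdet n ?N = rdet n ?N + 1 * rdet n ?N"
    by (rule rdet_linear[of r]) (use assms in auto)
  then have "rdet n ?N = 0" by simp
  moreover have "rdet n M = rdet n ?N"
    by (rule rdet_cong) auto
  ultimately show ?thesis by simp
qed

lemma rdet_unitriangular:
  assumes "\<And>i j. j < i \<Longrightarrow> M i j = 0" "\<And>i. M i i = 1"
  shows "rdet n M = 1"
  unfolding rdet_def
proof (subst det_upper_triangular[of _ n])
  have "diag_mat (mat n n (\<lambda>(i, j). M (Suc i) (Suc j))) = replicate n 1"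
    by (rule nth_equalityI) (use assms in \<open>auto simp: diag_mat_def\<close>)
  then show "prod_list (diag_mat (mat n n (\<lambda>(i, j). M (Suc i) (Suc j)))) = 1" by simp
qed (use assms in \<open>auto simp: upper_triangular_def\<close>)

text \<open>\<open>hsym x b d\<close> is the complete homogeneous symmetric polynomial of degree \<open>d\<close> in
  \<open>x 1, \<dots>, x b\<close>.\<close>

fun hsym :: "(nat \<Rightarrow> 'a::comm_ring_1) \<Rightarrow> nat \<Rightarrow> nat \<Rightarrow> 'a" where
  "hsym x b 0 = 1"
| "hsym x 0 (Suc d) = 0"
| "hsym x (Suc b) (Suc d) = hsym x b (Suc d) + x (Suc b) * hsym x (Suc b) d"

lemma hsym_hom:
  assumes "comm_ring_hom h"
  shows "h (hsym x b d) = hsym (\<lambda>i. h (x i)) b d"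
proof -
  interpret comm_ring_hom h by fact
  show ?thesis by (induction x b d rule: hsym.induct) (simp_all add: hom_add hom_mult)
qed

lemma hsym_cong:
  assumes "\<And>i. 1 \<le> i \<Longrightarrow> i \<le> b \<Longrightarrow> x i = y i"
  shows "hsym x b d = hsym y b d"
  using assms by (induction x b d rule: hsym.induct) simp_all

text \<open>The coefficients are symmetric in the two top variables, which yields invariance under
  their exchange. In generating functions this is \<open>H_b = (1 - y t) (1 - z t) H_(b+2)\<close>,
  with \<open>y\<close> and \<open>z\<close> the two variables removed.\<close>

lemma hsym_Suc_Suc:
  "hsym x (Suc (Suc b)) (Suc (Suc d)) = hsym x b (Suc (Suc d)) +
    (x (Suc b) + x (Suc (Suc b))) * hsym x (Suc (Suc b)) (Suc d)
    - x (Suc b) * x (Suc (Suc b)) * hsym x (Suc (Suc b)) d"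
  by (simp add: algebra_simps)

lemma hsym_swap_top:
  "hsym (\<lambda>i. x (transpose (Suc b) (Suc (Suc b)) i)) (Suc (Suc b)) d = hsym x (Suc (Suc b)) d"
proof -
  let ?y = "\<lambda>i. x (transpose (Suc b) (Suc (Suc b)) i)"
  have b: "hsym ?y b e = hsym x b e" for e
    by (rule hsym_cong) (auto simp: transpose_def)
  show ?thesis
  proof (induction d rule: induct_nat_012)
    case 1
    then show ?case using b[of 1] by simp
  next
    case (ge2 d)
    then show ?case unfolding hsym_Suc_Suc b ge2 by (simp add: algebra_simps del: hsym.simps)
  qed simp
qed

lemma hsym_swap:
  assumes "1 \<le> k" "b \<noteq> k"
  shows "hsym (\<lambda>i. x (transpose k (Suc k) i)) b d = hsym x b d"
proof (cases "b < k")
  case True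
  then show ?thesis by (intro hsym_cong) (auto simp: transpose_def)
next
  case False
  then have "Suc k \<le> b" using assms by simp
  then show ?thesis
  proof (induction b arbitrary: d rule: dec_induct)
    case base
    show ?case using hsym_swap_top[of x "k - 1"] assms(1) by simp
  next
    case (step b)
    have "x (transpose k (Suc k) (Suc b)) = x (Suc b)" using step by (simp add: transpose_def)
    then show ?case using step by (induction d) simp_all
  qed
qed

text \<open>Split off the last variable of the symmetric \<open>hsym x (Suc k) (Suc d)\<close> in
  both orders of \<open>x k\<close> and \<open>x (Suc k)\<close>, and subtract.\<close>

lemma hsym_divided_difference:
  assumes "1 \<le> k"
  shows "hsym x k (Suc d) - hsym (\<lambda>i. x (transpose k (Suc k) i)) k (Suc d) =
    (x k - x (Suc k)) * hsym x (Suc k) d"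
proof -
  let ?y = "\<lambda>i. x (transpose k (Suc k) i)"
  have "hsym x (Suc k) e = hsym ?y (Suc k) e" for e
    using hsym_swap[OF assms, of "Suc k" x e] by (simp del: hsym.simps)
  from this[of "Suc d"] this[of d] show ?thesis by (simp add: algebra_simps)
qed

section \<open>Rows of the Jacobi-Trudi determinant and changes of the flag\<close>

definition hrow :: "(nat \<Rightarrow> 'a::comm_ring_1) \<Rightarrow> nat \<Rightarrow> nat \<Rightarrow> nat \<Rightarrow> nat \<Rightarrow> 'a" where
  "hrow x b a i j = (if i \<le> a + j then hsym x b (a + j - i) else 0)"

text \<open>The lower degree is expressed by raising \<open>i\<close> instead of lowering
  \<open>a\<close>. This covers rows of length 0, and it makes the correction term in row
  \<open>r\<close> look like a row of index \<open>r + 1\<close>.\<close>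

lemma hrow_Suc: "hrow x (Suc b) a i j = hrow x b a i j + x (Suc b) * hrow x (Suc b) a (Suc i) j"
proof -
  consider "a + j < i" | "a + j = i" | d where "a + j = i + Suc d"
    using less_imp_Suc_add[of i "a + j"] by fastforce
  then show ?thesis by cases (simp_all add: hrow_def)
qed

lemma hrow_shift: "hrow x b (Suc a) (Suc i) = hrow x b a i"
  by (simp add: hrow_def fun_eq_iff)

text \<open>The flagged Schur determinant of shape \<open>m\<close> and flag \<open>f\<close> (both indexed from 1).\<close>

definition fdet :: "(nat \<Rightarrow> 'a::comm_ring_1) \<Rightarrow> nat \<Rightarrow> (nat \<Rightarrow> nat) \<Rightarrow> (nat \<Rightarrow> nat) \<Rightarrow> 'a" where
  "fdet x n m f = rdet n (\<lambda>i. hrow x (f i) (m i) i)"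

lemma fdet_cong:
  assumes "\<And>i. 1 \<le> i \<Longrightarrow> i \<le> n \<Longrightarrow> m i = m' i" "\<And>i. 1 \<le> i \<Longrightarrow> i \<le> n \<Longrightarrow> f i = f' i"
  shows "fdet x n m f = fdet x n m' f'"
  unfolding fdet_def by (rule rdet_cong) (use assms in simp)

lemma fdet_hom:
  assumes "comm_ring_hom h"
  shows "h (fdet x n m f) = fdet (\<lambda>i. h (x i)) n m f"
proof -
  interpret comm_ring_hom h by fact
  show ?thesis
    unfolding fdet_def rdet_hom[OF assms]
    by (rule rdet_cong) (simp add: hrow_def hsym_hom[OF assms])
qed

lemma fdet_row:
  assumes "1 \<le> r" "r \<le> n" "f r = Suc b"
  shows "fdet x n m f = fdet x n m (f(r := b)) +
    x (Suc b) * rdet n ((\<lambda>i. hrow x (f i) (m i) i)(r := hrow x (Suc b) (m r) (Suc r)))"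
  unfolding fdet_def
  by (rule rdet_linear[of r]) (use assms hrow_Suc in auto)

lemma fdet_rec:
  assumes "1 \<le> r" "r \<le> n" "f r = Suc b" "m r = Suc a"
  shows "fdet x n m f = fdet x n m (f(r := b)) + x (Suc b) * fdet x n (m(r := a)) f"
proof -
  have "(\<lambda>i. hrow x (f i) (m i) i)(r := hrow x (Suc b) (m r) (Suc r)) =
      (\<lambda>i. hrow x (f i) ((m(r := a)) i) i)"
    using assms by (auto simp: fun_eq_iff hrow_shift)
  then show ?thesis
    using fdet_row[of r n f b x m, OF assms(1-3)] by (simp add: fdet_def[of x n "m(r := a)"])
qed

text \<open>The correction row of \<open>fdet_row\<close> is literally row \<open>r + 1\<close>, so
  its determinant has two equal rows.\<close>

lemma fdet_lower_equal_rows: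
  assumes "1 \<le> r" "r < n" "f r = Suc b" "f (Suc r) = Suc b" "m (Suc r) = m r"
  shows "fdet x n m f = fdet x n m (f(r := b))"
proof -
  have "rdet n ((\<lambda>i. hrow x (f i) (m i) i)(r := hrow x (Suc b) (m r) (Suc r))) = 0"
    by (rule rdet_identical_rows[of r _ "Suc r"]) (use assms in auto)
  then show ?thesis using fdet_row[of r n f b x m] assms by simp
qed

lemma fdet_lower_last_row:
  assumes "1 \<le> n" "f n = Suc b" "m n = 0"
  shows "fdet x n m f = fdet x n m (f(n := b))"
proof -
  let ?M = "(\<lambda>i. hrow x (f i) (m i) i)(n := hrow x (Suc b) (m n) (Suc n))"
  have "rdet n ?M = rdet n (?M(n := \<lambda>_. 0))"
    by (rule rdet_cong) (use assms in \<open>auto simp: hrow_def\<close>)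
  also have "\<dots> = 0"
    by (rule rdet_zero_row[of n]) (use assms in auto)
  finally show ?thesis using fdet_row[of n n f b x m] assms by simp
qed

text \<open>Flags of empty rows can be lowered to 0 one after the other, beginning with row
  \<open>n\<close>. This is why \<open>ramp_flag\<close> and \<open>diag_flag\<close> may leave
  empty rows unconstrained.\<close>

lemma fdet_zero_rows:
  assumes "1 \<le> R" "\<And>i. R \<le> i \<Longrightarrow> m i = 0" "\<And>i. 1 \<le> i \<Longrightarrow> i < R \<Longrightarrow> f i = g i"
  shows "fdet x n m f = fdet x n m g"
  using assms
proof (induction "Suc n - R" arbitrary: R f g)
  case 0
  then show ?case by (intro fdet_cong) auto
next
  case (Suc d)
  have R: "R \<le> n" using Suc.hyps(2) by simp
  have IH: "fdet x n m f = fdet x n m g" if "\<And>i. 1 \<le> i \<Longrightarrow> i \<le> R \<Longrightarrow> f i = g i" for f g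
    by (rule Suc.hyps(1)[of "Suc R"]) (use Suc.hyps(2) Suc.prems that in auto)
  have drop: "fdet x n m f = fdet x n m (f(R := 0))" for f
  proof (induction "f R" arbitrary: f)
    case 0
    then show ?case by (metis fun_upd_triv)
  next
    case (Suc b)
    have "fdet x n m f = fdet x n m (f(R := b))"
    proof (cases "R = n")
      case True
      then show ?thesis
        using fdet_lower_last_row[of n f b m x] \<open>Suc b = f R\<close> \<open>1 \<le> R\<close>
        by (simp add: \<open>\<And>i. R \<le> i \<Longrightarrow> m i = 0\<close>)
    next
      case False
      \<comment> \<open>By the induction hypothesis the flag of the next row is free; setting it
        equal to that of row \<open>R\<close> makes \<open>fdet_lower_equal_rows\<close>
        applicable.\<close>
      let ?f = "f(Suc R := Suc b)"
      have "fdet x n m f = fdet x n m ?f" by (rule IH) auto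
      also have "\<dots> = fdet x n m (?f(R := b))"
        by (rule fdet_lower_equal_rows) (use False R Suc.hyps(2) \<open>1 \<le> R\<close> \<open>\<And>i. R \<le> i \<Longrightarrow> m i = 0\<close> in auto)
      also have "\<dots> = fdet x n m (f(R := b))" by (rule IH) auto
      finally show ?thesis .
    qed
    also have "\<dots> = fdet x n m ((f(R := b))(R := 0))"
      by (rule Suc.hyps(1)) simp
    finally show ?case by simp
  qed
  have "fdet x n m f = fdet x n m (f(R := 0))" by (rule drop)
  also have "\<dots> = fdet x n m (g(R := 0))" by (rule IH) (use Suc.prems in auto)
  also have "\<dots> = fdet x n m g" by (rule drop[symmetric])
  finally show ?case .
qed

text \<open>In terms of tableaux, the first column would need \<open>p\<close> strictly increasing
  entries, the last of them at most \<open>p - 1\<close>. The proof shortens row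
  \<open>p - 1\<close> until it is as long as row \<open>p\<close>; each term with a lowered flag is
  an instance with \<open>p - 1\<close> in place of \<open>p\<close>.\<close>

lemma fdet_short_flag:
  assumes "1 \<le> p" "p \<le> n" "\<And>i. 1 \<le> i \<Longrightarrow> i < p \<Longrightarrow> f i = i" "f p = p - 1"
    and "\<And>i j. 1 \<le> i \<Longrightarrow> i \<le> j \<Longrightarrow> j \<le> p \<Longrightarrow> m j \<le> m i" "1 \<le> m p"
  shows "fdet x n m f = 0"
  using assms
proof (induction p arbitrary: m f)
  case (Suc q)
  show ?case
  proof (cases "q = 0")
    case True
    have "hrow x 0 (m 1) 1 j = 0" if "1 \<le> j" for j
    proof -
      have "m 1 + j - 1 = Suc (m 1 + j - 2)" using that Suc.prems(6) True by simp
      then show ?thesis by (simp add: hrow_def)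
    qed
    then show ?thesis unfolding fdet_def
      by (intro rdet_zero_row[of 1]) (use True Suc.prems in auto)
  next
    case False
    then obtain b where b: "q = Suc b" by (cases q) auto
    have low: "fdet x n m (f(q := b)) = 0"
      if "\<And>i. 1 \<le> i \<Longrightarrow> i < Suc q \<Longrightarrow> f i = i"
        "\<And>i j. 1 \<le> i \<Longrightarrow> i \<le> j \<Longrightarrow> j \<le> Suc q \<Longrightarrow> m j \<le> m i" "1 \<le> m (Suc q)" for m f
    proof (rule Suc.IH)
      show "1 \<le> m q" using that(2)[of q "Suc q"] that(3) b by auto
    qed (use that Suc.prems b in auto)
    show ?thesis
      using Suc.prems
    proof (induction "m q" arbitrary: m)
      case 0
      then show ?case using 0(6)[of q "Suc q"] b by auto
    next
      case (Suc a)
      have f: "f q = Suc b" "f (Suc q) = Suc b" using Suc.prems(3)[of q] Suc.prems(4) b by auto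
      show ?case
      proof (cases "m (Suc q) = m q")
        case True
        then have "fdet x n m f = fdet x n m (f(q := b))"
          by (intro fdet_lower_equal_rows) (use f Suc.prems b in auto)
        then show ?thesis using low[of f m] Suc.prems by simp
      next
        case False
        have "m (Suc q) \<le> a" using Suc.prems(5)[of q "Suc q"] Suc.hyps(2) False b by simp
        have "fdet x n (m(q := a)) f = 0"
        proof (rule Suc.hyps(1))
          fix i j assume ij: "1 \<le> i" "i \<le> j" "j \<le> Suc q"
          show "(m(q := a)) j \<le> (m(q := a)) i"
            using Suc.prems(5)[OF ij] \<open>m (Suc q) \<le> a\<close> Suc.hyps(2) ij
            by (cases "j = Suc q") auto
        qed (use Suc.prems in auto)
        moreover have "fdet x n m f = fdet x n m (f(q := b)) + x (Suc b) * fdet x n (m(q := a)) f"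
          by (rule fdet_rec) (use f Suc b in auto)
        ultimately show ?thesis using low[of f m] Suc.prems by simp
      qed
    qed
  qed
qed simp

definition is_part :: "nat \<Rightarrow> (nat \<Rightarrow> nat) \<Rightarrow> bool" where
  "is_part n m \<longleftrightarrow> (\<forall>i j. 1 \<le> i \<longrightarrow> i \<le> j \<longrightarrow> m j \<le> m i) \<and> (\<forall>i > n. m i = 0)"

lemma is_partD: "is_part n m \<Longrightarrow> 1 \<le> i \<Longrightarrow> i \<le> j \<Longrightarrow> m j \<le> m i"
  by (simp add: is_part_def)

lemma is_part_zero: "is_part n m \<Longrightarrow> n < i \<Longrightarrow> m i = 0"
  by (simp add: is_part_def)

lemma is_part_remove:
  assumes "is_part n m" "1 \<le> r" "m (Suc r) < m r"
  shows "is_part n (m(r := m r - 1))"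
  unfolding is_part_def
proof (intro conjI allI impI)
  fix i j :: nat assume ij: "1 \<le> i" "i \<le> j"
  show "(m(r := m r - 1)) j \<le> (m(r := m r - 1)) i"
  proof (cases "i = r \<and> j \<noteq> r")
    case True
    then have "m j \<le> m (Suc r)" using is_partD[OF assms(1), of "Suc r" j] ij by simp
    then show ?thesis using True assms(3) by simp
  next
    case False
    then show ?thesis using is_partD[OF assms(1) ij] by auto
  qed
next
  fix i assume "n < i"
  then show "(m(r := m r - 1)) i = 0" using is_part_zero[OF assms(1)] by auto
qed

text \<open>A tableau with these flags has only entries \<open>i\<close> in row \<open>i\<close>.
  This is the base case on both sides: the staircase of the longest permutation, and a supershape
  equal to the shape.\<close>

lemma fdet_dominant:
  assumes "is_part n m" "\<And>i. 1 \<le> i \<Longrightarrow> i \<le> n \<Longrightarrow> 1 \<le> m i \<Longrightarrow> f i = i"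
  shows "fdet x n m f = (\<Prod>i = 1..n. x i ^ m i)"
  using assms
proof (induction "\<Sum>i = 1..n. m i" arbitrary: m rule: less_induct)
  case less
  show ?case
  proof (cases "\<exists>i\<ge>1. m i \<noteq> 0")
    case False
    have "fdet x n m f = fdet x n m (\<lambda>_. 0)"
      by (rule fdet_zero_rows[of 1]) (use False in auto)
    also have "\<dots> = 1"
      unfolding fdet_def
    proof (subst rdet_cong[where M' = "hrow x 0 0"])
      show "rdet n (hrow x 0 0) = 1"
        by (rule rdet_unitriangular) (auto simp: hrow_def)
    qed (use False in auto)
    finally show ?thesis using False by simp
  next
    case True
    let ?S = "{i. 1 \<le> i \<and> m i \<noteq> 0}"
    have "i \<le> n" if "m i \<noteq> 0" for i
      using is_part_zero[OF less.prems(1), of i] that by (cases "n < i") auto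
    then have "?S \<subseteq> {1..n}" by auto
    then have fin: "finite ?S" using finite_subset by blast
    define r where "r = Max ?S"
    have r: "1 \<le> r" "m r \<noteq> 0" using Max_in[OF fin] True unfolding r_def by auto
    have "r \<le> n" using r is_part_zero[OF less.prems(1), of r] by (cases "n < r") auto
    have "m (Suc r) = 0" using Max_ge[OF fin, of "Suc r"] unfolding r_def[symmetric] by auto
    obtain a where a: "m r = Suc a" using r(2) by (cases "m r") auto
    obtain b where b: "r = Suc b" using r(1) by (cases r) auto
    have fr: "f r = Suc b" using less.prems(2)[of r] r \<open>r \<le> n\<close> b by simp
    have fi: "f i = i" if "1 \<le> i" "i \<le> r" for i
      using less.prems(2)[of i] is_partD[OF less.prems(1), of i r] that r \<open>r \<le> n\<close> by simp
    \<comment> \<open>In the recursion for the last nonempty row the term with lowered flag dies: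
      flags \<open>1, ..., r - 1, r - 1\<close> are too small for \<open>r\<close> nonempty
      rows.\<close>
    have 0: "fdet x n m (f(r := b)) = 0"
      by (rule fdet_short_flag[of r]) (use r \<open>r \<le> n\<close> b fi is_partD[OF less.prems(1)] in auto)
    have split: "(\<Sum>i = 1..n. g i) = g r + (\<Sum>i \<in> {1..n} - {r}. g i)" for g :: "nat \<Rightarrow> nat"
      using r \<open>r \<le> n\<close> by (subst sum.remove[of _ r]) auto
    have same: "(\<Sum>i \<in> {1..n} - {r}. (m(r := a)) i) = (\<Sum>i \<in> {1..n} - {r}. m i)"
      by (rule sum.cong) auto
    have 1: "fdet x n (m(r := a)) f = (\<Prod>i = 1..n. x i ^ (m(r := a)) i)"
    proof (rule less.hyps)
      show "(\<Sum>i = 1..n. (m(r := a)) i) < (\<Sum>i = 1..n. m i)"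
        unfolding split same using a by simp
      show "is_part n (m(r := a))"
        using is_part_remove[OF less.prems(1) r(1)] a \<open>m (Suc r) = 0\<close> by simp
      show "f i = i" if "1 \<le> i" "i \<le> n" "1 \<le> (m(r := a)) i" for i
        using less.prems(2)[of i] that fi[of r] r(1) by (cases "i = r") auto
    qed
    have psplit: "(\<Prod>i = 1..n. g i) = g r * (\<Prod>i \<in> {1..n} - {r}. g i)" for g :: "nat \<Rightarrow> 'a"
      using r \<open>r \<le> n\<close> by (subst prod.remove[of _ r]) auto
    have psame: "(\<Prod>i \<in> {1..n} - {r}. x i ^ (m(r := a)) i) = (\<Prod>i \<in> {1..n} - {r}. x i ^ m i)"
      by (rule prod.cong) auto
    have "fdet x n m f = x r * fdet x n (m(r := a)) f"
      using fdet_rec[of r n f b m a x] r \<open>r \<le> n\<close> fr a 0 b by simp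
    then show ?thesis
      unfolding 1 psplit psame using a by (simp add: ac_simps)
  qed
qed

text \<open>Within a block of equal rows the flag may increase in steps of one: raising an entry to the next
  one does not change the determinant, so only the last entry of a block matters.\<close>

definition ramp_flag :: "(nat \<Rightarrow> nat) \<Rightarrow> (nat \<Rightarrow> nat) \<Rightarrow> bool" where
  "ramp_flag m f \<longleftrightarrow> (\<forall>r\<ge>1. 1 \<le> m r \<longrightarrow> m (Suc r) = m r \<longrightarrow> f r \<le> f (Suc r) \<and> f (Suc r) \<le> Suc (f r))"

text \<open>This is \<open>fdet_lower_equal_rows\<close> read backwards: entries are raised towards
  the flag at the end of their block, and \<open>B\<close> bounds the number of raisings.\<close>

lemma fdet_flatten:
  assumes m: "is_part n m" and "ramp_flag m f" and "\<And>i. f i \<le> B"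
  shows "\<exists>h. fdet x n m f = fdet x n m h \<and>
    (\<forall>r\<ge>1. 1 \<le> m r \<longrightarrow> m (Suc r) = m r \<longrightarrow> h r = h (Suc r)) \<and>
    (\<forall>r\<ge>1. m (Suc r) < m r \<longrightarrow> h r = f r)"
  using assms(2,3)
proof (induction "\<Sum>i = 1..n. B - f i" arbitrary: f rule: less_induct)
  case less
  let ?P = "\<lambda>r. 1 \<le> r \<and> 1 \<le> m r \<and> m (Suc r) = m r \<and> f r \<noteq> f (Suc r)"
  show ?case
  proof (cases "\<exists>r. ?P r")
    case False
    then show ?thesis by (intro exI[of _ f]) auto
  next
    case True
    \<comment> \<open>For the least such \<open>r\<close>, the entry before it in its block already
      equals \<open>f r\<close>, so raising \<open>f r\<close> by one creates no step larger than
      one.\<close>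
    define r where "r = (LEAST r. ?P r)"
    have r: "?P r" using LeastI_ex[OF True] unfolding r_def .
    have min: "\<not> ?P s" if "s < r" for s using not_less_Least that unfolding r_def by blast
    have "Suc r \<le> n" using r is_part_zero[OF m, of "Suc r"] by (cases "n < Suc r") auto
    have fr: "f (Suc r) = Suc (f r)" using r less.prems(1) unfolding ramp_flag_def by force
    let ?f = "f(r := Suc (f r))"
    have eq: "fdet x n m ?f = fdet x n m f"
      using fdet_lower_equal_rows[of r n ?f "f r" m x] r \<open>Suc r \<le> n\<close> fr by simp
    have "(\<Sum>i = 1..n. B - ?f i) < (\<Sum>i = 1..n. B - f i)"
    proof (rule sum_strict_mono_ex1)
      show "\<exists>i\<in>{1..n}. B - ?f i < B - f i"
        using r \<open>Suc r \<le> n\<close> less.prems(2)[of "Suc r"] fr by (intro bexI[of _ r]) auto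
    qed auto
    moreover have "ramp_flag m ?f"
      unfolding ramp_flag_def
    proof (intro allI impI)
      fix s assume s: "1 \<le> s" "1 \<le> m s" "m (Suc s) = m s"
      then have fs: "f s \<le> f (Suc s)" "f (Suc s) \<le> Suc (f s)"
        using less.prems(1) unfolding ramp_flag_def by auto
      moreover have "f s = f r" if "Suc s = r"
        using min[of s] s that by auto
      ultimately show "?f s \<le> ?f (Suc s) \<and> ?f (Suc s) \<le> Suc (?f s)"
        using fr by auto
    qed
    moreover have "?f i \<le> B" for i
      using less.prems(2)[of i] less.prems(2)[of "Suc r"] fr by auto
    ultimately obtain h where h: "fdet x n m ?f = fdet x n m h"
      "\<forall>r\<ge>1. 1 \<le> m r \<longrightarrow> m (Suc r) = m r \<longrightarrow> h r = h (Suc r)"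
      "\<forall>r\<ge>1. m (Suc r) < m r \<longrightarrow> h r = ?f r"
      using less.hyps by blast
    then show ?thesis using eq r by (intro exI[of _ h]) auto
  qed
qed

lemma fdet_ramp_flag_eq:
  assumes m: "is_part n m" and f: "ramp_flag m f" and g: "ramp_flag m g"
    and ends: "\<And>r. 1 \<le> r \<Longrightarrow> m (Suc r) < m r \<Longrightarrow> f r = g r"
  shows "fdet x n m f = fdet x n m g"
proof -
  have fin: "\<exists>B. \<forall>i\<in>{1..Suc n}. (F i :: nat) \<le> B" for F
    by (rule exI[of _ "Max (F ` {1..Suc n})"]) auto
  obtain B where B: "\<And>i. i \<in> {1..Suc n} \<Longrightarrow> f i \<le> B" using fin[of f] by blast
  obtain C where C: "\<And>i. i \<in> {1..Suc n} \<Longrightarrow> g i \<le> C" using fin[of g] by blast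
  define f' where "f' = (\<lambda>i. if i \<in> {1..Suc n} then f i else 0)"
  define g' where "g' = (\<lambda>i. if i \<in> {1..Suc n} then g i else 0)"
  have small: "r \<le> n" if "1 \<le> m r" for r
    using is_part_zero[OF m, of r] that by (cases "n < r") auto
  have f': "ramp_flag m f'"
    using f unfolding ramp_flag_def f'_def by (auto dest: small[unfolded One_nat_def])
  have g': "ramp_flag m g'"
    using g unfolding ramp_flag_def g'_def by (auto dest: small[unfolded One_nat_def])
  have "\<And>i. f' i \<le> B" using B by (simp add: f'_def)
  from fdet_flatten[OF m f' this] obtain h where h: "fdet x n m f' = fdet x n m h"
    "\<forall>r\<ge>1. 1 \<le> m r \<longrightarrow> m (Suc r) = m r \<longrightarrow> h r = h (Suc r)"
    "\<forall>r\<ge>1. m (Suc r) < m r \<longrightarrow> h r = f' r" by blast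
  have "\<And>i. g' i \<le> C" using C by (simp add: g'_def)
  from fdet_flatten[OF m g' this] obtain l where l: "fdet x n m g' = fdet x n m l"
    "\<forall>r\<ge>1. 1 \<le> m r \<longrightarrow> m (Suc r) = m r \<longrightarrow> l r = l (Suc r)"
    "\<forall>r\<ge>1. m (Suc r) < m r \<longrightarrow> l r = g' r" by blast
  have hl: "h r = l r" if "1 \<le> r" "1 \<le> m r" for r
    using that
  proof (induction "n - r" arbitrary: r rule: less_induct)
    case less
    show ?case
    proof (cases "m (Suc r) < m r")
      case True
      then show ?thesis using h(3) l(3) ends[of r] less.prems by (auto simp: f'_def g'_def)
    next
      case False
      then have eq: "m (Suc r) = m r" using is_partD[OF m, of r "Suc r"] less.prems by simp
      then have "h (Suc r) = l (Suc r)" using less small[of "Suc r"] by auto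
      then show ?thesis using h(2) l(2) eq less.prems by auto
    qed
  qed
  have "fdet x n m h = fdet x n m l"
  proof -
    define R where "R = (LEAST R. 1 \<le> R \<and> m R = 0)"
    have R: "1 \<le> R \<and> m R = 0" unfolding R_def
      by (rule LeastI[of _ "Suc n"]) (simp add: is_part_zero[OF m])
    have "m i = 0" if "R \<le> i" for i using is_partD[OF m, of R i] R that by simp
    moreover have "1 \<le> m i" if "1 \<le> i" "i < R" for i
      using not_less_Least[of i "\<lambda>R. 1 \<le> R \<and> m R = 0"] that unfolding R_def[symmetric] by auto
    ultimately show ?thesis
      using hl by (intro fdet_zero_rows[of R]) (use R in auto)
  qed
  moreover have "fdet x n m f = fdet x n m f'" "fdet x n m g = fdet x n m g'"
    by (rule fdet_cong; simp add: f'_def g'_def)+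
  ultimately show ?thesis using h(1) l(1) by simp
qed

lemma divided_difference_fdet:
  assumes R: "1 \<le> R" "R \<le> n" and k: "1 \<le> k" and mR: "m R = Suc C" and fR: "f R = k"
    and f: "\<And>r. 1 \<le> r \<Longrightarrow> r \<le> n \<Longrightarrow> r \<noteq> R \<Longrightarrow> f r \<noteq> k"
  shows "divided_difference k (fdet var n m f) = fdet var n (m(R := C)) (f(R := Suc k))"
proof (rule divided_difference_eqI)
  let ?t = "transpose k (Suc k)"
  let ?y = "\<lambda>i. var (?t i)"
  let ?M = "\<lambda>i. hrow var (f i) (m i) i"
  have "swap_vars k (fdet var n m f) = fdet ?y n m f"
    using fdet_hom[OF comm_ring_hom_swap_vars, of k var n m f]
    by (simp add: swap_vars_var)
  also have "\<dots> = rdet n (?M(R := hrow ?y k (Suc C) R))"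
    unfolding fdet_def
  proof (rule rdet_cong)
    fix i j assume "1 \<le> i" "i \<le> n"
    then show "hrow ?y (f i) (m i) i j = (?M(R := hrow ?y k (Suc C) R)) i j"
      using mR fR f[of i] hsym_swap[OF k, of "f i" var "m i + j - i"] by (cases "i = R") (simp_all add: hrow_def)
  qed
  finally have swap: "swap_vars k (fdet var n m f) = rdet n (?M(R := hrow ?y k (Suc C) R))" .
  have A: "fdet var n (m(R := C)) (f(R := Suc k)) = rdet n (?M(R := hrow var (Suc k) C R))"
    unfolding fdet_def by (rule rdet_cong) auto
  have B: "fdet var n m f = rdet n (?M(R := hrow ?y k (Suc C) R)) +
      (var k - var (Suc k)) * rdet n (?M(R := hrow var (Suc k) C R))"
    unfolding fdet_def
  proof (rule rdet_linear[OF R])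
    fix j
    have "hrow var k (Suc C) R j = hrow ?y k (Suc C) R j + (var k - var (Suc k)) * hrow var (Suc k) C R j"
    proof -
      consider "Suc C + j < R" | "Suc C + j = R" | d where "Suc C + j = R + Suc d"
        using less_imp_Suc_add[of R "Suc C + j"] by fastforce
      then show ?thesis
      proof cases
        case (3 d)
        then have "C + j = R + d" by simp
        then have "hrow var k (Suc C) R j - hrow ?y k (Suc C) R j =
            (var k - var (Suc k)) * hrow var (Suc k) C R j"
          using hsym_divided_difference[OF k, of var d] 3 by (simp add: hrow_def del: hsym.simps)
        then show ?thesis by (metis diff_add_cancel add.commute)
      qed (auto simp: hrow_def)
    qed
    then show "hrow var (f R) (m R) R j = (?M(R := hrow ?y k (Suc C) R)) R j +
        (var k - var (Suc k)) * (?M(R := hrow var (Suc k) C R)) R j"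
      using mR fR by simp
  qed auto
  show "(var k - var (Suc k)) * fdet var n (m(R := C)) (f(R := Suc k)) =
      fdet var n m f - swap_vars k (fdet var n m f)"
    by (subst swap, subst A, subst B, rule add_diff_cancel_left'[symmetric])
qed

section \<open>Excited diagrams\<close>

definition cells :: "(nat \<Rightarrow> nat) \<Rightarrow> (nat \<times> nat) set" where
  "cells m = {(i, j). 1 \<le> i \<and> 1 \<le> j \<and> j \<le> m i}"

lemma cells_iff [simp]: "(i, j) \<in> cells m \<longleftrightarrow> 1 \<le> i \<and> 1 \<le> j \<and> j \<le> m i"
  by (simp add: cells_def)

lemma cells_down:
  assumes "is_part n m" "(i, j) \<in> cells m" "1 \<le> i'" "i' \<le> i" "1 \<le> j'" "j' \<le> j"
  shows "(i', j') \<in> cells m"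
  using assms is_partD[OF assms(1), of i' i] by auto

lemma finite_cells:
  assumes "is_part n m"
  shows "finite (cells m)"
proof (rule finite_subset)
  have "i \<le> n" if "m i \<noteq> 0" for i
    using is_part_zero[OF assms, of i] that by (cases "n < i") auto
  then show "cells m \<subseteq> {1..n} \<times> {1..m 1}"
    using is_partD[OF assms, of 1] by (force simp: cells_def)
qed simp

text \<open>An excited diagram is recorded by the number of diagonal steps that each cell of the shape has
  made.\<close>

definition shifted :: "(nat \<times> nat \<Rightarrow> nat) \<Rightarrow> nat \<times> nat \<Rightarrow> nat \<times> nat" where
  "shifted e c = (fst c + e c, snd c + e c)"

text \<open>The numbers \<open>i + e (i, j)\<close> form a semistandard tableau: monotonicity makes
  its rows weakly and its columns strictly increasing. The value 0 off the shape makes the function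
  unique.\<close>

definition excitations :: "(nat \<Rightarrow> nat) \<Rightarrow> (nat \<Rightarrow> nat) \<Rightarrow> (nat \<times> nat \<Rightarrow> nat) set" where
  "excitations l m = {e.
     (\<forall>c. c \<notin> cells m \<longrightarrow> e c = 0) \<and>
     (\<forall>c\<in>cells m. shifted e c \<in> cells l) \<and>
     (\<forall>c\<in>cells m. \<forall>d\<in>cells m. fst c \<le> fst d \<longrightarrow> snd c \<le> snd d \<longrightarrow> e c \<le> e d)}"

lemma excitationsD:
  assumes "e \<in> excitations l m"
  shows "c \<notin> cells m \<Longrightarrow> e c = 0"
    and "c \<in> cells m \<Longrightarrow> shifted e c \<in> cells l"
    and "c \<in> cells m \<Longrightarrow> d \<in> cells m \<Longrightarrow> fst c \<le> fst d \<Longrightarrow> snd c \<le> snd d \<Longrightarrow> e c \<le> e d"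
  using assms unfolding excitations_def by blast+

lemma inj_on_shifted:
  assumes "e \<in> excitations l m"
  shows "inj_on (shifted e) (cells m)"
proof (rule inj_onI)
  fix c d assume cd: "c \<in> cells m" "d \<in> cells m" and eq: "shifted e c = shifted e d"
  have eq': "fst c + e c = fst d + e d" "snd c + e c = snd d + e d"
    using eq by (auto simp: shifted_def)
  consider "fst c \<le> fst d" "snd c \<le> snd d" | "fst d \<le> fst c" "snd d \<le> snd c"
    using eq' by linarith
  then show "c = d"
  proof cases
    case 1
    then have "e c \<le> e d" using excitationsD(3)[OF assms] cd by blast
    then show ?thesis using 1 eq' by (auto simp: prod_eq_iff)
  next
    case 2
    then have "e d \<le> e c" using excitationsD(3)[OF assms] cd by blast
    then show ?thesis using 2 eq' by (auto simp: prod_eq_iff)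
  qed
qed

lemma shifted_image_step:
  assumes "e \<in> excitations l m" "(i, j) \<in> cells m"
  shows "shifted (e((i, j) := Suc (e (i, j)))) ` cells m =
    insert (i + e (i, j) + 1, j + e (i, j) + 1) (shifted e ` cells m - {(i + e (i, j), j + e (i, j))})"
proof -
  let ?e = "e((i, j) := Suc (e (i, j)))"
  have "cells m = insert (i, j) (cells m - {(i, j)})" using assms(2) by blast
  then have "shifted ?e ` cells m = insert (shifted ?e (i, j)) (shifted ?e ` (cells m - {(i, j)}))"
    by (metis image_insert)
  also have "shifted ?e ` (cells m - {(i, j)}) = shifted e ` (cells m - {(i, j)})"
    by (rule image_cong) (auto simp: shifted_def)
  also have "\<dots> = shifted e ` cells m - {shifted e (i, j)}"
    using inj_on_image_set_diff[OF inj_on_shifted[OF assms(1)], of "cells m" "{(i, j)}"] assms(2) by auto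
  finally show ?thesis by (simp add: shifted_def)
qed

text \<open>By induction along \<open>i + j\<close>. If \<open>e\<close> moved \<open>(i, j)\<close>
  less far than \<open>e'\<close>, its image would be the image under \<open>e'\<close> of another
  cell of the same diagonal. An earlier cell is impossible by injectivity of
  \<open>shifted e\<close>, since \<open>e\<close> and \<open>e'\<close> agree there; a later one
  has moved too far under \<open>e'\<close>.\<close>

lemma shifted_image_inj:
  "inj_on (\<lambda>e. shifted e ` cells m) (excitations l m)"
proof (rule inj_onI)
  have aux: "\<not> e (i, j) < e' (i, j)"
    if e: "e \<in> excitations l m" "e' \<in> excitations l m" and sub: "shifted e ` cells m \<subseteq> shifted e' ` cells m"
      and c: "(i, j) \<in> cells m" and eq: "\<And>c. c \<in> cells m \<Longrightarrow> fst c + snd c < i + j \<Longrightarrow> e c = e' c"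
    for e e' i j
  proof
    assume less: "e (i, j) < e' (i, j)"
    have "shifted e (i, j) \<in> shifted e' ` cells m" using sub c by blast
    then obtain i' j' where d: "(i', j') \<in> cells m" "shifted e (i, j) = shifted e' (i', j')"
      by fast
    then have pos: "i + e (i, j) = i' + e' (i', j')" "j + e (i, j) = j' + e' (i', j')"
      by (auto simp: shifted_def)
    show False
    proof (cases "i' < i")
      case True
      then have "e (i', j') = e' (i', j')" using eq d(1) pos by auto
      then have "shifted e (i, j) = shifted e (i', j')" using d(2) by (simp add: shifted_def)
      then show False using inj_onD[OF inj_on_shifted[OF e(1)] _ c d(1)] True by auto
    next
      case False
      then have "e' (i, j) \<le> e' (i', j')" using excitationsD(3)[OF e(2) c d(1)] pos by auto
      then show False using pos less False by simp
    qed
  qed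
  fix e e' assume e: "e \<in> excitations l m" "e' \<in> excitations l m"
    and eq: "shifted e ` cells m = shifted e' ` cells m"
  have "e (i, j) = e' (i, j)" if "(i, j) \<in> cells m" for i j
    using that
  proof (induction "i + j" arbitrary: i j rule: less_induct)
    case less
    have prev: "e c = e' c" if "c \<in> cells m" "fst c + snd c < i + j" for c
      using less.hyps[of "fst c" "snd c"] that by auto
    show ?case
      using aux[OF e _ less.prems prev] aux[OF e(2,1) _ less.prems prev[symmetric]] eq
      by (metis linorder_neqE_nat subset_refl)
  qed
  then have on: "e c = e' c" if "c \<in> cells m" for c using that by (cases c) blast
  show "e = e'"
  proof
    fix c show "e c = e' c"
      using excitationsD(1)[OF e(1)] excitationsD(1)[OF e(2)] on by (cases "c \<in> cells m") auto
  qed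
qed

text \<open>A move adds one to \<open>e\<close> at one cell. Its emptiness conditions force the
  right and lower neighbours in the shape to have moved further, so monotonicity survives.
  Conversely, every nonzero monotone \<open>e\<close> arises by a move from one with a smaller
  sum.\<close>

lemma excited_diagrams_eq:
  assumes m: "is_part n m" and l: "is_part N l" and sub: "cells m \<subseteq> cells l"
    and lam: "young_diagram lam = cells l" and mu: "young_diagram mu = cells m"
  shows "excited_diagrams lam mu = (\<lambda>e. shifted e ` cells m) ` excitations l m"
proof (intro equalityI subsetI)
  fix D assume "D \<in> excited_diagrams lam mu"
  then show "D \<in> (\<lambda>e. shifted e ` cells m) ` excitations l m"
  proof (induction rule: excited_diagrams.induct)
    case initial
    have "(\<lambda>_. 0) \<in> excitations l m" using sub by (auto simp: excitations_def shifted_def)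
    moreover have "shifted (\<lambda>_. 0) ` cells m = cells m" by (simp add: shifted_def)
    ultimately show ?case unfolding mu by (intro image_eqI[of _ _ "\<lambda>_. 0"]) simp_all
  next
    case (excite D a b)
    then obtain e where e: "e \<in> excitations l m" and D: "D = shifted e ` cells m" by auto
    obtain i j where ij: "(i, j) \<in> cells m" and ab: "a = i + e (i, j)" "b = j + e (i, j)"
      using excite.hyps(2) unfolding D by (auto simp: shifted_def)
    let ?e = "e((i, j) := Suc (e (i, j)))"
    have out: "(a + 1, b) \<notin> D" "(a, b + 1) \<notin> D" "(a + 1, b + 1) \<in> cells l"
      using excite.hyps(3) unfolding lam by auto
    \<comment> \<open>It suffices to look at the neighbour below or to the right: an equal shift
      there would put its image on a cell that the move requires to be empty.\<close>
    have up: "Suc (e (i, j)) \<le> e d" if d: "d \<in> cells m" "i \<le> fst d" "j \<le> snd d" "d \<noteq> (i, j)" for d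
    proof -
      obtain i' j' where d': "d = (i', j')" by force
      consider "i < i'" | "i = i'" "j < j'" using d d' by force
      then show ?thesis
      proof cases
        case 1
        then have c: "(Suc i, j) \<in> cells m"
          using cells_down[OF m, of i' j' "Suc i" j] d d' ij by auto
        have "e (i, j) \<le> e (Suc i, j)" "e (Suc i, j) \<le> e d"
          using excitationsD(3)[OF e ij c] excitationsD(3)[OF e c d(1)] 1 d d' by auto
        moreover have "e (i, j) \<noteq> e (Suc i, j)"
        proof
          assume "e (i, j) = e (Suc i, j)"
          then have "shifted e (Suc i, j) = (a + 1, b)" using ab by (simp add: shifted_def)
          then show False using out(1) c unfolding D by (metis imageI)
        qed
        ultimately show ?thesis by simp
      next
        case 2
        then have c: "(i, Suc j) \<in> cells m" using d d' ij by auto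
        have "e (i, j) \<le> e (i, Suc j)" "e (i, Suc j) \<le> e d"
          using excitationsD(3)[OF e ij c] excitationsD(3)[OF e c d(1)] 2 d d' by auto
        moreover have "e (i, j) \<noteq> e (i, Suc j)"
        proof
          assume "e (i, j) = e (i, Suc j)"
          then have "shifted e (i, Suc j) = (a, b + 1)" using ab by (simp add: shifted_def)
          then show False using out(2) c unfolding D by (metis imageI)
        qed
        ultimately show ?thesis by simp
      qed
    qed
    have "?e \<in> excitations l m"
      unfolding excitations_def
    proof (intro CollectI conjI allI impI ballI)
      fix c assume "c \<notin> cells m"
      then show "?e c = 0" using ij excitationsD(1)[OF e] by auto
    next
      fix c assume c: "c \<in> cells m"
      show "shifted ?e c \<in> cells l"
      proof (cases "c = (i, j)")
        case True
        then show ?thesis using out(3) ab by (simp add: shifted_def)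
      next
        case False
        then show ?thesis using excitationsD(2)[OF e c] by (simp add: shifted_def)
      qed
    next
      fix c d assume cd: "c \<in> cells m" "d \<in> cells m" "fst c \<le> fst d" "snd c \<le> snd d"
      have "e c \<le> e d" using excitationsD(3)[OF e cd] .
      then show "?e c \<le> ?e d"
        using up[of d] cd by (cases "c = (i, j)"; cases "d = (i, j)") auto
    qed
    moreover have "insert (a + 1, b + 1) (D - {(a, b)}) = shifted ?e ` cells m"
      unfolding D ab by (rule shifted_image_step[OF e ij, symmetric])
    ultimately show ?case by (intro image_eqI[of _ _ ?e])
  qed
next
  fix D assume "D \<in> (\<lambda>e. shifted e ` cells m) ` excitations l m"
  then obtain e where "e \<in> excitations l m" "D = shifted e ` cells m" by blast
  then show "D \<in> excited_diagrams lam mu"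
  proof (induction "\<Sum>c\<in>cells m. e c" arbitrary: e D)
    case 0
    then have "e c = 0" if "c \<in> cells m" for c
      using that finite_cells[OF m] by simp
    then have "shifted e ` cells m = (\<lambda>c. c) ` cells m"
      by (intro image_cong) (simp_all add: shifted_def)
    then have "D = cells m" using 0 by simp
    then show ?case using excited_diagrams.initial[of mu lam] mu by simp
  next
    case (Suc s)
    let ?Q = "\<lambda>c. c \<in> cells m \<and> e c \<noteq> 0"
    have "(\<Sum>c\<in>cells m. e c) \<noteq> 0" using Suc.hyps(2) by simp
    then obtain c0 where "?Q c0" by (meson sum.neutral)
    \<comment> \<open>A shifted cell of least coordinate sum: all cells with a smaller sum are
      unshifted, so its last step can be undone.\<close>
    from ex_has_least_nat[of ?Q, OF this, of "\<lambda>c. fst c + snd c"]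
    obtain c where c: "?Q c" and min: "\<And>d. ?Q d \<Longrightarrow> fst c + snd c \<le> fst d + snd d"
      by blast
    obtain i j where ij: "c = (i, j)" by force
    obtain t where t: "e (i, j) = Suc t" using c ij by (cases "e (i, j)") auto
    define g where "g = e((i, j) := t)"
    have ij': "(i, j) \<in> cells m" using c ij by simp
    have low: "e d = 0" if "d \<in> cells m" "fst d + snd d < i + j" for d
      using min[of d] that ij by auto
    have eg: "e = g((i, j) := Suc (g (i, j)))" using t by (auto simp: g_def)
    note e = Suc.prems(1)
    have g: "g \<in> excitations l m"
      unfolding excitations_def
    proof (intro CollectI conjI allI impI ballI)
      fix d assume "d \<notin> cells m"
      then show "g d = 0" using ij' excitationsD(1)[OF e] by (auto simp: g_def)
    next
      fix d assume d: "d \<in> cells m"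
      have s: "shifted e d \<in> cells l" using excitationsD(2)[OF e d] .
      show "shifted g d \<in> cells l"
      proof (cases "d = (i, j)")
        case True
        have "(i + t, j + t) \<in> cells l"
          by (rule cells_down[OF l, of "i + Suc t" "j + Suc t"]) (use s True t ij' in \<open>auto simp: shifted_def\<close>)
        then show ?thesis using True by (simp add: shifted_def g_def)
      next
        case False
        then show ?thesis using s by (simp add: shifted_def g_def)
      qed
    next
      fix d d' assume dd: "d \<in> cells m" "d' \<in> cells m" "fst d \<le> fst d'" "snd d \<le> snd d'"
      have le: "e d \<le> e d'" using excitationsD(3)[OF e dd] .
      have "e d = 0" if "d' = (i, j)" "d \<noteq> (i, j)"
      proof (rule low[OF dd(1)])
        show "fst d + snd d < i + j" using dd(3,4) that by (cases d) auto
      qed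
      then show "g d \<le> g d'"
        using le t by (auto simp: g_def)
    qed
    have "(\<Sum>c\<in>cells m. e c) = Suc (\<Sum>c\<in>cells m. g c)"
    proof -
      have "(\<Sum>c\<in>cells m. e c) = e (i, j) + (\<Sum>c\<in>cells m - {(i, j)}. e c)"
        using finite_cells[OF m] ij' by (rule sum.remove)
      moreover have "(\<Sum>c\<in>cells m. g c) = g (i, j) + (\<Sum>c\<in>cells m - {(i, j)}. g c)"
        using finite_cells[OF m] ij' by (rule sum.remove)
      moreover have "(\<Sum>c\<in>cells m - {(i, j)}. g c) = (\<Sum>c\<in>cells m - {(i, j)}. e c)"
        by (rule sum.cong) (auto simp: g_def)
      ultimately show ?thesis using t by (simp add: g_def)
    qed
    then have IH: "shifted g ` cells m \<in> excited_diagrams lam mu"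
      using Suc.hyps(2) by (intro Suc.hyps(1)[OF _ g refl]) simp
    have gt: "g (i, j) = t" by (simp add: g_def)
    have D: "D = insert (i + t + 1, j + t + 1) (shifted g ` cells m - {(i + t, j + t)})"
      using shifted_image_step[OF g ij', folded eg, unfolded gt] Suc.prems(2) by simp
    have "{(i + t + 1, j + t), (i + t, j + t + 1), (i + t + 1, j + t + 1)} \<subseteq> cells l"
    proof -
      have "(i + Suc t, j + Suc t) \<in> cells l"
        using excitationsD(2)[OF e ij'] t by (simp add: shifted_def)
      then show ?thesis
        using cells_down[OF l, of "i + Suc t" "j + Suc t"] ij' by auto
    qed
    moreover have "x \<notin> shifted g ` cells m"
      if x: "x \<in> {(i + t + 1, j + t), (i + t, j + t + 1), (i + t + 1, j + t + 1)}" for x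
    proof
      assume "x \<in> shifted g ` cells m"
      then obtain i' j' where d: "(i', j') \<in> cells m" "x = (i' + g (i', j'), j' + g (i', j'))"
        by (auto simp: shifted_def)
      then have ne: "(i', j') \<noteq> (i, j)" using x by (auto simp: g_def)
      then have ge: "g (i', j') = e (i', j')" by (auto simp: g_def)
      \<comment> \<open>A cell weakly southeast of \<open>(i, j)\<close> has already moved past the
        square. Any other candidate lies near the same diagonal, hence has a smaller coordinate sum;
        it has not moved and is too far northwest.\<close>
      show False
      proof (cases "i \<le> i' \<and> j \<le> j'")
        case True
        then have "Suc t \<le> e (i', j')" using excitationsD(3)[OF e ij' d(1)] t by simp
        then show False using True ne d(2) x ge by auto
      next
        case False
        then have "i' + j' < i + j" using d(2) x by auto
        then have "g (i', j') = 0" using low[OF d(1)] ge by simp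
        then show False using False d(2) x \<open>i' + j' < i + j\<close> by auto
      qed
    qed
    moreover have "(i + t, j + t) \<in> shifted g ` cells m"
      by (rule image_eqI[of _ _ "(i, j)"]) (use ij' in \<open>auto simp: shifted_def g_def\<close>)
    ultimately show ?case
      using excited_diagrams.excite[OF IH, of "i + t" "j + t"] unfolding D lam by blast
  qed
qed

lemma card_excited_diagrams:
  assumes "is_part n m" "is_part N l" "cells m \<subseteq> cells l"
    and "young_diagram lam = cells l" "young_diagram mu = cells m"
  shows "card (excited_diagrams lam mu) = card (excitations l m)"
  unfolding excited_diagrams_eq[OF assms] by (rule card_image[OF shifted_image_inj])

lemma finite_excitations:
  assumes "is_part n l"
  shows "finite (excitations l m)"
proof (rule finite_imageD[OF _ shifted_image_inj])
  have "(\<lambda>e. shifted e ` cells m) ` excitations l m \<subseteq> Pow (cells l)"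
    using excitationsD(2) by blast
  then show "finite ((\<lambda>e. shifted e ` cells m) ` excitations l m)"
    using finite_cells[OF assms] finite_subset by blast
qed

section \<open>Removing an outer corner of the supershape\<close>

lemma cells_remove:
  assumes "1 \<le> r" "1 \<le> m r"
  shows "cells (m(r := m r - 1)) = cells m - {(r, m r)}"
  using assms by (auto simp: cells_def split: if_splits)

lemma excitations_remove_corner:
  assumes "1 \<le> p" "1 \<le> l p"
  shows "excitations (l(p := l p - 1)) m = {e \<in> excitations l m. \<forall>c\<in>cells m. shifted e c \<noteq> (p, l p)}"
  unfolding excitations_def cells_remove[of p l, OF assms] by blast

text \<open>A right or lower neighbour in the shape would be shifted at least as far and thus leave
  \<open>l\<close>. So the cell sent to an outer corner of \<open>l\<close> is itself an outer
  corner of \<open>m\<close>, on the same diagonal.\<close>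

lemma excitation_at_corner:
  assumes m: "is_part n m" and l: "is_part N l" and p: "1 \<le> p" "l (Suc p) < l p"
    and e: "e \<in> excitations l m" and c: "(i, j) \<in> cells m" "shifted e (i, j) = (p, l p)"
  shows "j = m i" "m (Suc i) < m i" "m i + p = l p + i"
proof -
  have pos: "i + e (i, j) = p" "j + e (i, j) = l p" using c(2) by (auto simp: shifted_def)
  have r: "(i, Suc j) \<notin> cells m"
  proof
    assume d: "(i, Suc j) \<in> cells m"
    let ?g = "e (i, Suc j)"
    have "e (i, j) \<le> ?g" using excitationsD(3)[OF e c(1) d] by simp
    moreover have "Suc j + ?g \<le> l (i + ?g)" using excitationsD(2)[OF e d] by (simp add: shifted_def)
    moreover have "l (i + ?g) \<le> l p" using is_partD[OF l, of p "i + ?g"] p pos \<open>e (i, j) \<le> ?g\<close> by simp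
    ultimately show False using pos by simp
  qed
  then show j: "j = m i" using c(1) by simp
  show "m (Suc i) < m i"
  proof (rule ccontr)
    assume "\<not> ?thesis"
    then have d: "(Suc i, j) \<in> cells m" using c(1) j by simp
    let ?g = "e (Suc i, j)"
    have "e (i, j) \<le> ?g" using excitationsD(3)[OF e c(1) d] by simp
    moreover have "j + ?g \<le> l (Suc i + ?g)" using excitationsD(2)[OF e d] by (simp add: shifted_def)
    moreover have "l (Suc i + ?g) \<le> l (Suc p)"
      using is_partD[OF l, of "Suc p" "Suc i + ?g"] pos \<open>e (i, j) \<le> ?g\<close> by simp
    ultimately show False using pos p by simp
  qed
  show "m i + p = l p + i" using pos j by simp
qed

text \<open>The corner is deleted together with the cell sent to it; the inverse puts that cell back
  with shift \<open>p - r\<close>, the distance to the corner along the diagonal.\<close>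

lemma excitations_corner_bij:
  assumes m: "is_part n m" and l: "is_part N l" and p: "1 \<le> p" "l (Suc p) < l p"
    and r: "1 \<le> r" "r \<le> p" "m (Suc r) < m r" "m r + p = l p + r"
  shows "bij_betw (\<lambda>e. e((r, m r) := 0)) {e \<in> excitations l m. e (r, m r) = p - r}
    (excitations (l(p := l p - 1)) (m(r := m r - 1)))"
proof (rule bij_betw_byWitness[where f' = "\<lambda>e. e((r, m r) := p - r)"])
  let ?c = "(r, m r)"
  let ?l = "l(p := l p - 1)"
  let ?m = "m(r := m r - 1)"
  have c: "?c \<in> cells m" using r by simp
  have cm: "cells ?m = cells m - {?c}" by (rule cells_remove) (use r in auto)
  have cl: "cells ?l = cells l - {(p, l p)}" by (rule cells_remove) (use p in auto)
  show "\<forall>e\<in>{e \<in> excitations l m. e ?c = p - r}. e(?c := 0, ?c := p - r) = e"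
    by (simp add: fun_upd_idem)
  have "e ?c = 0" if "e \<in> excitations ?l ?m" for e
    by (rule excitationsD(1)[OF that], unfold cm) blast
  then show "\<forall>e\<in>excitations ?l ?m. e(?c := p - r, ?c := 0) = e"
    by (simp add: fun_upd_idem)
  show "(\<lambda>e. e(?c := 0)) ` {e \<in> excitations l m. e ?c = p - r} \<subseteq> excitations ?l ?m"
  proof clarify
    fix e assume e: "e \<in> excitations l m" "e ?c = p - r"
    have sc: "shifted e ?c = (p, l p)" using e(2) r by (simp add: shifted_def)
    show "e(?c := 0) \<in> excitations ?l ?m"
      unfolding excitations_def cm cl
    proof (intro CollectI conjI allI impI ballI)
      fix d assume "d \<notin> cells m - {?c}"
      then show "(e(?c := 0)) d = 0" using excitationsD(1)[OF e(1), of d] by (cases "d = ?c") auto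
    next
      fix d assume d: "d \<in> cells m - {?c}"
      then have "shifted e d \<noteq> (p, l p)"
        using inj_onD[OF inj_on_shifted[OF e(1)], of d ?c] c sc by auto
      then have "shifted e d \<in> cells l - {(p, l p)}" using excitationsD(2)[OF e(1)] d by auto
      then show "shifted (e(?c := 0)) d \<in> cells l - {(p, l p)}" using d by (auto simp: shifted_def)
    next
      fix d d' assume "d \<in> cells m - {?c}" "d' \<in> cells m - {?c}" "fst d \<le> fst d'" "snd d \<le> snd d'"
      then show "(e(?c := 0)) d \<le> (e(?c := 0)) d'" using excitationsD(3)[OF e(1)] by auto
    qed
  qed
  show "(\<lambda>e. e(?c := p - r)) ` excitations ?l ?m \<subseteq> {e \<in> excitations l m. e ?c = p - r}"
  proof clarify
    fix e assume e: "e \<in> excitations ?l ?m"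
    note eD = excitationsD[OF e, unfolded cm cl]
    \<comment> \<open>Needed for monotonicity after the cell is restored. The left or the upper
      neighbour of that cell dominates \<open>d\<close>, and a shift beyond \<open>p - r\<close>
      would take this neighbour out of \<open>l\<close>.\<close>
    have small: "e d \<le> p - r" if d: "d \<in> cells m - {?c}" "fst d \<le> r" "snd d \<le> m r" for d
    proof (cases "fst d = r")
      case True
      then have "snd d < m r" using d by (cases d) auto
      then have c': "(r, m r - 1) \<in> cells m - {?c}" using d True r by (cases d) auto
      let ?g = "e (r, m r - 1)"
      have "e d \<le> ?g" using eD(3)[OF d(1) c'] True \<open>snd d < m r\<close> by simp
      moreover have "?g \<le> p - r"
      proof (rule ccontr)
        assume "\<not> ?thesis"
        then have "l (r + ?g) \<le> l (Suc p)" using is_partD[OF l, of "Suc p" "r + ?g"] r by simp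
        moreover have "m r - 1 + ?g \<le> l (r + ?g)" using eD(2)[OF c'] by (simp add: shifted_def)
        ultimately show False using p r \<open>\<not> ?g \<le> p - r\<close> by simp
      qed
      ultimately show ?thesis by simp
    next
      case False
      then have "1 < r" using d by (cases d) auto
      then have "m r \<le> m (r - 1)" using is_partD[OF m, of "r - 1" r] by simp
      then have c': "(r - 1, m r) \<in> cells m - {?c}" using \<open>1 < r\<close> r by auto
      let ?g = "e (r - 1, m r)"
      have "e d \<le> ?g" using eD(3)[OF d(1) c'] False d by simp
      moreover have "?g \<le> p - r"
      proof (rule ccontr)
        assume "\<not> ?thesis"
        then have "l (r - 1 + ?g) \<le> l p" using is_partD[OF l, of p "r - 1 + ?g"] p r by simp
        moreover have "m r + ?g \<le> l (r - 1 + ?g)" using eD(2)[OF c'] by (simp add: shifted_def)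
        ultimately show False using p r \<open>\<not> ?g \<le> p - r\<close> by simp
      qed
      ultimately show ?thesis by simp
    qed
    have corner: "d = ?c" if "d \<in> cells m" "r \<le> fst d" "m r \<le> snd d" for d
    proof (rule ccontr)
      assume "d \<noteq> ?c"
      then have "Suc r \<le> fst d" using that by (cases d; cases "fst d = r") auto
      then have "m (fst d) \<le> m (Suc r)" using is_partD[OF m, of "Suc r" "fst d"] by simp
      then show False using that r by (cases d) auto
    qed
    show "e(?c := p - r) \<in> excitations l m \<and> (e(?c := p - r)) ?c = p - r"
      unfolding excitations_def
    proof (intro CollectI conjI allI impI ballI)
      fix d assume "d \<notin> cells m"
      then show "(e(?c := p - r)) d = 0" using eD(1) c by auto
    next
      fix d assume d: "d \<in> cells m"
      show "shifted (e(?c := p - r)) d \<in> cells l"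
      proof (cases "d = ?c")
        case True
        then show ?thesis using r p by (simp add: shifted_def)
      next
        case False
        then have "shifted e d \<in> cells l" using eD(2)[of d] d by simp
        then show ?thesis using False by (simp add: shifted_def)
      qed
    next
      fix d d' assume dd: "d \<in> cells m" "d' \<in> cells m" "fst d \<le> fst d'" "snd d \<le> snd d'"
      show "(e(?c := p - r)) d \<le> (e(?c := p - r)) d'"
      proof (cases "d = ?c")
        case True
        then have "d' = ?c" using corner[of d'] dd by simp
        then show ?thesis using True by simp
      next
        case False
        then show ?thesis using small[of d] eD(3)[of d d'] dd by (cases "d' = ?c") auto
      qed
    qed simp
  qed
qed

text \<open>\<open>f i\<close> is the row in which the diagonal through the last cell of row \<open>i\<close> of \<open>m\<close> leaves \<open>l\<close>.\<close>

definition diag_flag :: "(nat \<Rightarrow> nat) \<Rightarrow> (nat \<Rightarrow> nat) \<Rightarrow> (nat \<Rightarrow> nat) \<Rightarrow> bool" where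
  "diag_flag l m f \<longleftrightarrow> (\<forall>i\<ge>1. 1 \<le> m i \<longrightarrow>
     i \<le> f i \<and> f i + m i \<le> l (f i) + i \<and> l (Suc (f i)) + i \<le> f i + m i)"

lemma diag_flagD:
  assumes "diag_flag l m f" "1 \<le> i" "1 \<le> m i"
  shows "i \<le> f i" "f i + m i \<le> l (f i) + i" "l (Suc (f i)) + i \<le> f i + m i"
  using assms by (auto simp: diag_flag_def)

lemma diag_flag_unique:
  assumes l: "is_part N l" and f: "diag_flag l m f" and i: "1 \<le> i" "1 \<le> m i"
    and p: "i \<le> p" "p + m i \<le> l p + i" "l (Suc p) + i \<le> p + m i"
  shows "f i = p"
proof (rule ccontr)
  note fi = diag_flagD[OF f i]
  assume "f i \<noteq> p"
  then consider "f i < p" | "p < f i" by linarith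
  then show False
  proof cases
    case 1
    then have "l p \<le> l (Suc (f i))" using is_partD[OF l, of "Suc (f i)" p] by simp
    then show False using fi p 1 by simp
  next
    case 2
    then have "l (f i) \<le> l (Suc p)" using is_partD[OF l, of "Suc p" "f i"] by simp
    then show False using fi p 2 by simp
  qed
qed

text \<open>By induction on the size of \<open>l\<close>. If no row of \<open>m\<close> ends on the
  diagonal of the removed corner, neither side changes. If row \<open>r\<close> does and row
  \<open>r + 1\<close> is equally long, the corner cannot be occupied, and lowering the flag of
  \<open>r\<close> preserves the determinant. Otherwise both sides split in two.\<close>

lemma card_excitations_eq_fdet:
  assumes m: "is_part n m" and l: "is_part N l" and sub: "\<And>i. 1 \<le> i \<Longrightarrow> m i \<le> l i"
    and f: "diag_flag l m f"
  shows "int (card (excitations l m)) = fdet (\<lambda>_. 1) n m f"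
  using assms
proof (induction "\<Sum>i = 1..N. l i" arbitrary: l m f rule: less_induct)
  case less
  note m = less.prems(1) and l = less.prems(2) and sub = less.prems(3) and f = less.prems(4)
  show ?case
  proof (cases "\<exists>p\<ge>1. m p < l p")
    case False
    then have ml: "l i = m i" if "1 \<le> i" for i using sub[OF that] that by (metis le_less)
    have "excitations l m = {\<lambda>_. 0}"
    proof (intro equalityI subsetI)
      fix e assume e: "e \<in> excitations l m"
      have "e c = 0" for c
      proof (cases "c \<in> cells m")
        case True
        obtain i j where c: "c = (i, j)" by force
        have d: "(i, m i) \<in> cells m" using True c by auto
        have "e c \<le> e (i, m i)" using excitationsD(3)[OF e True d] True c by simp
        moreover have "m i + e (i, m i) \<le> l (i + e (i, m i))"
          using excitationsD(2)[OF e d] by (simp add: shifted_def)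
        moreover have "l (i + e (i, m i)) \<le> m i"
          using is_partD[OF l, of i "i + e (i, m i)"] ml[of i] True c by simp
        ultimately show ?thesis by simp
      qed (use excitationsD(1)[OF e] in blast)
      then show "e \<in> {\<lambda>_. 0}" by auto
    next
      fix e :: "nat \<times> nat \<Rightarrow> nat" assume "e \<in> {\<lambda>_. 0}"
      then show "e \<in> excitations l m" using ml by (auto simp: excitations_def shifted_def)
    qed
    moreover have "fdet (\<lambda>_. 1::int) n m f = (\<Prod>i = 1..n. 1 ^ m i)"
    proof (rule fdet_dominant[OF m])
      fix i assume i: "1 \<le> i" "1 \<le> m i"
      show "f i = i"
        by (rule diag_flag_unique[OF l f i]) (use i ml is_partD[OF l, of i "Suc i"] in auto)
    qed
    ultimately show ?thesis by simp
  next
    case True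
    let ?S = "{i. 1 \<le> i \<and> m i < l i}"
    have "i \<le> N" if "m i < l i" for i
      using is_part_zero[OF l, of i] that by (cases "N < i") auto
    then have "?S \<subseteq> {1..N}" by auto
    then have fin: "finite ?S" using finite_subset by blast
    \<comment> \<open>The last row in which \<open>l\<close> exceeds \<open>m\<close>. Its end is an
      outer corner of \<open>l\<close>, because the next row of \<open>l\<close> is no longer than
      that of \<open>m\<close>.\<close>
    define p where "p = Max ?S"
    have p: "1 \<le> p" "m p < l p" using Max_in[OF fin] True unfolding p_def by auto
    have "p \<le> N" using \<open>?S \<subseteq> {1..N}\<close> p by auto
    have "\<not> m (Suc p) < l (Suc p)" using Max_ge[OF fin, of "Suc p"] unfolding p_def[symmetric] by auto
    then have corner: "l (Suc p) < l p"
      using is_partD[OF m, of p "Suc p"] p by simp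
    let ?l = "l(p := l p - 1)"
    have l': "is_part N ?l" using is_part_remove[OF l p(1) corner] .
    have sub': "m i \<le> ?l i" if "1 \<le> i" for i using sub[OF that] p by auto
    have less_sum: "(\<Sum>i = 1..N. ?l i) < (\<Sum>i = 1..N. l i)"
      by (rule sum_strict_mono_ex1) (use p \<open>p \<le> N\<close> in auto)
    \<comment> \<open>The ends of the rows of a partition lie on distinct diagonals, so at most one
      row is affected.\<close>
    have content: "i = r" if "1 \<le> i" "1 \<le> r" "m i + p = l p + i" "m r + p = l p + r" for i r
      using is_partD[OF m, of i r] is_partD[OF m, of r i] that by (cases "i \<le> r") auto
    have rp: "r < p" if "1 \<le> r" "1 \<le> m r" "m r + p = l p + r" for r
    proof (rule ccontr)
      assume "\<not> r < p"
      then have "m r \<le> m p" using is_partD[OF m, of p r] p by simp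
      then show False using that p \<open>\<not> r < p\<close> by simp
    qed
    have fp: "f r = p" if "1 \<le> r" "1 \<le> m r" "m r + p = l p + r" for r
      by (rule diag_flag_unique[OF l f that(1,2)]) (use that rp[OF that] corner in auto)
    have keep: "diag_flag ?l m' g"
      if g: "\<And>i. 1 \<le> i \<Longrightarrow> 1 \<le> m' i \<Longrightarrow> i \<le> g i \<and> g i + m' i \<le> ?l (g i) + i \<and> ?l (Suc (g i)) + i \<le> g i + m' i"
      for m' g using g by (simp add: diag_flag_def)
    have keep_row: "i \<le> f i \<and> f i + m i \<le> ?l (f i) + i \<and> ?l (Suc (f i)) + i \<le> f i + m i"
      if "1 \<le> i" "1 \<le> m i" "m i + p \<noteq> l p + i" for i
      using diag_flagD[OF f that(1,2)] that(3) by auto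
    show ?thesis
    proof (cases "\<exists>r. 1 \<le> r \<and> 1 \<le> m r \<and> m r + p = l p + r")
      case False
      have "excitations ?l m = excitations l m"
      proof -
        have "shifted e c \<noteq> (p, l p)" if "e \<in> excitations l m" "c \<in> cells m" for e c
          using excitation_at_corner[OF m l p(1) corner that(1), of "fst c" "snd c"] that(2) False
          by (cases c) auto
        then show ?thesis
          by (subst excitations_remove_corner) (use p in auto)
      qed
      moreover have D: "diag_flag ?l m f" by (rule keep) (use keep_row False in blast)
      have "int (card (excitations ?l m)) = fdet (\<lambda>_. 1) n m f"
        by (rule less.hyps[OF less_sum m l' _ D]) (rule sub')
      ultimately show ?thesis by (simp only:)
    next
      case True
      then obtain r where r: "1 \<le> r" "1 \<le> m r" "m r + p = l p + r" by blast
      note fr = fp[OF r] and rp = rp[OF r]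
      obtain b where b: "p = Suc b" using p(1) by (cases p) auto
      have rn: "r \<le> n" using is_part_zero[OF m, of r] r by (cases "n < r") auto
      have D: "diag_flag ?l m (f(r := b))"
      proof (rule keep)
        fix i assume i: "1 \<le> i" "1 \<le> m i"
        show "i \<le> (f(r := b)) i \<and> (f(r := b)) i + m i \<le> ?l ((f(r := b)) i) + i \<and>
            ?l (Suc ((f(r := b)) i)) + i \<le> (f(r := b)) i + m i"
        proof (cases "i = r")
          case True
          have "l p \<le> l b" using is_partD[OF l, of b p] rp r b by simp
          then show ?thesis using True rp r b p by simp
        next
          case False
          then have "m i + p \<noteq> l p + i" using content[OF i(1) r(1) _ r(3)] by blast
          then show ?thesis using keep_row[OF i] False by simp
        qed
      qed
      have E1: "int (card (excitations ?l m)) = fdet (\<lambda>_. 1) n m (f(r := b))"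
        by (rule less.hyps[OF less_sum m l' _ D]) (rule sub')
      show ?thesis
      proof (cases "m (Suc r) < m r")
        case False
        then have eq: "m (Suc r) = m r" using is_partD[OF m, of r "Suc r"] r by simp
        have "excitations ?l m = excitations l m"
        proof -
          have "shifted e c \<noteq> (p, l p)" if "e \<in> excitations l m" "c \<in> cells m" for e c
            using excitation_at_corner[OF m l p(1) corner that(1), of "fst c" "snd c"] that(2)
              content[OF _ r(1) _ r(3), of "fst c"] eq by (cases c) auto
          then show ?thesis
            by (subst excitations_remove_corner) (use p in auto)
        qed
        moreover have "fdet (\<lambda>_. 1) n m f = fdet (\<lambda>_. 1::int) n m (f(r := b))"
        proof (rule fdet_lower_equal_rows)
          show "f (Suc r) = Suc b"
            unfolding b[symmetric]
            by (rule diag_flag_unique[OF l f]) (use eq r rp p corner in auto)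
          show "r < n" using is_part_zero[OF m, of "Suc r"] eq r by (cases "n < Suc r") auto
        qed (use r fr b eq in auto)
        ultimately show ?thesis using E1 by simp
      next
        case True
        let ?m = "m(r := m r - 1)"
        have m': "is_part n ?m" using is_part_remove[OF m r(1) True] .
        \<comment> \<open>Shortening row \<open>r\<close> moves its end to the neighbouring
          diagonal, which leaves the smaller \<open>l\<close> in row \<open>p\<close> again; hence
          the flag stays.\<close>
        have "diag_flag ?l ?m f"
        proof (rule keep)
          fix i assume i: "1 \<le> i" "1 \<le> ?m i"
          show "i \<le> f i \<and> f i + ?m i \<le> ?l (f i) + i \<and> ?l (Suc (f i)) + i \<le> f i + ?m i"
          proof (cases "i = r")
            case True
            then show ?thesis using fr rp r p corner i by auto
          next
            case False
            then have "m i + p \<noteq> l p + i" using content[OF i(1) r(1) _ r(3)] by blast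
            then show ?thesis using keep_row[of i] i False by simp
          qed
        qed
        moreover have "?m i \<le> ?l i" if "1 \<le> i" for i using sub'[OF that] by auto
        ultimately have E2: "int (card (excitations ?l ?m)) = fdet (\<lambda>_. 1) n ?m f"
          using less.hyps[OF less_sum m' l'] by blast
        let ?B = "{e \<in> excitations l m. e (r, m r) = p - r}"
        have at: "shifted e c = (p, l p) \<longleftrightarrow> c = (r, m r) \<and> e c = p - r"
          if e: "e \<in> excitations l m" and c: "c \<in> cells m" for e c
        proof
          assume s: "shifted e c = (p, l p)"
          obtain i j where ij: "c = (i, j)" by force
          have "j = m i" "i = r"
            using excitation_at_corner[OF m l p(1) corner e c[unfolded ij] s[unfolded ij]]
              content[OF _ r(1) _ r(3), of i] c ij by auto
          then show "c = (r, m r) \<and> e c = p - r" using s ij by (auto simp: shifted_def)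
        next
          assume "c = (r, m r) \<and> e c = p - r"
          then show "shifted e c = (p, l p)" using rp r by (auto simp: shifted_def)
        qed
        have cr: "(r, m r) \<in> cells m" using r by simp
        have "(\<forall>c\<in>cells m. shifted e c \<noteq> (p, l p)) \<longleftrightarrow> e (r, m r) \<noteq> p - r"
          if "e \<in> excitations l m" for e
          using at[OF that] cr by blast
        moreover have "excitations ?l m = {e \<in> excitations l m. \<forall>c\<in>cells m. shifted e c \<noteq> (p, l p)}"
          by (rule excitations_remove_corner) (use p in auto)
        ultimately have "excitations ?l m = excitations l m - ?B" by blast
        then have "card (excitations l m) = card (excitations ?l m) + card ?B"
          using finite_excitations[OF l, of m] card_mono[of "excitations l m" ?B]
          by (simp add: card_Diff_subset)
        also have "card ?B = card (excitations ?l ?m)"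
          by (rule bij_betw_same_card[OF excitations_corner_bij[OF m l p(1) corner r(1) _ True r(3)]])
            (use rp in simp)
        finally have card_eq: "card (excitations l m) = card (excitations ?l m) + card (excitations ?l ?m)" .
        have "fdet (\<lambda>_. 1::int) n m f = fdet (\<lambda>_. 1) n m (f(r := b)) + 1 * fdet (\<lambda>_. 1) n ?m f"
          by (rule fdet_rec) (use r rn fr b in auto)
        then show ?thesis unfolding card_eq of_nat_add E1 E2 by simp
      qed
    qed
  qed
qed

section \<open>Lehmer codes of vexillary permutations\<close>

definition lehmer_code :: "nat \<Rightarrow> (nat \<Rightarrow> nat) \<Rightarrow> nat \<Rightarrow> nat" where
  "lehmer_code n w i = card {l. i < l \<and> l \<le> n \<and> w l < w i}"

lemma vexillaryD:
  assumes "vexillary n w" "1 \<le> i" "i < j" "j < k" "k < l" "l \<le> n" "w j < w i" "w i < w l" "w l < w k"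
  shows False
  using assms unfolding vexillary_def by blast

lemma finite_code_set: "finite {l::nat. i < l \<and> l \<le> n \<and> w l < (a::nat)}"
  by (rule finite_subset[of _ "{..n}"]) auto

lemma code_mono:
  assumes "{l. i < l \<and> l \<le> n \<and> w l < w i} \<subseteq> {l. j < l \<and> l \<le> n \<and> w l < w j}"
  shows "lehmer_code n w i \<le> lehmer_code n w j"
  unfolding lehmer_code_def by (rule card_mono[OF finite_code_set assms])

lemma interval_increasing:
  fixes f :: "nat \<Rightarrow> 'a::preorder"
  assumes "\<And>i. a \<le> i \<Longrightarrow> i < b \<Longrightarrow> f i < f (Suc i)" "a \<le> i" "i < j" "j \<le> b"
  shows "f i < f j"
  using assms(3,4)
proof (induction j)
  case (Suc j)
  then have "f j < f (Suc j)" using assms(1,2) by simp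
  then show ?case using Suc by (cases "i = j") (auto intro: less_trans)
qed simp

lemma interval_decreasing:
  fixes f :: "nat \<Rightarrow> 'a::preorder"
  assumes "\<And>i. a \<le> i \<Longrightarrow> i < b \<Longrightarrow> f (Suc i) < f i" "a \<le> i" "i < j" "j \<le> b"
  shows "f j < f i"
  using assms(3,4)
proof (induction j)
  case (Suc j)
  then have "f (Suc j) < f j" using assms(1,2) by simp
  then show ?case using Suc by (cases "i = j") (auto intro: less_trans)
qed simp

text \<open>The ascent used to climb from a vexillary permutation to a longer one is the first one,
  within the first ascending run, behind which no inversion lies entirely above it.\<close>

lemma vexillary_good_ascent:
  assumes w: "w permutes {1..n}" and vex: "vexillary n w"
    and asc: "\<exists>k. 1 \<le> k \<and> k < n \<and> w k < w (Suc k)"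
  obtains k where "1 \<le> k" "k < n" "w k < w (Suc k)"
    and "vexillary n (w \<circ> transpose k (Suc k))"
    and "\<And>j l. Suc k < j \<Longrightarrow> j < l \<Longrightarrow> l \<le> n \<Longrightarrow> w l < w j \<Longrightarrow> w l < w (Suc k)"
    and "\<And>i. 1 \<le> i \<Longrightarrow> i < k \<Longrightarrow> Suc (Suc (lehmer_code n w (Suc k))) \<le> lehmer_code n w i \<or>
      Suc i = k \<and> lehmer_code n w i = Suc (lehmer_code n w (Suc k)) \<or> lehmer_code n w i \<le> lehmer_code n w k"
proof -
  have inj: "w i = w j \<longleftrightarrow> i = j" for i j using permutes_inj[OF w] by (auto simp: inj_eq)
  define k0 where "k0 = (LEAST k. 1 \<le> k \<and> k < n \<and> w k < w (Suc k))"
  have k0: "1 \<le> k0" "k0 < n" "w k0 < w (Suc k0)"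
    using LeastI_ex[OF asc] unfolding k0_def[symmetric] by auto
  have down: "w (Suc i) < w i" if "1 \<le> i" "i < k0" for i
    using not_less_Least[of i "\<lambda>k. 1 \<le> k \<and> k < n \<and> w k < w (Suc k)"] that k0(2) inj[of i "Suc i"]
    unfolding k0_def[symmetric] by auto
  note desc = interval_decreasing[of 1 k0 w, OF down]
  define M where "M = (LEAST M. k0 < M \<and> (M = n \<or> w (Suc M) < w M))"
  have "k0 < M \<and> (M = n \<or> w (Suc M) < w M)" unfolding M_def by (rule LeastI[of _ n]) (use k0 in simp)
  then have M: "k0 < M" "M = n \<or> w (Suc M) < w M" by auto
  have "M \<le> n" unfolding M_def by (rule Least_le) (use k0 in simp)
  have up: "w i < w (Suc i)" if "k0 \<le> i" "i < M" for i
    using not_less_Least[of i "\<lambda>M. k0 < M \<and> (M = n \<or> w (Suc M) < w M)"] that k0(3) inj[of i "Suc i"]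
    unfolding M_def[symmetric] by (cases "i = k0") auto
  note asc = interval_increasing[of k0 M w, OF up]
  define free where
    "free = (\<lambda>k. \<forall>j l. Suc k < j \<longrightarrow> j < l \<longrightarrow> l \<le> n \<longrightarrow> w l < w j \<longrightarrow> w l < w (Suc k))"
  define k where "k = (LEAST k. k0 \<le> k \<and> k < M \<and> free k)"
  have "k0 \<le> k \<and> k < M \<and> free k"
    unfolding k_def
  proof (rule LeastI[of _ "M - 1"], intro conjI)
    \<comment> \<open>The last ascent of the run qualifies: a later inversion above
      \<open>w M\<close> would form 2143 with the descent at \<open>M\<close>.\<close>
    show "free (M - 1)"
      unfolding free_def
    proof (intro allI impI)
      fix j l assume jl: "Suc (M - 1) < j" "j < l" "l \<le> n" "w l < w j"
      show "w l < w (Suc (M - 1))"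
      proof (rule ccontr)
        assume "\<not> ?thesis"
        then have Ml: "w M < w l" using M inj[of l M] jl by auto
        have M': "w (Suc M) < w M" using M jl by auto
        have "j \<noteq> Suc M" using M' Ml jl by auto
        then show False
          using vexillaryD[OF vex, of M "Suc M" j l] jl M M' Ml k0 by auto
      qed
    qed
  qed (use M in auto)
  then have k: "k0 \<le> k" "k < M" "free k" by auto
  have k': "1 \<le> k" "k < n" "w k < w (Suc k)" using k k0 \<open>M \<le> n\<close> up by auto
  have k_min: "\<not> free i" if "k0 \<le> i" "i < k" for i
    using not_less_Least[of i "\<lambda>k. k0 \<le> k \<and> k < M \<and> free k"] that k(2) unfolding k_def[symmetric] by auto
  \<comment> \<open>If \<open>k\<close> is not the first ascent, then \<open>k - 1\<close> is not
    free, so some later inversion lies above \<open>w k\<close>. Preceded by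
    \<open>w i > w k0\<close> it would complete a 2143, unless \<open>w i\<close> exceeds its lower
    value and therefore \<open>w k\<close>.\<close>
  have above: "w k < w i" if i: "1 \<le> i" "i < k0" for i
  proof (cases "k = k0")
    case True
    then show ?thesis using desc[of i k0] i by simp
  next
    case False
    then have "\<not> free (k - 1)" using k_min[of "k - 1"] k by simp
    then obtain j l where jl: "k < j" "j < l" "l \<le> n" "w l < w j" "\<not> w l < w k"
      using k' unfolding free_def by auto
    then have "w k < w l" using inj[of k l] by auto
    moreover have "\<not> w i < w l"
      using vexillaryD[OF vex, of i k0 j l] i jl k desc[of i k0] by auto
    ultimately show ?thesis by simp
  qed
  have gap: "\<not> (w i < w l \<and> w l < w (Suc k))" if "1 \<le> i" "i < k0" "Suc k < l" "l \<le> n" for i l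
    using vexillaryD[OF vex, of i k0 "Suc k" l] that k desc[of i k0] by auto
  have cond2: "w k < w i" if "1 \<le> i" "i < j" "j < k" "w j < w i" for i j
  proof (rule above[OF that(1)], rule ccontr)
    assume "\<not> i < k0"
    then have "w i < w j" using asc[of i j] that k by simp
    then show False using that by simp
  qed
  have vex': "vexillary n (w \<circ> transpose k (Suc k))"
    unfolding vexillary_def
  proof (rule notI, elim exE conjE)
    fix i j a b
    let ?t = "transpose k (Suc k)"
    assume ord: "1 \<le> i" "i < j" "j < a" "a < b" "b \<le> n"
      and pat: "(w \<circ> ?t) j < (w \<circ> ?t) i" "(w \<circ> ?t) i < (w \<circ> ?t) b" "(w \<circ> ?t) b < (w \<circ> ?t) a"
    have t: "?t x < ?t y" if "x < y" "\<not> (x = k \<and> y = Suc k)" for x y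
      using that by (auto simp: transpose_def)
    have tk: "?t k = Suc k" "?t (Suc k) = k" by auto
    have t1: "1 \<le> ?t i" "?t b \<le> n" using ord k' by (auto simp: transpose_def)
    \<comment> \<open>A new pattern must use the exchanged pair as two neighbouring entries: as 21
      this is excluded by \<open>free\<close>, as 14 by the descent at \<open>k\<close>, as 43 by
      \<open>cond2\<close>. Otherwise the positions transported by \<open>?t\<close> give a pattern
      of \<open>w\<close> itself.\<close>
    consider "i = k" "j = Suc k" | "j = k" "a = Suc k" | "a = k" "b = Suc k"
      | "\<not> (i = k \<and> j = Suc k)" "\<not> (j = k \<and> a = Suc k)" "\<not> (a = k \<and> b = Suc k)" by blast
    then show False
    proof cases
      case 1
      then have "?t a = a" "?t b = b" using ord by auto
      then show False
        using 1 pat k(3)[unfolded free_def, rule_format, of a b] ord by (auto simp: tk)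
    next
      case 2
      then show False using pat k'(3) by (simp add: tk)
    next
      case 3
      then have "?t i = i" "?t j = j" using ord by auto
      then show False using 3 pat cond2[of i j] ord by (auto simp: tk)
    next
      case 4
      then show False
        using vexillaryD[OF vex t1(1) t[of i j] t[of j a] t[of a b] t1(2)] ord pat by simp
    qed
  qed
  \<comment> \<open>Inside the run, every inversion of \<open>i\<close> is one of \<open>k\<close>.
    Before the run, \<open>i\<close> has all inversions of \<open>k + 1\<close> and in addition
    \<open>k\<close>; if \<open>i + 1\<close> is not \<open>k\<close>, there is one more strictly
    between \<open>i\<close> and \<open>k\<close>.\<close>
  have codes: "Suc (Suc (lehmer_code n w (Suc k))) \<le> lehmer_code n w i \<or>
      Suc i = k \<and> lehmer_code n w i = Suc (lehmer_code n w (Suc k)) \<or> lehmer_code n w i \<le> lehmer_code n w k"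
    if i: "1 \<le> i" "i < k" for i
  proof (cases "i < k0")
    case False
    have "lehmer_code n w i \<le> lehmer_code n w k"
    proof (rule code_mono, rule subsetI, clarify)
      fix l assume l: "i < l" "l \<le> n" "w l < w i"
      have ik: "w i < w k" using asc[of i k] False i k by simp
      have "\<not> l \<le> k" using asc[of i l] False l k by auto
      then show "k < l \<and> l \<le> n \<and> w l < w k" using l ik by simp
    qed
    then show ?thesis by blast
  next
    case True
    let ?T = "{l. Suc k < l \<and> l \<le> n \<and> w l < w (Suc k)}"
    let ?S = "{l. i < l \<and> l \<le> n \<and> w l < w i}"
    have ki: "w k < w i" using above[OF i(1) True] .
    have "w l < w i" if "l \<in> ?T" for l
      using gap[OF i(1) True, of l] that inj[of l i] i by auto
    then have T: "?T \<subseteq> ?S" using i by auto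
    have "insert k ?T \<subseteq> ?S" using T ki i k' by auto
    then have "card (insert k ?T) \<le> card ?S" by (rule card_mono[OF finite_code_set])
    then have 1: "Suc (lehmer_code n w (Suc k)) \<le> lehmer_code n w i"
      using finite_code_set[of "Suc k" n w "w (Suc k)"] by (simp add: lehmer_code_def)
    show ?thesis
    proof (cases "Suc i = k")
      case True
      then show ?thesis using 1 by auto
    next
      case False
      obtain x where x: "i < x" "x < k" "w x < w i"
      proof (cases "k0 < k")
        case True
        show ?thesis by (rule that[of k0]) (use True \<open>i < k0\<close> desc[of i k0] i in auto)
      next
        case False
        then show ?thesis using that[of "Suc i"] \<open>Suc i \<noteq> k\<close> i k desc[of i "Suc i"] by auto
      qed
      then have "insert x (insert k ?T) \<subseteq> ?S" using T ki i k' by auto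
      then have "card (insert x (insert k ?T)) \<le> card ?S" by (rule card_mono[OF finite_code_set])
      then have "Suc (Suc (lehmer_code n w (Suc k))) \<le> lehmer_code n w i"
        using finite_code_set[of "Suc k" n w "w (Suc k)"] x by (simp add: lehmer_code_def)
      then show ?thesis by blast
    qed
  qed
  show ?thesis
    by (rule that[OF k' vex' _ codes]) (use k(3) in \<open>auto simp: free_def\<close>)
qed

section \<open>The Lehmer code around the chosen ascent\<close>

lemma code_ascent_le:
  assumes "w k < w (Suc k)"
  shows "lehmer_code n w k \<le> lehmer_code n w (Suc k)"
proof (rule code_mono, rule subsetI, clarify)
  fix l assume "k < l" "l \<le> n" "w l < w k"
  then show "Suc k < l \<and> l \<le> n \<and> w l < w (Suc k)" using assms by (cases "l = Suc k") auto
qed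

lemma code_after_ascent_le:
  assumes free: "\<And>j l. Suc k < j \<Longrightarrow> j < l \<Longrightarrow> l \<le> n \<Longrightarrow> w l < w j \<Longrightarrow> w l < w (Suc k)" and j: "Suc k < j"
  shows "lehmer_code n w j \<le> lehmer_code n w (Suc k)"
  by (rule code_mono) (use free[OF j] j in auto)

text \<open>The inversions of \<open>q\<close> are among those of \<open>k + 1\<close>, hence all of
  them by count. They lie behind \<open>q\<close>, so positions between \<open>k + 1\<close> and
  \<open>q\<close> carry larger values and have the same inversions.\<close>

lemma code_after_ascent_block:
  assumes w: "w permutes {1..n}"
    and free: "\<And>j l. Suc k < j \<Longrightarrow> j < l \<Longrightarrow> l \<le> n \<Longrightarrow> w l < w j \<Longrightarrow> w l < w (Suc k)"
    and q: "Suc k < q" "q \<le> n" "lehmer_code n w q = lehmer_code n w (Suc k)"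
    and j: "Suc k < j" "j \<le> q"
  shows "lehmer_code n w j = lehmer_code n w (Suc k)"
proof -
  let ?S = "\<lambda>i. {l. i < l \<and> l \<le> n \<and> w l < w i}"
  have inj: "w i = w j \<longleftrightarrow> i = j" for i j using permutes_inj[OF w] by (auto simp: inj_eq)
  have sub: "?S i \<subseteq> ?S (Suc k)" if "Suc k < i" for i using free[OF that] that by auto
  have eq: "?S q = ?S (Suc k)"
    using card_subset_eq[OF finite_code_set sub[OF q(1)]] q(3) by (simp add: lehmer_code_def)
  have "j \<notin> ?S (Suc k)" unfolding eq[symmetric] using j by simp
  then have "w (Suc k) < w j" using j q inj[of j "Suc k"] by auto
  then have "l \<in> ?S j" if "l \<in> ?S (Suc k)" for l
    using that[folded eq] that j by auto
  then have "?S (Suc k) \<subseteq> ?S j" by blast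
  then have "?S j = ?S (Suc k)" using sub[OF j(1)] by blast
  then show ?thesis by (simp add: lehmer_code_def)
qed

lemma code_swap:
  assumes k: "1 \<le> k" "k < n" "w k < w (Suc k)"
  defines "u \<equiv> w \<circ> transpose k (Suc k)"
  shows "lehmer_code n u k = Suc (lehmer_code n w (Suc k))"
    and "lehmer_code n u (Suc k) = lehmer_code n w k"
    and "i \<noteq> k \<Longrightarrow> i \<noteq> Suc k \<Longrightarrow> lehmer_code n u i = lehmer_code n w i"
proof -
  let ?t = "transpose k (Suc k)"
  have u: "u k = w (Suc k)" "u (Suc k) = w k" "\<And>l. l \<noteq> k \<Longrightarrow> l \<noteq> Suc k \<Longrightarrow> u l = w l"
    by (auto simp: u_def)
  have "{l. k < l \<and> l \<le> n \<and> u l < u k} = insert (Suc k) {l. Suc k < l \<and> l \<le> n \<and> w l < w (Suc k)}"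
  proof (rule Set.set_eqI)
    fix l
    show "l \<in> {l. k < l \<and> l \<le> n \<and> u l < u k} \<longleftrightarrow>
        l \<in> insert (Suc k) {l. Suc k < l \<and> l \<le> n \<and> w l < w (Suc k)}"
      using k u by (cases "l = Suc k"; cases "k < l") auto
  qed
  then show "lehmer_code n u k = Suc (lehmer_code n w (Suc k))"
    using finite_code_set[of "Suc k" n w "w (Suc k)"] by (simp add: lehmer_code_def)
  have "{l. Suc k < l \<and> l \<le> n \<and> u l < u (Suc k)} = {l. k < l \<and> l \<le> n \<and> w l < w k}"
  proof (rule Set.set_eqI)
    fix l
    show "l \<in> {l. Suc k < l \<and> l \<le> n \<and> u l < u (Suc k)} \<longleftrightarrow> l \<in> {l. k < l \<and> l \<le> n \<and> w l < w k}"
      using k u by (cases "l = Suc k"; cases "k < l") auto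
  qed
  then show "lehmer_code n u (Suc k) = lehmer_code n w k" by (simp add: lehmer_code_def)
  assume i: "i \<noteq> k" "i \<noteq> Suc k"
  have "{l. i < l \<and> l \<le> n \<and> u l < u i} = ?t ` {l. i < l \<and> l \<le> n \<and> w l < w i}"
  proof (rule Set.set_eqI)
    fix l
    have "l \<in> ?t ` {l. i < l \<and> l \<le> n \<and> w l < w i} \<longleftrightarrow> ?t l \<in> {l. i < l \<and> l \<le> n \<and> w l < w i}"
      by (rule in_transpose_image_iff)
    also have "\<dots> \<longleftrightarrow> i < ?t l \<and> ?t l \<le> n \<and> u l < u i"
      using u(3)[OF i] by (simp add: u_def)
    also have "\<dots> \<longleftrightarrow> l \<in> {l. i < l \<and> l \<le> n \<and> u l < u i}"
    proof -
      have "i < ?t l \<and> ?t l \<le> n \<longleftrightarrow> i < l \<and> l \<le> n"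
        using i k by (cases "l = k"; cases "l = Suc k") auto
      then show ?thesis by blast
    qed
    finally show "l \<in> {l. i < l \<and> l \<le> n \<and> u l < u i} \<longleftrightarrow> l \<in> ?t ` {l. i < l \<and> l \<le> n \<and> w l < w i}" by simp
  qed
  then show "lehmer_code n u i = lehmer_code n w i"
    by (simp add: lehmer_code_def card_image)
qed

section \<open>Vexillary Schubert polynomials as flagged determinants\<close>

definition count_ge :: "nat \<Rightarrow> (nat \<Rightarrow> nat) \<Rightarrow> nat \<Rightarrow> nat" where
  "count_ge n c v = card {i \<in> {1..n}. v \<le> c i}"

definition last_ge :: "nat \<Rightarrow> (nat \<Rightarrow> nat) \<Rightarrow> nat \<Rightarrow> nat" where
  "last_ge n c v = Max {i \<in> {1..n}. v \<le> c i}"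

text \<open>\<open>m\<close> lists the values of \<open>c\<close> in decreasing order; equivalently its conjugate partition is
  \<open>count_ge n c\<close>.\<close>

definition is_sorting :: "nat \<Rightarrow> (nat \<Rightarrow> nat) \<Rightarrow> (nat \<Rightarrow> nat) \<Rightarrow> bool" where
  "is_sorting n c m \<longleftrightarrow> (\<forall>r\<ge>1. \<forall>v\<ge>1. v \<le> m r \<longleftrightarrow> r \<le> count_ge n c v)"

lemma is_sortingD: "is_sorting n c m \<Longrightarrow> 1 \<le> r \<Longrightarrow> 1 \<le> v \<Longrightarrow> v \<le> m r \<longleftrightarrow> r \<le> count_ge n c v"
  by (simp add: is_sorting_def)

lemma last_ge_eqI:
  assumes "1 \<le> j" "j \<le> n" "v \<le> c j" "\<And>i. j < i \<Longrightarrow> i \<le> n \<Longrightarrow> c i < v"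
  shows "last_ge n c v = j"
  unfolding last_ge_def
proof (rule Max_eqI)
  fix i assume "i \<in> {i \<in> {1..n}. v \<le> c i}"
  then show "i \<le> j" using assms(4)[of i] by (cases "j < i") auto
qed (use assms in auto)

lemma last_ge_ge: "1 \<le> i \<Longrightarrow> i \<le> n \<Longrightarrow> v \<le> c i \<Longrightarrow> i \<le> last_ge n c v"
  unfolding last_ge_def by (rule Max_ge) auto

lemma last_ge_in:
  assumes "1 \<le> i" "i \<le> n" "v \<le> c i"
  shows "1 \<le> last_ge n c v" "last_ge n c v \<le> n" "v \<le> c (last_ge n c v)"
proof -
  have "last_ge n c v \<in> {i \<in> {1..n}. v \<le> c i}"
    unfolding last_ge_def by (rule Max_in) (use assms in auto)
  then show "1 \<le> last_ge n c v" "last_ge n c v \<le> n" "v \<le> c (last_ge n c v)" by auto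
qed

lemma count_ge_antimono: "v \<le> v' \<Longrightarrow> count_ge n c v' \<le> count_ge n c v"
  unfolding count_ge_def by (rule card_mono) auto

lemma is_sorting_is_part:
  assumes "is_sorting n c m"
  shows "is_part n m"
  unfolding is_part_def
proof (intro conjI allI impI)
  fix i j :: nat assume ij: "1 \<le> i" "i \<le> j"
  show "m j \<le> m i"
  proof (cases "m j = 0")
    case False
    then have "j \<le> count_ge n c (m j)" using is_sortingD[OF assms, of j "m j"] ij by simp
    then show ?thesis using is_sortingD[OF assms, of i "m j"] ij False by simp
  qed simp
next
  fix i assume "n < i"
  have "count_ge n c 1 \<le> card {1..n}" unfolding count_ge_def by (rule card_mono) auto
  then show "m i = 0" using is_sortingD[OF assms, of i 1] \<open>n < i\<close> by simp
qed

lemma is_sorting_occurs: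
  assumes m: "is_sorting n c m" and r: "1 \<le> r" "1 \<le> m r"
  obtains i where "1 \<le> i" "i \<le> n" "c i = m r"
proof -
  have "r \<le> count_ge n c (m r)" "\<not> r \<le> count_ge n c (Suc (m r))"
    using is_sortingD[OF m r(1), of "m r"] is_sortingD[OF m r(1), of "Suc (m r)"] r by auto
  then have "\<not> {i \<in> {1..n}. m r \<le> c i} \<subseteq> {i \<in> {1..n}. Suc (m r) \<le> c i}"
    using card_mono[of "{i \<in> {1..n}. Suc (m r) \<le> c i}" "{i \<in> {1..n}. m r \<le> c i}"]
    unfolding count_ge_def by fastforce
  then obtain i where "i \<in> {1..n}" "m r \<le> c i" "\<not> Suc (m r) \<le> c i" by blast
  then show ?thesis using that[of i] by auto
qed

lemma is_sorting_block_end: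
  assumes m: "is_sorting n c m" and r: "1 \<le> r" "m (Suc r) < m r"
  shows "count_ge n c (m r) = r"
  using is_sortingD[OF m r(1), of "m r"] is_sortingD[OF m, of "Suc r" "m r"] r by simp

text \<open>Abstracts the codes \<open>c\<close> of \<open>w\<close> and \<open>d\<close> of the
  longer permutation, so that the rest of the step concerns sequences of numbers.\<close>

locale code_ascent =
  fixes n k :: nat and c d m :: "nat \<Rightarrow> nat"
  assumes k: "1 \<le> k" "k < n"
    and d: "d k = Suc (c (Suc k))" "d (Suc k) = c k" "\<And>i. i \<noteq> k \<Longrightarrow> i \<noteq> Suc k \<Longrightarrow> d i = c i"
    and ck: "c k \<le> c (Suc k)"
    and after: "\<And>j. Suc k < j \<Longrightarrow> j \<le> n \<Longrightarrow> c j \<le> c (Suc k)"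
    and before: "\<And>i. 1 \<le> i \<Longrightarrow> i < k \<Longrightarrow> Suc (Suc (c (Suc k))) \<le> c i \<or>
      Suc i = k \<and> c i = Suc (c (Suc k)) \<or> c i \<le> c k"
    and block: "\<And>q j. Suc k < q \<Longrightarrow> q \<le> n \<Longrightarrow> c q = c (Suc k) \<Longrightarrow> Suc k < j \<Longrightarrow> j \<le> q \<Longrightarrow>
      c j = c (Suc k)"
    and m: "is_sorting n c m"
begin

definition C where "C = c (Suc k)"
text \<open>In \<open>d\<close> the entry \<open>C\<close> has become \<open>C + 1\<close>. After
  sorting, the row that grows is the first one of length \<open>C\<close>, just behind the rows
  longer than \<open>C\<close>.\<close>

definition R where "R = Suc (count_ge n c (Suc C))"

lemma R: "1 \<le> R" "R \<le> n"
proof -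
  have "{i \<in> {1..n}. Suc C \<le> c i} \<subseteq> {1..n} - {Suc k}" by (auto simp: C_def)
  then have "count_ge n c (Suc C) \<le> card ({1..n} - {Suc k})"
    unfolding count_ge_def by (intro card_mono) auto
  then show "1 \<le> R" "R \<le> n" using k by (auto simp: R_def)
qed

lemma row_before: "1 \<le> r \<Longrightarrow> r < R \<Longrightarrow> Suc C \<le> m r"
  using is_sortingD[OF m, of r "Suc C"] by (auto simp: R_def)

lemma row_after: "R \<le> r \<Longrightarrow> m r \<le> C"
  using is_sortingD[OF m, of r "Suc C"] R by (auto simp: R_def not_less_eq_eq)

lemma count_C: "Suc (count_ge n c (Suc C)) \<le> count_ge n c C"
proof -
  have "insert (Suc k) {i \<in> {1..n}. Suc C \<le> c i} \<subseteq> {i \<in> {1..n}. C \<le> c i}" using k by (auto simp: C_def)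
  then have "card (insert (Suc k) {i \<in> {1..n}. Suc C \<le> c i}) \<le> count_ge n c C"
    unfolding count_ge_def by (intro card_mono) auto
  then show ?thesis by (simp add: count_ge_def C_def)
qed

lemma mR: "m R = C"
proof (rule antisym[OF row_after[OF order_refl]])
  show "C \<le> m R"
    using is_sortingD[OF m R(1), of C] count_C by (cases "C = 0") (auto simp: R_def)
qed

text \<open>Up to the exchange of \<open>k\<close> and \<open>k + 1\<close>, \<open>d\<close> is
  \<open>c\<close> with one entry \<open>C\<close> raised by one, which is visible at the threshold
  \<open>C + 1\<close> alone.\<close>

lemma count_d: "count_ge n d v = count_ge n c v + (if v = Suc C then 1 else 0)"
proof -
  let ?t = "transpose k (Suc k)"
  let ?c = "c(Suc k := Suc C)"
  have dc: "d (?t i) = ?c i" for i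
    using d by (cases "i = k"; cases "i = Suc k") (auto simp: C_def)
  have "{i \<in> {1..n}. v \<le> d i} = ?t ` {i \<in> {1..n}. v \<le> ?c i}"
  proof (rule Set.set_eqI)
    fix i
    have ti: "?t i \<in> {1..n} \<longleftrightarrow> i \<in> {1..n}"
      using k by (cases "i = k"; cases "i = Suc k") auto
    have "i \<in> ?t ` {i \<in> {1..n}. v \<le> ?c i} \<longleftrightarrow> ?t i \<in> {i \<in> {1..n}. v \<le> ?c i}"
      by (rule in_transpose_image_iff)
    also have "\<dots> \<longleftrightarrow> ?t i \<in> {1..n} \<and> v \<le> ?c (?t i)" by blast
    also have "\<dots> \<longleftrightarrow> i \<in> {1..n} \<and> v \<le> d i"
      unfolding ti dc[symmetric] by simp
    finally show "i \<in> {i \<in> {1..n}. v \<le> d i} \<longleftrightarrow> i \<in> ?t ` {i \<in> {1..n}. v \<le> ?c i}" by simp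
  qed
  then have 1: "count_ge n d v = card {i \<in> {1..n}. v \<le> ?c i}"
    by (simp add: count_ge_def card_image)
  show ?thesis
  proof (cases "v = Suc C")
    case True
    then have "{i \<in> {1..n}. v \<le> ?c i} = insert (Suc k) {i \<in> {1..n}. v \<le> c i}" using k by auto
    then show ?thesis unfolding 1 using True by (simp add: count_ge_def C_def)
  next
    case False
    then have "{i \<in> {1..n}. v \<le> ?c i} = {i \<in> {1..n}. v \<le> c i}" by (auto simp: C_def)
    then show ?thesis unfolding 1 using False by (simp add: count_ge_def)
  qed
qed

lemma sorting_d: "is_sorting n d (m(R := Suc C))"
  unfolding is_sorting_def
proof (intro allI impI)
  fix r v :: nat assume rv: "1 \<le> r" "1 \<le> v"
  show "v \<le> (m(R := Suc C)) r \<longleftrightarrow> r \<le> count_ge n d v"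
  proof (cases "r = R")
    case False
    then show ?thesis using is_sortingD[OF m rv] by (auto simp: count_d R_def)
  next
    case True
    have "R \<le> count_ge n d v \<longleftrightarrow> v \<le> Suc C"
    proof -
      consider "v \<le> C" | "v = Suc C" | "Suc C < v" by linarith
      then show ?thesis
      proof cases
        case 1
        then show ?thesis using is_sortingD[OF m R(1) rv(2)] mR by (auto simp: count_d)
      next
        case 2
        then show ?thesis by (simp add: count_d R_def)
      next
        case 3
        then show ?thesis using count_ge_antimono[of "Suc C" v n c] by (auto simp: count_d R_def)
      qed
    qed
    then show ?thesis using True by simp
  qed
qed

lemma small_from_k: "k \<le> i \<Longrightarrow> i \<le> n \<Longrightarrow> c i \<le> C"
  using ck after[of i] by (cases "i = k"; cases "i = Suc k") (auto simp: C_def)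

lemma last_before:
  assumes "1 \<le> r" "r < R"
  shows "last_ge n c (m r) < k"
proof -
  have mr: "Suc C \<le> m r" using row_before assms by blast
  then obtain i where i: "1 \<le> i" "i \<le> n" "c i = m r" using is_sorting_occurs[OF m assms(1)] by auto
  show ?thesis
    using last_ge_in[of i n "m r" c] small_from_k[of "last_ge n c (m r)"] i mr by (cases "last_ge n c (m r) < k") auto
qed

text \<open>By \<open>before\<close>, an entry \<open>C + 1\<close> can sit only at
  \<open>k - 1\<close>. This provides the step of one from the flag of a row of length
  \<open>C + 1\<close> to the flag \<open>k\<close> of row \<open>R\<close>.\<close>

lemma last_Suc_C:
  assumes "1 \<le> r" "m r = Suc C"
  shows "Suc (last_ge n c (Suc C)) = k"
proof -
  obtain i where i: "1 \<le> i" "i \<le> n" "c i = Suc C" using is_sorting_occurs[OF m assms(1)] assms by auto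
  have "i < k" using small_from_k[of i] i by (cases "i < k") auto
  then have "Suc i = k" using before[of i] i ck by (auto simp: C_def)
  then have "last_ge n c (Suc C) = i"
    using small_from_k i by (intro last_ge_eqI) (auto simp: le_imp_less_Suc)
  then show ?thesis using \<open>Suc i = k\<close> by simp
qed

lemma last_C: "Suc k \<le> last_ge n c v" if "v \<le> C"
  using last_ge_ge[of "Suc k" n v c] that k by (auto simp: C_def)

lemma last_d_large: "Suc C < v \<Longrightarrow> last_ge n d v = last_ge n c v"
proof -
  assume v: "Suc C < v"
  have "{i \<in> {1..n}. v \<le> d i} = {i \<in> {1..n}. v \<le> c i}"
  proof (rule Set.set_eqI)
    fix i show "i \<in> {i \<in> {1..n}. v \<le> d i} \<longleftrightarrow> i \<in> {i \<in> {1..n}. v \<le> c i}"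
      using v d ck by (cases "i = k"; cases "i = Suc k") (auto simp: C_def)
  qed
  then show "last_ge n d v = last_ge n c v" by (simp add: last_ge_def)
qed

lemma last_d_Suc_C: "last_ge n d (Suc C) = k"
proof (rule last_ge_eqI)
  fix i assume "k < i" "i \<le> n"
  then show "d i < Suc C" using d ck after[of i] by (cases "i = Suc k") (auto simp: C_def less_Suc_eq_le)
qed (use k d in \<open>auto simp: C_def\<close>)

text \<open>The danger is the position \<open>k + 1\<close>, whose entry drops from \<open>C\<close>
  to \<open>c k\<close>. Either \<open>c k\<close> is still at least \<open>m r\<close>, or the last
  position lies beyond \<open>k + 1\<close>.\<close>

lemma last_d_small:
  assumes r: "R < r" "1 \<le> m r"
  shows "last_ge n d (m r) = last_ge n c (m r)"
proof -
  let ?v = "m r"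
  have vC: "?v \<le> C" using row_after[of r] r by simp
  have other: "?v \<le> c k \<or> (\<exists>j>Suc k. j \<le> n \<and> ?v \<le> c j)"
  proof -
    obtain i where i: "1 \<le> i" "i \<le> n" "c i = ?v" "i \<noteq> Suc k"
    proof (cases "?v = C")
      case False
      obtain i where "1 \<le> i" "i \<le> n" "c i = ?v" using is_sorting_occurs[OF m, of r] r by auto
      then show ?thesis using that[of i] False by (cases "i = Suc k") (auto simp: C_def)
    next
      case True
      \<comment> \<open>Rows \<open>R\<close> and \<open>r\<close> are two different rows of length
        \<open>C\<close>, so some position other than \<open>k + 1\<close> has the entry
        \<open>C\<close>.\<close>
      have "r \<le> count_ge n c C" using is_sortingD[OF m, of r C] r True by auto
      then have "card (insert (Suc k) {i \<in> {1..n}. Suc C \<le> c i}) < card {i \<in> {1..n}. C \<le> c i}"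
        using r(1) by (simp add: count_ge_def R_def C_def)
      then have "\<not> {i \<in> {1..n}. C \<le> c i} \<subseteq> insert (Suc k) {i \<in> {1..n}. Suc C \<le> c i}"
        using card_mono[of "insert (Suc k) {i \<in> {1..n}. Suc C \<le> c i}" "{i \<in> {1..n}. C \<le> c i}"] by auto
      then obtain i where "i \<in> {1..n}" "C \<le> c i" "\<not> Suc C \<le> c i" "i \<noteq> Suc k" by blast
      then show ?thesis using that[of i] True by auto
    qed
    show ?thesis
    proof (cases "i < k")
      case True
      then show ?thesis using before[OF i(1) True] i vC by (auto simp: C_def)
    next
      case False
      then have "i = k \<or> Suc k < i" using i by auto
      then show ?thesis using i by auto
    qed
  qed
  define q where "q = last_ge n c ?v"
  have q: "Suc k \<le> q" using last_C[OF vC] by (simp add: q_def)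
  have q': "q \<le> n" "?v \<le> c q" using last_ge_in[of "Suc k" n ?v c] vC k by (auto simp: q_def C_def)
  have q_last: "c i < ?v" if "q < i" "i \<le> n" for i
    using last_ge_ge[of i n ?v c] that by (cases "?v \<le> c i") (auto simp: q_def)
  have "last_ge n d ?v = q"
  proof (rule last_ge_eqI)
    show "?v \<le> d q"
    proof (cases "q = Suc k")
      case True
      then show ?thesis using other q_last d by (auto simp: not_less[symmetric])
    next
      case False
      then show ?thesis using d q q' by auto
    qed
    show "d i < ?v" if "q < i" "i \<le> n" for i using q_last[OF that] d q that by auto
  qed (use q q' in auto)
  then show ?thesis by (simp add: q_def)
qed

text \<open>All entries from \<open>k + 1\<close> up to the last \<open>C\<close> are equal to
  \<open>C\<close>, so there are at most as many of them as rows from \<open>R\<close> to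
  \<open>r\<close>.\<close>

lemma last_C_bound:
  assumes r: "R \<le> r" "m r = C" "m (Suc r) < C"
  shows "last_ge n c C \<le> Suc k + (r - R)"
proof -
  let ?q = "last_ge n c C"
  have q: "Suc k \<le> ?q" "?q \<le> n" "C \<le> c ?q"
    using last_C[of C] last_ge_in[of "Suc k" n C c] k by (auto simp: C_def)
  have eq: "c j = C" if "Suc k \<le> j" "j \<le> ?q" for j
  proof (cases "j = Suc k")
    case False
    have "c ?q = C" using q small_from_k[of ?q] by auto
    then show ?thesis using block[of ?q j] that False q by (auto simp: C_def)
  qed (simp add: C_def)
  have "{i \<in> {1..n}. Suc C \<le> c i} \<union> {Suc k..?q} \<subseteq> {i \<in> {1..n}. C \<le> c i}" using eq q by auto
  then have "card ({i \<in> {1..n}. Suc C \<le> c i} \<union> {Suc k..?q}) \<le> count_ge n c C"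
    unfolding count_ge_def by (intro card_mono) auto
  moreover have "card ({i \<in> {1..n}. Suc C \<le> c i} \<union> {Suc k..?q}) = count_ge n c (Suc C) + (?q - k)"
    unfolding count_ge_def by (subst card_Un_disjoint) (use eq in auto)
  moreover have "count_ge n c C = r"
    using is_sorting_block_end[OF m, of r] r R by simp
  ultimately show ?thesis using q r(1) by (simp add: R_def)
qed

text \<open>As it stands, a ramp for the grown shape, where row \<open>R\<close> with flag
  \<open>k\<close> ends the block of length \<open>C + 1\<close>. With \<open>k + 1\<close> at row
  \<open>R\<close> it is a ramp for \<open>m\<close>, where row \<open>R\<close> begins the block of
  length \<open>C\<close>; the cap is the flag that this block must reach.\<close>

definition flag where
  "flag r = (if r = R then k else if R < r \<and> m r = C then min (last_ge n c C) (Suc k + (r - R))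
    else last_ge n c (m r))"

lemma flag_ramp_after:
  assumes "R < r" "m (Suc r) = m r"
  shows "flag r \<le> flag (Suc r) \<and> flag (Suc r) \<le> Suc (flag r)"
  using assms by (auto simp: flag_def)

text \<open>Both determinants are rewritten with ramps that differ in row \<open>R\<close> only.
  Rows before \<open>R\<close> have flags below \<open>k\<close> and rows after it flags above
  \<open>k\<close>, so \<open>k\<close> occurs once.\<close>

lemma divided_difference_step:
  "divided_difference k (fdet var n (m(R := Suc C)) (\<lambda>r. last_ge n d ((m(R := Suc C)) r))) =
   fdet var n m (\<lambda>r. last_ge n c (m r))"
proof -
  let ?m = "m(R := Suc C)"
  have m_part: "is_part n m" by (rule is_sorting_is_part[OF m])
  have 1: "fdet var n ?m (\<lambda>r. last_ge n d (?m r)) = fdet var n ?m flag"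
  proof (rule fdet_ramp_flag_eq)
    show "is_part n ?m" by (rule is_sorting_is_part[OF sorting_d])
    show "ramp_flag ?m (\<lambda>r. last_ge n d (?m r))" by (simp add: ramp_flag_def)
    show "ramp_flag ?m flag"
      unfolding ramp_flag_def
    proof (intro allI impI)
      fix r assume r: "1 \<le> r" "1 \<le> ?m r" "?m (Suc r) = ?m r"
      consider "Suc r < R" | "Suc r = R" | "r = R" | "R < r" by linarith
      then show "flag r \<le> flag (Suc r) \<and> flag (Suc r) \<le> Suc (flag r)"
      proof cases
        case 1
        then show ?thesis using r by (simp add: flag_def)
      next
        case 2
        then have "m r = Suc C" using r by simp
        then show ?thesis using last_Suc_C[OF r(1)] 2 by (auto simp: flag_def)
      next
        case 3
        then show ?thesis using r row_after[of "Suc R"] by simp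
      next
        case 4
        then show ?thesis using flag_ramp_after[of r] r by simp
      qed
    qed
    fix r assume r: "1 \<le> r" "?m (Suc r) < ?m r"
    consider "r < R" | "r = R" | "R < r" by linarith
    then show "last_ge n d (?m r) = flag r"
    proof cases
      case 1
      have "Suc C \<le> m r" using row_before[OF r(1) 1] .
      moreover have "Suc C \<le> ?m (Suc r)" using row_before[of "Suc r"] 1 by (cases "Suc r = R") auto
      ultimately have "Suc C < m r" using r 1 by simp
      then show ?thesis using last_d_large 1 by (simp add: flag_def)
    next
      case 2
      then show ?thesis using last_d_Suc_C by (simp add: flag_def)
    next
      case 3
      then have mr: "m (Suc r) < m r" using r by simp
      show ?thesis
        using last_d_small[of r] last_C_bound[of r] 3 mr by (auto simp: flag_def)
    qed
  qed
  have 2: "divided_difference k (fdet var n ?m flag) = fdet var n (?m(R := C)) (flag(R := Suc k))"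
  proof (rule divided_difference_fdet[OF R k(1)])
    fix r assume r: "1 \<le> r" "r \<le> n" "r \<noteq> R"
    show "flag r \<noteq> k"
    proof (cases "r < R")
      case True
      then show ?thesis using last_before[OF r(1)] by (auto simp: flag_def)
    next
      case False
      then show ?thesis using last_C[of "m r"] row_after[of r] r by (auto simp: flag_def)
    qed
  qed (simp_all add: flag_def)
  have "?m(R := C) = m" using mR by auto
  moreover have "fdet var n m (flag(R := Suc k)) = fdet var n m (\<lambda>r. last_ge n c (m r))"
  proof (rule fdet_ramp_flag_eq[OF m_part])
    show "ramp_flag m (\<lambda>r. last_ge n c (m r))" by (simp add: ramp_flag_def)
    show "ramp_flag m (flag(R := Suc k))"
      unfolding ramp_flag_def
    proof (intro allI impI)
      fix r assume r: "1 \<le> r" "1 \<le> m r" "m (Suc r) = m r"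
      consider "Suc r < R" | "Suc r = R" | "r = R" | "R < r" by linarith
      then show "(flag(R := Suc k)) r \<le> (flag(R := Suc k)) (Suc r) \<and>
          (flag(R := Suc k)) (Suc r) \<le> Suc ((flag(R := Suc k)) r)"
      proof cases
        case 1
        then show ?thesis using r by (simp add: flag_def)
      next
        case 2
        then show ?thesis using r row_before[of r] mR by simp
      next
        case 3
        then show ?thesis using r mR last_C[of C] by (auto simp: flag_def)
      next
        case 4
        then show ?thesis using flag_ramp_after[of r] r by simp
      qed
    qed
    fix r assume r: "1 \<le> r" "m (Suc r) < m r"
    consider "r < R" | "r = R" | "R < r" by linarith
    then show "(flag(R := Suc k)) r = last_ge n c (m r)"
    proof cases
      case 1
      then show ?thesis by (simp add: flag_def)
    next
      case 2
      then show ?thesis using last_C_bound[of R] last_C[of C] mR r by auto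
    next
      case 3
      then show ?thesis using last_C_bound[of r] r by (auto simp: flag_def)
    qed
  qed
  ultimately show ?thesis unfolding 1 2 by simp
qed

end

lemma code_longest: "i \<in> {1..n} \<Longrightarrow> lehmer_code n (longest_perm n) i = n - i"
proof -
  assume i: "i \<in> {1..n}"
  then have "{l. i < l \<and> l \<le> n \<and> longest_perm n l < longest_perm n i} = {i<..n}"
    by (auto simp: longest_perm_def)
  then show "lehmer_code n (longest_perm n) i = n - i" by (simp add: lehmer_code_def)
qed

lemma is_schubert_vexillary:
  assumes "w permutes {1..n}" "vexillary n w" "is_sorting n (lehmer_code n w) m"
  shows "is_schubert n w (fdet var n m (\<lambda>r. last_ge n (lehmer_code n w) (m r)))"
  using assms
proof (induction arbitrary: m rule: perm_ascent_induct)
  case longest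
  let ?c = "lehmer_code n (longest_perm n)"
  have count: "count_ge n ?c v = n - v" if "1 \<le> v" for v
  proof -
    have "{i \<in> {1..n}. v \<le> ?c i} = {1..n - v}" using that by (auto simp: code_longest)
    then show ?thesis by (simp add: count_ge_def)
  qed
  have m: "m r = n - r" if "1 \<le> r" for r
  proof (rule antisym)
    show "m r \<le> n - r"
      using is_sortingD[OF longest(2) that, of "m r"] count[of "m r"] that by (cases "m r = 0") auto
    show "n - r \<le> m r"
      using is_sortingD[OF longest(2) that, of "n - r"] count[of "n - r"] that by (cases "n - r = 0") auto
  qed
  have "fdet var n m (\<lambda>r. last_ge n ?c (m r)) = (\<Prod>i = 1..n. var i ^ m i)"
  proof (rule fdet_dominant[OF is_sorting_is_part[OF longest(2)]])
    fix i assume i: "1 \<le> i" "i \<le> n" "1 \<le> m i"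
    show "last_ge n ?c (m i) = i"
      by (rule last_ge_eqI) (use i m in \<open>auto simp: code_longest\<close>)
  qed
  also have "\<dots> = (\<Prod>i = 1..n. var i ^ (n - i))" using m by (intro prod.cong) auto
  finally show ?case using is_schubert.longest[of n] by simp
next
  case (ascent w)
  obtain k where asc: "1 \<le> k" "k < n" "w k < w (Suc k)"
    and vex: "vexillary n (w \<circ> transpose k (Suc k))"
    and free: "\<And>j l. Suc k < j \<Longrightarrow> j < l \<Longrightarrow> l \<le> n \<Longrightarrow> w l < w j \<Longrightarrow> w l < w (Suc k)"
    and before: "\<And>i. 1 \<le> i \<Longrightarrow> i < k \<Longrightarrow> Suc (Suc (lehmer_code n w (Suc k))) \<le> lehmer_code n w i \<or>
      Suc i = k \<and> lehmer_code n w i = Suc (lehmer_code n w (Suc k)) \<or> lehmer_code n w i \<le> lehmer_code n w k"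
    using vexillary_good_ascent[OF ascent.hyps(1) ascent.prems(1) ascent.hyps(2)] by blast
  let ?u = "w \<circ> transpose k (Suc k)"
  interpret code_ascent n k "lehmer_code n w" "lehmer_code n ?u" m
  proof
    show "lehmer_code n w j = lehmer_code n w (Suc k)"
      if "Suc k < q" "q \<le> n" "lehmer_code n w q = lehmer_code n w (Suc k)" "Suc k < j" "j \<le> q" for q j
      by (rule code_after_ascent_block[OF ascent.hyps(1) free that])
    show "lehmer_code n w j \<le> lehmer_code n w (Suc k)" if "Suc k < j" "j \<le> n" for j
      using code_after_ascent_le[of k n w j] free that by blast
    show "lehmer_code n ?u i = lehmer_code n w i" if "i \<noteq> k" "i \<noteq> Suc k" for i
      by (rule code_swap(3)[OF asc that])
  qed (rule asc code_swap(1,2)[OF asc] code_ascent_le[OF asc(3)] ascent.prems(2) before; assumption)+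
  have "is_schubert n ?u (fdet var n (m(R := Suc C)) (\<lambda>r. last_ge n (lehmer_code n ?u) ((m(R := Suc C)) r)))"
    by (rule ascent.IH[OF asc vex sorting_d])
  then have "is_schubert n w (divided_difference k
      (fdet var n (m(R := Suc C)) (\<lambda>r. last_ge n (lehmer_code n ?u) ((m(R := Suc C)) r))))"
    by (rule is_schubert_descend[OF _ asc])
  then show ?case unfolding divided_difference_step .
qed

section \<open>Shape and supershape\<close>

definition rows :: "nat list \<Rightarrow> nat \<Rightarrow> nat" where
  "rows p i = (if 1 \<le> i \<and> i \<le> length p then p ! (i - 1) else 0)"

lemma young_diagram_rows: "young_diagram p = cells (rows p)"
  by (auto simp: young_diagram_def cells_def rows_def split: if_splits)

lemma cells_inject:
  assumes "cells l = cells m" "1 \<le> i"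
  shows "l i = m i"
proof (rule antisym)
  show "l i \<le> m i" using assms cells_iff[of i "l i" l] cells_iff[of i "l i" m] by (cases "l i = 0") auto
  show "m i \<le> l i" using assms cells_iff[of i "m i" l] cells_iff[of i "m i" m] by (cases "m i = 0") auto
qed

lemma is_partition_young_inject:
  assumes "is_partition p" "is_partition q" "young_diagram p = young_diagram q"
  shows "p = q"
proof -
  have r: "rows p i = rows q i" if "1 \<le> i" for i
    using cells_inject assms(3) that unfolding young_diagram_rows by blast
  have pos: "rows p i \<noteq> 0" if "is_partition p" "1 \<le> i" "i \<le> length p" for p i
  proof -
    have "p ! (i - 1) \<in> set p" by (rule nth_mem) (use that in simp)
    then have "p ! (i - 1) \<noteq> 0" using that(1) unfolding is_partition_def by metis
    then show ?thesis using that by (simp add: rows_def)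
  qed
  have "\<not> length p < length q"
    using pos[OF assms(2), of "Suc (length p)"] r[of "Suc (length p)"] by (auto simp: rows_def)
  moreover have "\<not> length q < length p"
    using pos[OF assms(1), of "Suc (length q)"] r[of "Suc (length q)"] by (auto simp: rows_def)
  ultimately have len: "length p = length q" by simp
  show ?thesis
  proof (rule nth_equalityI[OF len])
    fix i assume "i < length p"
    then show "p ! i = q ! i" using r[of "Suc i"] len by (simp add: rows_def)
  qed
qed

lemma is_part_list:
  assumes l: "is_part n l"
  obtains p where "is_partition p" "young_diagram p = cells l"
proof -
  define K where "K = (LEAST K. l (Suc K) = 0)"
  have K0: "l (Suc K) = 0" unfolding K_def by (rule LeastI[of _ n]) (simp add: is_part_zero[OF l])
  have pos: "l i \<noteq> 0" if "1 \<le> i" "i \<le> K" for i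
    using not_less_Least[of "i - 1" "\<lambda>K. l (Suc K) = 0"] that unfolding K_def[symmetric] by auto
  have zero: "l i = 0" if "K < i" for i using is_partD[OF l, of "Suc K" i] K0 that by simp
  define p where "p = map (\<lambda>i. l (Suc i)) [0..<K]"
  have r: "rows p i = l i" if "1 \<le> i" for i
    using that zero[of i] by (auto simp: rows_def p_def)
  have "is_partition p"
    unfolding is_partition_def
  proof
    show "sorted_wrt (\<ge>) p"
      unfolding sorted_wrt_iff_nth_less using is_partD[OF l] by (auto simp: p_def)
    show "0 \<notin> set p"
    proof
      assume "0 \<in> set p"
      then obtain i where "i < K" "l (Suc i) = 0" by (auto simp: p_def)
      then show False using pos[of "Suc i"] by simp
    qed
  qed
  moreover have "young_diagram p = cells l"
    unfolding young_diagram_rows using r by (auto simp: cells_def)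
  ultimately show ?thesis by (rule that)
qed

lemma is_partition_rows_antimono:
  assumes "is_partition p" "1 \<le> i" "i \<le> j"
  shows "rows p j \<le> rows p i"
  using assms sorted_wrt_nth_less[of "(\<ge>)" p "i - 1" "j - 1"]
  by (cases "i = j") (auto simp: is_partition_def rows_def)

text \<open>For the Rothe diagram of \<open>w\<close> these are the parts of the supershape of \<open>w\<close>.\<close>

definition ideal_row :: "(nat \<times> nat) set \<Rightarrow> nat \<Rightarrow> nat" where
  "ideal_row D a = Max (insert 0 {y. \<exists>i\<ge>a. (i, y) \<in> D})"

lemma ideal_row_finite: "finite D \<Longrightarrow> finite {y. \<exists>i\<ge>a. (i, y) \<in> D}"
  by (rule finite_subset[of _ "snd ` D"]) force+

lemma ideal_row_ge: "finite D \<Longrightarrow> (i, y) \<in> D \<Longrightarrow> a \<le> i \<Longrightarrow> y \<le> ideal_row D a"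
  unfolding ideal_row_def by (rule Max_ge) (auto intro: ideal_row_finite)

lemma ideal_row_cases:
  assumes "finite D"
  obtains "ideal_row D a = 0" | i where "a \<le> i" "(i, ideal_row D a) \<in> D"
proof -
  have "ideal_row D a \<in> insert 0 {y. \<exists>i\<ge>a. (i, y) \<in> D}"
    unfolding ideal_row_def by (rule Max_in) (use ideal_row_finite[OF assms] in auto)
  then show ?thesis using that by blast
qed

lemma ideal_row_is_part:
  assumes "finite D" "D \<subseteq> {1..n} \<times> UNIV"
  shows "is_part n (ideal_row D)"
  unfolding is_part_def
proof (intro conjI allI impI)
  fix i j :: nat assume ij: "1 \<le> i" "i \<le> j"
  show "ideal_row D j \<le> ideal_row D i"
  proof (rule ideal_row_cases[OF assms(1), of j])
    fix a assume "j \<le> a" "(a, ideal_row D j) \<in> D"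
    then show ?thesis using ideal_row_ge[OF assms(1), of a "ideal_row D j" i] ij by simp
  qed simp
next
  fix i assume "n < i"
  then show "ideal_row D i = 0"
  proof -
    consider "ideal_row D i = 0" | a where "i \<le> a" "(a, ideal_row D i) \<in> D"
      by (rule ideal_row_cases[OF assms(1)])
    then show ?thesis
    proof cases
      case (2 a)
      then show ?thesis using assms(2) \<open>n < i\<close> by auto
    qed
  qed
qed

lemma finite_rothe: "finite (rothe_diagram n w)"
  by (rule finite_subset[of _ "{..n} \<times> w ` {..n}"]) (auto simp: rothe_diagram_def)

lemma rothe_iff: "(i, y) \<in> rothe_diagram n w \<longleftrightarrow> (\<exists>l. y = w l \<and> 1 \<le> i \<and> i < l \<and> l \<le> n \<and> w l < w i)"
  by (auto simp: rothe_diagram_def)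

lemma rothe_is_part: "is_part n (ideal_row (rothe_diagram n w))"
  by (rule ideal_row_is_part[OF finite_rothe]) (auto simp: rothe_diagram_def)

lemma young_supershape:
  assumes w: "w permutes {1..n}"
  shows "young_diagram (supershape n w) = cells (ideal_row (rothe_diagram n w))"
proof -
  let ?D = "rothe_diagram n w"
  obtain p where p: "is_partition p" "young_diagram p = cells (ideal_row ?D)"
    using is_part_list[OF rothe_is_part] by blast
  have sub: "?D \<subseteq> young_diagram p"
  proof
    fix c assume c: "c \<in> ?D"
    obtain i y where iy: "c = (i, y)" by force
    obtain l where "y = w l" "1 \<le> i" "i < l" "l \<le> n" using c iy rothe_iff by auto
    then have "1 \<le> y" using permutes_in_image[OF w, of l] by simp
    then show "c \<in> young_diagram p"
      unfolding p(2) iy using ideal_row_ge[OF finite_rothe, of i y n w i] c iy \<open>1 \<le> i\<close> by simp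
  qed
  have least: "young_diagram p \<subseteq> young_diagram q" if q: "is_partition q" "?D \<subseteq> young_diagram q" for q
  proof
    fix c assume "c \<in> young_diagram p"
    then obtain a b where ab: "c = (a, b)" "1 \<le> a" "1 \<le> b" "b \<le> ideal_row ?D a"
      unfolding p(2) by (auto simp: cells_def)
    then obtain i where i: "a \<le> i" "(i, ideal_row ?D a) \<in> ?D"
      by (cases rule: ideal_row_cases[OF finite_rothe[of n w], of a]) auto
    then have "ideal_row ?D a \<le> rows q i" using q(2) unfolding young_diagram_rows by auto
    also have "\<dots> \<le> rows q a" by (rule is_partition_rows_antimono[OF q(1) ab(2) i(1)])
    finally show "c \<in> young_diagram q" unfolding young_diagram_rows using ab by simp
  qed
  have "supershape n w = p"
    unfolding supershape_def
  proof (rule the_equality)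
    fix q assume q: "is_partition q \<and> ?D \<subseteq> young_diagram q \<and>
      (\<forall>q'. is_partition q' \<and> ?D \<subseteq> young_diagram q' \<longrightarrow> young_diagram q \<subseteq> young_diagram q')"
    then have "young_diagram q = young_diagram p" using p(1) sub least by blast
    then show "q = p" using is_partition_young_inject q p(1) by blast
  qed (use p(1) sub least in blast)
  then show ?thesis using p(2) by simp
qed

lemma sorted_nth_ge_iff:
  fixes xs :: "nat list"
  assumes "sorted_wrt (\<ge>) xs"
  shows "(r < length xs \<and> v \<le> xs ! r) \<longleftrightarrow> r < length (filter (\<lambda>x. v \<le> x) xs)"
  using assms
proof (induction xs arbitrary: r)
  case (Cons x xs)
  show ?case
  proof (cases "v \<le> x")
    case True
    then show ?thesis using Cons by (cases r) auto
  next
    case False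
    then have "filter (\<lambda>x. v \<le> x) xs = []" using Cons.prems by (auto simp: filter_empty_conv)
    moreover have "\<not> (r < length (x # xs) \<and> v \<le> (x # xs) ! r)"
      using False Cons.prems by (cases r) (auto dest!: nth_mem)
    ultimately show ?thesis using False by simp
  qed
qed simp

text \<open>Row \<open>i\<close> of the Rothe diagram has as many cells as the code at
  \<open>i\<close>. Dropping the empty rows is harmless since only thresholds
  \<open>v \<ge> 1\<close> are counted.\<close>

lemma shape_is_sorting:
  assumes w: "w permutes {1..n}"
  shows "is_sorting n (lehmer_code n w) (rows (shape n w))"
  unfolding is_sorting_def
proof (intro allI impI)
  fix r v :: nat assume rv: "1 \<le> r" "1 \<le> v"
  have card_row: "card {j. (i, j) \<in> rothe_diagram n w} = lehmer_code n w i" if "1 \<le> i" for i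
  proof -
    have "{j. (i, j) \<in> rothe_diagram n w} = w ` {l. i < l \<and> l \<le> n \<and> w l < w i}"
      using that by (auto simp: rothe_iff)
    then show ?thesis
      using card_image[OF inj_on_subset[OF permutes_inj[OF w] subset_UNIV]] by (simp add: lehmer_code_def)
  qed
  define xs where "xs = map (lehmer_code n w) [1..<n + 1]"
  have shape: "shape n w = rev (sort (filter (\<lambda>r. r > 0) xs))"
    unfolding shape_def xs_def
    by (rule arg_cong[of _ _ "\<lambda>xs. rev (sort (filter (\<lambda>r. r > 0) xs))"]) (auto simp: card_row)
  have sorted: "sorted_wrt (\<ge>) (shape n w)"
    unfolding shape sorted_wrt_rev by (simp add: sorted_sort)
  have "length (filter (\<lambda>x. v \<le> x) (shape n w)) = length (filter (\<lambda>x. v \<le> x) xs)"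
  proof -
    have "length (filter (\<lambda>x. v \<le> x) (shape n w)) = size (filter_mset (\<lambda>x. v \<le> x) (mset (shape n w)))"
      by (metis mset_filter size_mset)
    also have "mset (shape n w) = filter_mset (\<lambda>r. r > 0) (mset xs)"
      by (simp add: shape mset_filter)
    also have "filter_mset (\<lambda>x. v \<le> x) \<dots> = filter_mset (\<lambda>x. v \<le> x) (mset xs)"
      using rv(2) by (auto simp: filter_filter_mset intro!: filter_mset_cong)
    finally show ?thesis by (metis mset_filter size_mset)
  qed
  also have "\<dots> = count_ge n (lehmer_code n w) v"
  proof -
    have "length (filter (\<lambda>x. v \<le> x) xs) = card ({i. v \<le> lehmer_code n w i} \<inter> set [1..<n + 1])"
      unfolding xs_def filter_map length_map comp_def
      by (subst distinct_length_filter) auto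
    also have "{i. v \<le> lehmer_code n w i} \<inter> set [1..<n + 1] = {i \<in> {1..n}. v \<le> lehmer_code n w i}" by auto
    finally show ?thesis by (simp add: count_ge_def)
  qed
  finally have len: "length (filter (\<lambda>x. v \<le> x) (shape n w)) = count_ge n (lehmer_code n w) v" .
  show "v \<le> rows (shape n w) r \<longleftrightarrow> r \<le> count_ge n (lehmer_code n w) v"
    using sorted_nth_ge_iff[OF sorted, of "r - 1" v] rv unfolding len by (auto simp: rows_def)
qed

section \<open>Where the diagonals leave the supershape\<close>

lemma permutes_card_le:
  assumes w: "w permutes {1..n}" and y: "y \<le> n"
  shows "card {a \<in> {1..n}. w a \<le> y} = y"
proof -
  have "w ` {a \<in> {1..n}. w a \<le> y} = {1..y}"
  proof (intro equalityI subsetI)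
    fix v assume "v \<in> w ` {a \<in> {1..n}. w a \<le> y}"
    then show "v \<in> {1..y}" using permutes_in_image[OF w] by auto
  next
    fix v assume v: "v \<in> {1..y}"
    then have "v \<in> w ` {1..n}" using permutes_image[OF w] y by auto
    then show "v \<in> w ` {a \<in> {1..n}. w a \<le> y}" using v by auto
  qed
  then show ?thesis
    using card_image[OF inj_on_subset[OF permutes_inj[OF w] subset_UNIV], of "{a \<in> {1..n}. w a \<le> y}"] by simp
qed

text \<open>No entry beyond \<open>last_ge n c v\<close> reaches \<open>v\<close>. The identity
  turns the distance between flag and row index into a number of positions with a small
  entry.\<close>

lemma count_small_before_last:
  assumes "1 \<le> i" "i \<le> n" "v \<le> c i"
  shows "card {a \<in> {1..last_ge n c v}. c a < v} + count_ge n c v = last_ge n c v"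
proof -
  let ?j = "last_ge n c v"
  have jn: "?j \<le> n" using last_ge_in[of i n v c, OF assms] by simp
  have "{a \<in> {1..n}. v \<le> c a} = {a \<in> {1..?j}. v \<le> c a}"
    using last_ge_ge[of _ n v c] jn by auto
  then have "card {a \<in> {1..?j}. c a < v} + count_ge n c v =
      card ({a \<in> {1..?j}. c a < v} \<union> {a \<in> {1..?j}. v \<le> c a})"
    unfolding count_ge_def by (subst card_Un_disjoint) auto
  also have "{a \<in> {1..?j}. c a < v} \<union> {a \<in> {1..?j}. v \<le> c a} = {1..?j}" by auto
  finally show ?thesis by simp
qed

text \<open>Let \<open>(j, y)\<close> be the rightmost cell of row \<open>j\<close> of the Rothe
  diagram. The values up to \<open>y\<close> include those at the inversions of \<open>j\<close>, at
  least \<open>v\<close> in number, and those at the positions up to \<open>j\<close> with small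
  code: a value above \<open>y\<close> there would have all inversions of \<open>j\<close>.\<close>

lemma ideal_row_at_last:
  assumes w: "w permutes {1..n}" and i: "1 \<le> i" "i \<le> n" "v \<le> lehmer_code n w i" and v: "1 \<le> v"
  shows "last_ge n (lehmer_code n w) v + v \<le>
    ideal_row (rothe_diagram n w) (last_ge n (lehmer_code n w) v) + count_ge n (lehmer_code n w) v"
proof -
  define j where "j = last_ge n (lehmer_code n w) v"
  have j: "1 \<le> j" "j \<le> n" "v \<le> lehmer_code n w j" using last_ge_in[of i n v "lehmer_code n w", OF i] by (auto simp: j_def)
  let ?S = "{l. j < l \<and> l \<le> n \<and> w l < w j}"
  have fin: "finite (w ` ?S)" using finite_code_set by blast
  have "0 < card ?S" using j(3) v unfolding lehmer_code_def by linarith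
  then have "?S \<noteq> {}" by (metis card.empty less_irrefl)
  then have "Max (w ` ?S) \<in> w ` ?S" using fin by (intro Max_in) auto
  then obtain l0 where l0: "l0 \<in> ?S" "w l0 = Max (w ` ?S)" by auto
  define y where "y = w l0"
  have max: "w l \<le> y" if "l \<in> ?S" for l using Max_ge[OF fin] that l0 by (auto simp: y_def)
  have y: "y \<le> n" using permutes_in_image[OF w, of l0] l0 j by (auto simp: y_def)
  have small: "w a \<le> y" if "a \<in> {1..j}" "lehmer_code n w a < v" for a
  proof (rule ccontr)
    assume "\<not> w a \<le> y"
    have "lehmer_code n w j \<le> lehmer_code n w a"
    proof (rule code_mono, rule subsetI)
      fix l assume l: "l \<in> ?S"
      then show "l \<in> {l. a < l \<and> l \<le> n \<and> w l < w a}" using max[OF l] \<open>\<not> w a \<le> y\<close> that by auto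
    qed
    then show False using that j by simp
  qed
  have "{a \<in> {1..j}. lehmer_code n w a < v} \<union> ?S \<subseteq> {a \<in> {1..n}. w a \<le> y}"
    using small max j by auto
  then have "card ({a \<in> {1..j}. lehmer_code n w a < v} \<union> ?S) \<le> y"
    using card_mono[of "{a \<in> {1..n}. w a \<le> y}"] permutes_card_le[OF w y] by fastforce
  moreover have "card ({a \<in> {1..j}. lehmer_code n w a < v} \<union> ?S) = card {a \<in> {1..j}. lehmer_code n w a < v} + lehmer_code n w j"
    unfolding lehmer_code_def[of n w j] by (subst card_Un_disjoint) (auto simp: finite_code_set)
  moreover have "y \<le> ideal_row (rothe_diagram n w) j"
  proof (rule ideal_row_ge[OF finite_rothe])
    show "(j, y) \<in> rothe_diagram n w"
      unfolding rothe_iff by (rule exI[of _ l0]) (use l0(1) j in \<open>simp add: y_def\<close>)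
  qed simp
  moreover have "card {a \<in> {1..j}. lehmer_code n w a < v} + count_ge n (lehmer_code n w) v = j"
    unfolding j_def by (rule count_small_before_last[of i n v "lehmer_code n w", OF i])
  ultimately show ?thesis using j unfolding j_def[symmetric] by linarith
qed

text \<open>Let \<open>y\<close> be the column of a cell in a row below \<open>j\<close>. A position
  with value at most \<open>y\<close> has code less than \<open>v\<close>; it lies up to
  \<open>j\<close>, or it is an inversion of the position \<open>i\<close>, which has exactly
  \<open>v\<close> of them. Counting both kinds bounds \<open>y\<close>.\<close>

lemma ideal_row_after_last:
  assumes w: "w permutes {1..n}" and vex: "vexillary n w" and i: "1 \<le> i" "i \<le> n" "lehmer_code n w i = v"
  shows "ideal_row (rothe_diagram n w) (Suc (last_ge n (lehmer_code n w) v)) + count_ge n (lehmer_code n w) v \<le>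
    last_ge n (lehmer_code n w) v + v"
proof -
  define j where "j = last_ge n (lehmer_code n w) v"
  have inj: "w a = w b \<longleftrightarrow> a = b" for a b using permutes_inj[OF w] by (auto simp: inj_eq)
  have count: "card {a \<in> {1..j}. lehmer_code n w a < v} + count_ge n (lehmer_code n w) v = j"
    unfolding j_def by (rule count_small_before_last[of i]) (use i in auto)
  have ij: "a \<le> j" if "1 \<le> a" "a \<le> n" "v \<le> lehmer_code n w a" for a
    unfolding j_def by (rule last_ge_ge[of a n v "lehmer_code n w", OF that])
  have jn: "j \<le> n" unfolding j_def by (rule last_ge_in[of i]) (use i in auto)
  have "ideal_row (rothe_diagram n w) (Suc j) + count_ge n (lehmer_code n w) v \<le> j + v"
  proof (rule ideal_row_cases[OF finite_rothe[of n w], of "Suc j"])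
    fix b assume b: "Suc j \<le> b" "(b, ideal_row (rothe_diagram n w) (Suc j)) \<in> rothe_diagram n w"
    define y where "y = ideal_row (rothe_diagram n w) (Suc j)"
    obtain l where l: "y = w l" "1 \<le> b" "b < l" "l \<le> n" "w l < w b"
      using b(2) unfolding rothe_iff y_def[symmetric] by auto
    have yn: "y \<le> n" using permutes_in_image[OF w, of l] l by auto
    have cb: "lehmer_code n w b < v" using ij[of b] b(1) l by (cases "v \<le> lehmer_code n w b") auto
    \<comment> \<open>Otherwise \<open>a\<close>, having the larger code, has an inversion
      \<open>x\<close> that \<open>b\<close> lacks. Then \<open>x < b\<close>, and
      \<open>a, x, b, l\<close> form the pattern 2143.\<close>
    have large: "y < w a" if a: "1 \<le> a" "a \<le> n" "v \<le> lehmer_code n w a" for a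
    proof (rule ccontr)
      assume "\<not> y < w a"
      have ab: "a < b" using ij[OF a] b(1) by simp
      have "w a \<noteq> y" using inj[of a l] ab l by auto
      then have ay: "w a < w l" using \<open>\<not> y < w a\<close> l by simp
      have "\<not> {x. a < x \<and> x \<le> n \<and> w x < w a} \<subseteq> {x. b < x \<and> x \<le> n \<and> w x < w b}"
        using code_mono[of a n w b] cb a by auto
      then obtain x where x: "a < x" "x \<le> n" "w x < w a" "\<not> (b < x \<and> w x < w b)" by auto
      have "w x < w b" using x ay l by simp
      then have "x < b" using x inj[of x b] by auto
      then show False using vexillaryD[OF vex a(1) x(1) _ l(3,4) x(3) ay l(5)] by blast
    qed
    have small_values: "{a \<in> {1..n}. w a \<le> y} \<subseteq> {a \<in> {1..j}. lehmer_code n w a < v} \<union> {x. i < x \<and> x \<le> n \<and> w x < w i}"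
    proof
      fix a assume a: "a \<in> {a \<in> {1..n}. w a \<le> y}"
      then have ca: "lehmer_code n w a < v" using large[of a] by (cases "v \<le> lehmer_code n w a") auto
      show "a \<in> {a \<in> {1..j}. lehmer_code n w a < v} \<union> {x. i < x \<and> x \<le> n \<and> w x < w i}"
      proof (cases "a \<le> j")
        case True
        then show ?thesis using a ca by simp
      next
        case False
        then show ?thesis using a ij[of i] large[of i] i by auto
      qed
    qed
    have "card {a \<in> {1..n}. w a \<le> y} \<le>
        card ({a \<in> {1..j}. lehmer_code n w a < v} \<union> {x. i < x \<and> x \<le> n \<and> w x < w i})"
      by (rule card_mono[OF _ small_values]) (use finite_code_set in auto)
    then have "y \<le> card ({a \<in> {1..j}. lehmer_code n w a < v} \<union> {x. i < x \<and> x \<le> n \<and> w x < w i})"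
      unfolding permutes_card_le[OF w yn] .
    also have "\<dots> \<le> card {a \<in> {1..j}. lehmer_code n w a < v} + v"
      using card_Un_le[of "{a \<in> {1..j}. lehmer_code n w a < v}" "{x. i < x \<and> x \<le> n \<and> w x < w i}"] i
      by (simp add: lehmer_code_def)
    finally show ?thesis using count unfolding y_def by linarith
  qed (use count in simp)
  then show ?thesis by (simp add: j_def)
qed

definition exit_row :: "(nat \<Rightarrow> nat) \<Rightarrow> (nat \<Rightarrow> nat) \<Rightarrow> nat \<Rightarrow> nat" where
  "exit_row l m r = (LEAST p. r \<le> p \<and> l (Suc p) + r \<le> p + m r)"

lemma exit_row:
  assumes l: "is_part N l"
  shows "r \<le> exit_row l m r" "l (Suc (exit_row l m r)) + r \<le> exit_row l m r + m r"
proof -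
  have "r \<le> exit_row l m r \<and> l (Suc (exit_row l m r)) + r \<le> exit_row l m r + m r"
    unfolding exit_row_def by (rule LeastI[of _ "r + N"]) (simp add: is_part_zero[OF l])
  then show "r \<le> exit_row l m r" "l (Suc (exit_row l m r)) + r \<le> exit_row l m r + m r" by auto
qed

lemma exit_row_le: "r \<le> p \<Longrightarrow> l (Suc p) + r \<le> p + m r \<Longrightarrow> exit_row l m r \<le> p"
  unfolding exit_row_def by (rule Least_le) simp

lemma diag_flag_exit_row:
  assumes l: "is_part N l" and sub: "\<And>i. 1 \<le> i \<Longrightarrow> m i \<le> l i"
  shows "diag_flag l m (exit_row l m)"
  unfolding diag_flag_def
proof (intro allI impI)
  fix r assume r: "1 \<le> r" "1 \<le> m r"
  let ?p = "exit_row l m r"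
  have "?p + m r \<le> l ?p + r"
  proof (cases "?p = r")
    case True
    then show ?thesis using sub[OF r(1)] by simp
  next
    case False
    then have "r \<le> ?p - 1" "Suc (?p - 1) = ?p" using exit_row(1)[OF l, where r = r and m = m] by auto
    then show ?thesis using exit_row_le[of r "?p - 1" l m] by (cases "l ?p + r \<le> ?p - 1 + m r") auto
  qed
  then show "r \<le> ?p \<and> ?p + m r \<le> l ?p + r \<and> l (Suc ?p) + r \<le> ?p + m r"
    using exit_row[OF l, where r = r and m = m] by simp
qed

text \<open>The ends of two equal consecutive rows lie on neighbouring diagonals, and the lower
  diagonal leaves \<open>l\<close> in the same row or one row later.\<close>

lemma ramp_flag_exit_row:
  assumes l: "is_part N l"
  shows "ramp_flag m (exit_row l m)"
  unfolding ramp_flag_def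
proof (intro allI impI conjI)
  fix r assume r: "1 \<le> r" "1 \<le> m r" "m (Suc r) = m r"
  show "exit_row l m r \<le> exit_row l m (Suc r)"
    by (rule exit_row_le) (use exit_row[OF l, where r = "Suc r" and m = m] r in auto)
  show "exit_row l m (Suc r) \<le> Suc (exit_row l m r)"
    by (rule exit_row_le)
      (use exit_row[OF l, where r = r and m = m] is_partD[OF l, of "Suc (exit_row l m r)" "Suc (Suc (exit_row l m r))"] r in auto)
qed

theorem theorem5p4:
  fixes n :: nat and w :: "nat \<Rightarrow> nat" and lam mu :: "nat list"
  assumes "w permutes {1..n}"
    and "vexillary n w"
    and "mu = shape n w"
    and "lam = supershape n w"
  shows "zpoly_eval (schubert n w) (\<lambda>_. 1) = int (card (excited_diagrams lam mu))"
proof -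
  note w = assms(1) and vex = assms(2)
  let ?c = "lehmer_code n w"
  define m where "m = rows mu"
  define l where "l = ideal_row (rothe_diagram n w)"
  have m: "is_sorting n ?c m" unfolding m_def assms(3) by (rule shape_is_sorting[OF w])
  have mp: "is_part n m" by (rule is_sorting_is_part[OF m])
  have lp: "is_part n l" unfolding l_def by (rule rothe_is_part)
  have mu: "young_diagram mu = cells m" by (simp add: young_diagram_rows m_def)
  have lam: "young_diagram lam = cells l" using young_supershape[OF w] by (simp add: assms(4) l_def)
  have le_count: "r \<le> count_ge n ?c (m r)" if "1 \<le> r" "1 \<le> m r" for r
    using is_sortingD[OF m that(1), of "m r"] that by simp
  have count_last: "count_ge n ?c (m r) \<le> last_ge n ?c (m r)" if r: "1 \<le> r" "1 \<le> m r" for r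
  proof -
    obtain i where i: "1 \<le> i" "i \<le> n" "?c i = m r" by (rule is_sorting_occurs[OF m r])
    have "card {a \<in> {1..last_ge n ?c (m r)}. ?c a < m r} + count_ge n ?c (m r) = last_ge n ?c (m r)"
      by (rule count_small_before_last[of i]) (use i in auto)
    then show ?thesis by linarith
  qed
  have at_last: "last_ge n ?c (m r) + m r \<le> l (last_ge n ?c (m r)) + count_ge n ?c (m r)"
    if r: "1 \<le> r" "1 \<le> m r" for r
  proof -
    obtain i where i: "1 \<le> i" "i \<le> n" "?c i = m r" by (rule is_sorting_occurs[OF m r])
    then show ?thesis using ideal_row_at_last[OF w i(1,2), of "m r"] r by (simp add: l_def)
  qed
  have sub: "m r \<le> l r" if "1 \<le> r" for r
  proof (cases "m r = 0")
    case False
    then have r: "1 \<le> r" "1 \<le> m r" using that by auto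
    \<comment> \<open>Row \<open>r\<close> of \<open>l\<close> is at least as long as the row at the
      last position, and the length of the latter is bounded below by
      \<open>at_last\<close>.\<close>
    have "l (last_ge n ?c (m r)) \<le> l r"
      using is_partD[OF lp that] le_count[OF r] count_last[OF r] by simp
    then show ?thesis using at_last[OF r] count_last[OF r] by simp
  qed simp
  define f where "f = exit_row l m"
  have f: "diag_flag l m f" unfolding f_def by (rule diag_flag_exit_row[OF lp sub])
  have "fdet (\<lambda>_. 1::int) n m (\<lambda>r. last_ge n ?c (m r)) = fdet (\<lambda>_. 1) n m f"
  proof (rule fdet_ramp_flag_eq[OF mp])
    show "ramp_flag m (\<lambda>r. last_ge n ?c (m r))" by (simp add: ramp_flag_def)
    show "ramp_flag m f" unfolding f_def by (rule ramp_flag_exit_row[OF lp])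
    \<comment> \<open>At a block end \<open>count_ge\<close> equals \<open>r\<close>, so
      \<open>at_last\<close> and the bound in the following row say that the diagonal of row
      \<open>r\<close> leaves \<open>l\<close> exactly at the last position.\<close>
    fix r assume r: "1 \<le> r" "m (Suc r) < m r"
    then have mr: "1 \<le> m r" by simp
    have count: "count_ge n ?c (m r) = r" by (rule is_sorting_block_end[OF m r])
    obtain i where i: "1 \<le> i" "i \<le> n" "?c i = m r" by (rule is_sorting_occurs[OF m r(1) mr])
    have "l (Suc (last_ge n ?c (m r))) + r \<le> last_ge n ?c (m r) + m r"
      using ideal_row_after_last[OF w vex i] count by (simp add: l_def)
    then have "f r = last_ge n ?c (m r)"
      using diag_flag_unique[OF lp f r(1) mr] at_last[OF r(1) mr] count_last[OF r(1) mr] count by simp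
    then show "last_ge n ?c (m r) = f r" by simp
  qed
  also have "\<dots> = int (card (excitations l m))"
    by (rule card_excitations_eq_fdet[OF mp lp sub f, symmetric])
  also have "card (excitations l m) = card (excited_diagrams lam mu)"
  proof (rule card_excited_diagrams[OF mp lp _ lam mu, symmetric])
    show "cells m \<subseteq> cells l" using sub by (auto simp: cells_def intro: order_trans)
  qed
  finally have count: "fdet (\<lambda>_. 1) n m (\<lambda>r. last_ge n ?c (m r)) = int (card (excited_diagrams lam mu))" .
  have "schubert n w = fdet var n m (\<lambda>r. last_ge n ?c (m r))"
    by (rule schubert_eqI[OF is_schubert_vexillary[OF w vex m]])
  moreover have "zpoly_eval (fdet var n m (\<lambda>r. last_ge n ?c (m r))) (\<lambda>_. 1) =
      fdet (\<lambda>i. zpoly_eval (var i) (\<lambda>_. 1)) n m (\<lambda>r. last_ge n ?c (m r))"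
    by (rule fdet_hom[OF comm_ring_hom_zpoly_eval_ones])
  ultimately show ?thesis using count by (simp add: var_def zpoly_eval_ones_single)
qed

end
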